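(* Let $u$ be an inner function and let $A^u_\phi\in\mathcal{T}_u$ be a truncated Toeplitz operator on $K^2_u$. Then the following are equivalent: (i) $A^u_\phi$ is normal. (ii) $A^u_\phi (A^u_\phi)^*-(A^u_\phi)^*A^u_\phi\in\mathcal{T}_u$. (iii) One of the following is true: (1) there exists $\alpha\in\mathbb{T}$ such that $A^u_\phi$ belongs to $\mathcal{B}^\alpha_u$; (2) $A^u_\phi$ is a linear combination (with complex coefficients) of a selfadjoint truncated Toeplitz operator on $K^2_u$ and the identity.
   Context: $\mathbb{T}$ is the unit circle. The Hardy space $H^2$ is viewed as a closed subspace of $L^2(\mathbb{T})$ via boundary values. For an inner function $u$, the model space is $K^2_u=H^2\ominus uH^2$, and $P_{K^2_u}$ is the orthogonal projection of $L^2(\mathbb{T})$ onto it. Truncated Toeplitz operators: $K^2_u\cap H^\infty$ is dense in $K^2_u$. If $\phi\in L^2(\mathbb{T})$ and the map $f\mapsto P_{K^2_u}(\phi f)$, defined on $K^2_u\cap H^\infty$, extends to a bounded operator on $K^2_u$, this extension is denoted $A^u_\phi$ and called the truncated Toeplitz operator with symbol $\phi$ (the symbol is not unique). $\mathcal{T}_u$ is the set of all (bounded) truncated Toeplitz operators on $K^2_u$; it is a linear subspace of the bounded operators on $K^2_u$. $S_u=A^u_z$ is the compression of multiplication by $z$. Conjugation: for $f\in K^2_u$, $\tilde f=u\bar z\bar f$ (on $\mathbb{T}$); this maps $K^2_u$ bijectively to itself. Sedlock classes: for $\alpha\in\mathbb{C}$, $\mathcal{B}^\alpha_u$ is the set of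 operators in $\mathcal{T}_u$ that have a symbol of the form $\phi+\alpha\overline{S_u\tilde\phi}+c$ with $\phi\in K^2_u$ and $c\in\mathbb{C}$. *)

theory Defs
  imports "HOL-Analysis.Analysis"
begin

section \<open>The complex Hilbert space \<open>L\<^sup>2(\<T>)\<close>\<close>

text \<open>Normalized arc length. Its underlying space is the unit circle and not the whole plane, so
  the values of a function off the circle are irrelevant for measurability.\<close>

definition circle_measure :: "complex measure" where
  "circle_measure =
     distr (uniform_measure lborel {0..2 * pi}) (restrict_space borel (sphere 0 1)) cis"

definition square_integrable :: "(complex \<Rightarrow> complex) \<Rightarrow> bool" where
  "square_integrable f \<longleftrightarrow>
     f \<in> borel_measurable circle_measure \<and> integrable circle_measure (\<lambda>z. (cmod (f z))\<^sup>2)"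

definition l2_rel :: "(complex \<Rightarrow> complex) \<Rightarrow> (complex \<Rightarrow> complex) \<Rightarrow> bool" where
  "l2_rel f g \<longleftrightarrow>
     square_integrable f \<and> square_integrable g \<and> (AE z in circle_measure. f z = g z)"

lemma square_integrable_measurable [measurable_dest]:
  "square_integrable f \<Longrightarrow> f \<in> borel_measurable circle_measure"
  by (simp add: square_integrable_def)

lemma square_integrable_zero [simp]: "square_integrable (\<lambda>_. 0)"
  by (simp add: square_integrable_def)

lemma square_integrable_dominated:
  assumes g: "integrable circle_measure g" and f: "f \<in> borel_measurable circle_measure"
    and le: "\<And>z. (cmod (f z))\<^sup>2 \<le> g z"
  shows "square_integrable f"
  unfolding square_integrable_def
proof
  show "integrable circle_measure (\<lambda>z. (cmod (f z))\<^sup>2)"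
  proof (rule Bochner_Integration.integrable_bound[OF g])
    show "(\<lambda>z. (cmod (f z))\<^sup>2) \<in> borel_measurable circle_measure"
      using f by measurable
    show "AE z in circle_measure. norm ((cmod (f z))\<^sup>2) \<le> norm (g z)"
      using le by (intro always_eventually) (auto intro: order_trans[OF _ abs_ge_self])
  qed
qed (fact f)

lemma square_integrable_add:
  assumes f: "square_integrable f" and g: "square_integrable g"
  shows "square_integrable (\<lambda>z. f z + g z)"
proof (rule square_integrable_dominated)
  show "integrable circle_measure (\<lambda>z. 2 * (cmod (f z))\<^sup>2 + 2 * (cmod (g z))\<^sup>2)"
    using f g unfolding square_integrable_def by auto
  show "(\<lambda>z. f z + g z) \<in> borel_measurable circle_measure"
    using f g by measurable
  fix z
  have "(cmod (f z + g z))\<^sup>2 \<le> (cmod (f z) + cmod (g z))\<^sup>2"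
    by (intro power_mono norm_triangle_ineq) auto
  also have "\<dots> \<le> 2 * (cmod (f z))\<^sup>2 + 2 * (cmod (g z))\<^sup>2"
    using zero_le_power2[of "cmod (f z) - cmod (g z)"] by (simp add: power2_eq_square algebra_simps)
  finally show "(cmod (f z + g z))\<^sup>2 \<le> 2 * (cmod (f z))\<^sup>2 + 2 * (cmod (g z))\<^sup>2" .
qed

lemma square_integrable_scale:
  assumes f: "square_integrable f"
  shows "square_integrable (\<lambda>z. c * f z)"
  using f by (auto simp: square_integrable_def norm_mult power_mult_distrib)

lemma square_integrable_uminus:
  "square_integrable f \<Longrightarrow> square_integrable (\<lambda>z. - f z)"
  by (simp add: square_integrable_def)

lemma square_integrable_diff:
  assumes f: "square_integrable f" and g: "square_integrable g"
  shows "square_integrable (\<lambda>z. f z - g z)"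
  using square_integrable_add[OF f square_integrable_uminus[OF g]] by simp

lemma square_integrable_cnj:
  assumes "square_integrable f"
  shows "square_integrable (\<lambda>z. cnj (f z))"
proof -
  have "(\<lambda>z. cnj (f z)) \<in> borel_measurable circle_measure"
    using assms
    by (intro borel_measurable_continuous_on[where f = cnj]) (auto simp: square_integrable_def)
  then show ?thesis
    using assms by (auto simp: square_integrable_def)
qed

lemma integrable_mult_cnj:
  assumes f: "square_integrable f" and g: "square_integrable g"
  shows "integrable circle_measure (\<lambda>z. f z * cnj (g z))"
proof (rule Bochner_Integration.integrable_bound)
  show "integrable circle_measure (\<lambda>z. (cmod (f z))\<^sup>2 + (cmod (g z))\<^sup>2)"
    using f g unfolding square_integrable_def by auto
  show "(\<lambda>z. f z * cnj (g z)) \<in> borel_measurable circle_measure"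
    using f square_integrable_cnj[OF g] by measurable
  have "cmod (f z) * cmod (g z) \<le> (cmod (f z))\<^sup>2 + (cmod (g z))\<^sup>2" for z
    using sum_squares_bound[of "cmod (f z)" "cmod (g z)"]
      mult_nonneg_nonneg[OF norm_ge_zero norm_ge_zero, of "f z" "g z"] by linarith
  then show "AE z in circle_measure. cmod (f z * cnj (g z)) \<le> norm ((cmod (f z))\<^sup>2 + (cmod (g z))\<^sup>2)"
    by (intro always_eventually) (auto simp: norm_mult)
qed

lemma square_integrable_cong_AE:
  assumes "f \<in> borel_measurable circle_measure" "g \<in> borel_measurable circle_measure"
    and "AE z in circle_measure. f z = g z"
  shows "square_integrable f \<longleftrightarrow> square_integrable g"
proof -
  have "integrable circle_measure (\<lambda>z. (cmod (f z))\<^sup>2) \<longleftrightarrow>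
        integrable circle_measure (\<lambda>z. (cmod (g z))\<^sup>2)"
    using assms by (intro integrable_cong_AE) auto
  then show ?thesis
    using assms by (simp add: square_integrable_def)
qed

quotient_type ltwo = "complex \<Rightarrow> complex" / partial: l2_rel
proof (rule part_equivpI)
  show "\<exists>f. l2_rel f f"
    by (auto simp: l2_rel_def intro!: exI[of _ "\<lambda>_. 0"])
  show "symp l2_rel"
    by (auto simp: symp_def l2_rel_def)
  show "transp l2_rel"
    by (auto simp: transp_def l2_rel_def)
qed

lift_definition l2_scale :: "complex \<Rightarrow> ltwo \<Rightarrow> ltwo"  (infixr "*\<^sub>C" 75)
  is "\<lambda>c f z. c * f z"
  by (auto simp: l2_rel_def square_integrable_scale)

lift_definition l2_cinner :: "ltwo \<Rightarrow> ltwo \<Rightarrow> complex"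
  is "\<lambda>f g. LINT z|circle_measure. f z * cnj (g z)"
proof -
  fix f f' g g'
  assume *: "l2_rel f f'" "l2_rel g g'"
  then have "integrable circle_measure (\<lambda>z. f z * cnj (g z))"
    "integrable circle_measure (\<lambda>z. f' z * cnj (g' z))"
    by (auto simp: l2_rel_def integrable_mult_cnj)
  with * show "(LINT z|circle_measure. f z * cnj (g z)) = (LINT z|circle_measure. f' z * cnj (g' z))"
    by (intro integral_cong_AE) (auto simp: l2_rel_def dest: borel_measurable_integrable)
qed

instantiation ltwo :: real_inner
begin

lift_definition zero_ltwo :: ltwo is "\<lambda>_. 0"
  by (simp add: l2_rel_def)

lift_definition plus_ltwo :: "ltwo \<Rightarrow> ltwo \<Rightarrow> ltwo" is "\<lambda>f g z. f z + g z"
  by (auto simp: l2_rel_def square_integrable_add)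

lift_definition uminus_ltwo :: "ltwo \<Rightarrow> ltwo" is "\<lambda>f z. - f z"
  by (auto simp: l2_rel_def square_integrable_uminus)

lift_definition minus_ltwo :: "ltwo \<Rightarrow> ltwo \<Rightarrow> ltwo" is "\<lambda>f g z. f z - g z"
  by (auto simp: l2_rel_def square_integrable_diff)

definition scaleR_ltwo :: "real \<Rightarrow> ltwo \<Rightarrow> ltwo" where
  "scaleR_ltwo r f = complex_of_real r *\<^sub>C f"

definition inner_ltwo :: "ltwo \<Rightarrow> ltwo \<Rightarrow> real" where
  "inner_ltwo f g = Re (l2_cinner f g)"

definition norm_ltwo :: "ltwo \<Rightarrow> real" where
  "norm_ltwo f = sqrt (inner f f)"

definition sgn_ltwo :: "ltwo \<Rightarrow> ltwo" where
  "sgn_ltwo f = scaleR (inverse (norm f)) f"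

definition dist_ltwo :: "ltwo \<Rightarrow> ltwo \<Rightarrow> real" where
  "dist_ltwo f g = norm (f - g)"

definition uniformity_ltwo :: "(ltwo \<times> ltwo) filter" where
  "uniformity_ltwo = (INF e\<in>{0<..}. principal {(f, g). dist f g < e})"

definition open_ltwo :: "ltwo set \<Rightarrow> bool" where
  "open_ltwo U \<longleftrightarrow> (\<forall>f\<in>U. eventually (\<lambda>(f', g). f' = f \<longrightarrow> g \<in> U) uniformity)"

instance
proof
  fix f g h :: ltwo and a b :: real
  show "f + g + h = f + (g + h)"
    by transfer (auto simp: l2_rel_def square_integrable_add algebra_simps)
  show "f + g = g + f"
    by transfer (auto simp: l2_rel_def square_integrable_add algebra_simps)
  show "0 + f = f"
    by transfer (auto simp: l2_rel_def)
  show "- f + f = 0"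
    by transfer (auto simp: l2_rel_def)
  show "f - g = f + - g"
    by transfer (auto simp: l2_rel_def square_integrable_diff)
  show "a *\<^sub>R (f + g) = a *\<^sub>R f + a *\<^sub>R g"
    unfolding scaleR_ltwo_def
    by transfer (auto simp: l2_rel_def distrib_left distrib_right
        intro!: square_integrable_add square_integrable_scale)
  show "(a + b) *\<^sub>R f = a *\<^sub>R f + b *\<^sub>R f"
    unfolding scaleR_ltwo_def
    by transfer (auto simp: l2_rel_def distrib_left distrib_right
        intro!: square_integrable_add square_integrable_scale)
  show "a *\<^sub>R b *\<^sub>R f = (a * b) *\<^sub>R f"
    unfolding scaleR_ltwo_def
    by transfer (auto simp: l2_rel_def mult.assoc
        intro!: square_integrable_scale)
  show "1 *\<^sub>R f = f"
    unfolding scaleR_ltwo_def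
    by transfer (auto simp: l2_rel_def)
  show "dist f g = norm (f - g)"
    by (fact dist_ltwo_def)
  show "sgn f = scaleR (inverse (norm f)) f"
    by (fact sgn_ltwo_def)
  show "uniformity = (INF e\<in>{0<..}. principal {(f, g :: ltwo). dist f g < e})"
    by (fact uniformity_ltwo_def)
  show "open U \<longleftrightarrow> (\<forall>f\<in>U. eventually (\<lambda>(f', g). f' = f \<longrightarrow> g \<in> U) uniformity)" for U :: "ltwo set"
    by (fact open_ltwo_def)
  show "norm f = sqrt (inner f f)"
    by (fact norm_ltwo_def)
  show "inner f g = inner g f"
    unfolding inner_ltwo_def
  proof transfer
    fix f g
    assume "l2_rel f f" "l2_rel g g"
    have "(LINT z|circle_measure. cnj (g z * cnj (f z))) = cnj (LINT z|circle_measure. g z * cnj (f z))"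
      using \<open>l2_rel f f\<close> \<open>l2_rel g g\<close>
      by (intro integral_bounded_linear bounded_linear_cnj integrable_mult_cnj) (auto simp: l2_rel_def)
    moreover have "(\<lambda>z. cnj (g z * cnj (f z))) = (\<lambda>z. f z * cnj (g z))"
      by (simp add: mult.commute)
    ultimately show "Re (LINT z|circle_measure. f z * cnj (g z)) = Re (LINT z|circle_measure. g z * cnj (f z))"
      by simp
  qed
  show "inner (f + g) h = inner f h + inner g h"
    unfolding inner_ltwo_def
    by transfer (simp add: l2_rel_def integrable_mult_cnj distrib_right)
  show "inner (a *\<^sub>R f) g = a * inner f g"
    unfolding inner_ltwo_def scaleR_ltwo_def
    by transfer (simp add: l2_rel_def mult.assoc)
  have *: "Re (LINT z|circle_measure. f z * cnj (f z)) = (LINT z|circle_measure. (cmod (f z))\<^sup>2)" for f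
    by (simp flip: complex_norm_square of_real_power)
  show "0 \<le> inner f f"
    unfolding inner_ltwo_def
    by transfer (simp only: *, simp)
  show "inner f f = 0 \<longleftrightarrow> f = 0"
    unfolding inner_ltwo_def
  proof transfer
    fix f
    assume "l2_rel f f"
    then have f: "square_integrable f"
      by (simp add: l2_rel_def)
    then have "(LINT z|circle_measure. (cmod (f z))\<^sup>2) = 0 \<longleftrightarrow> (AE z in circle_measure. (cmod (f z))\<^sup>2 = 0)"
      by (intro integral_nonneg_eq_0_iff_AE) (auto simp: square_integrable_def)
    with f show "Re (LINT z|circle_measure. f z * cnj (f z)) = 0 \<longleftrightarrow> l2_rel f (\<lambda>_. 0)"
      by (simp only: *) (simp add: l2_rel_def)
  qed
qed

end

text \<open>The class of a function; by convention 0 if the function is not square integrable.\<close>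

lift_definition to_L2 :: "(complex \<Rightarrow> complex) \<Rightarrow> ltwo"
  is "\<lambda>f. if square_integrable f then f else (\<lambda>_. 0)"
  by (simp add: l2_rel_def)

text \<open>Pointwise product; by convention 0 if the product is not in \<open>L\<^sup>2(\<T>)\<close>. Below it is only formed
  when one factor is essentially bounded.\<close>

lift_definition l2_mult :: "ltwo \<Rightarrow> ltwo \<Rightarrow> ltwo"
  is "\<lambda>f g. if square_integrable (\<lambda>z. f z * g z) then (\<lambda>z. f z * g z) else (\<lambda>_. 0)"
proof -
  fix f f' g g'
  assume *: "l2_rel f f'" "l2_rel g g'"
  then have ae: "AE z in circle_measure. f z * g z = f' z * g' z"
    by (auto simp: l2_rel_def)
  from * have "square_integrable (\<lambda>z. f z * g z) \<longleftrightarrow> square_integrable (\<lambda>z. f' z * g' z)"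
    by (intro square_integrable_cong_AE ae borel_measurable_times)
      (auto simp: l2_rel_def square_integrable_def)
  with ae show "l2_rel
      (if square_integrable (\<lambda>z. f z * g z) then (\<lambda>z. f z * g z) else (\<lambda>_. 0))
      (if square_integrable (\<lambda>z. f' z * g' z) then (\<lambda>z. f' z * g' z) else (\<lambda>_. 0))"
    by (simp add: l2_rel_def)
qed

lift_definition l2_cnj :: "ltwo \<Rightarrow> ltwo" is "\<lambda>f z. cnj (f z)"
  by (auto simp: l2_rel_def square_integrable_cnj)

lift_definition l2_unimodular :: "ltwo \<Rightarrow> bool" is "\<lambda>f. AE z in circle_measure. cmod (f z) = 1"
  by (auto simp: l2_rel_def elim: AE_mp)

abbreviation l2_z :: ltwo where
  "l2_z \<equiv> to_L2 (\<lambda>z. z)"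

abbreviation l2_const :: "complex \<Rightarrow> ltwo" where
  "l2_const c \<equiv> to_L2 (\<lambda>_. c)"


section \<open>Operators on subspaces of \<open>L\<^sup>2(\<T>)\<close>\<close>

definition orth_proj :: "ltwo set \<Rightarrow> ltwo \<Rightarrow> ltwo" where
  "orth_proj K f = (THE g. g \<in> K \<and> (\<forall>h\<in>K. l2_cinner (f - g) h = 0))"

text \<open>An operator on a subspace \<open>K\<close> is represented by a total function of which only the values
  on \<open>K\<close> matter; all notions below depend only on these values.\<close>

definition bounded_operator_on :: "ltwo set \<Rightarrow> (ltwo \<Rightarrow> ltwo) \<Rightarrow> bool" where
  "bounded_operator_on K A \<longleftrightarrow>
     (\<forall>f\<in>K. A f \<in> K) \<and>
     (\<forall>f\<in>K. \<forall>g\<in>K. A (f + g) = A f + A g) \<and>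
     (\<forall>c. \<forall>f\<in>K. A (c *\<^sub>C f) = c *\<^sub>C A f) \<and>
     (\<exists>C. \<forall>f\<in>K. norm (A f) \<le> C * norm f)"

definition adjoint_on :: "ltwo set \<Rightarrow> (ltwo \<Rightarrow> ltwo) \<Rightarrow> ltwo \<Rightarrow> ltwo" where
  "adjoint_on K A g = (THE h. h \<in> K \<and> (\<forall>f\<in>K. l2_cinner (A f) g = l2_cinner f h))"

definition normal_on :: "ltwo set \<Rightarrow> (ltwo \<Rightarrow> ltwo) \<Rightarrow> bool" where
  "normal_on K A \<longleftrightarrow> (\<forall>f\<in>K. A (adjoint_on K A f) = adjoint_on K A (A f))"

definition selfadjoint_on :: "ltwo set \<Rightarrow> (ltwo \<Rightarrow> ltwo) \<Rightarrow> bool" where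
  "selfadjoint_on K A \<longleftrightarrow> (\<forall>f\<in>K. adjoint_on K A f = A f)"


section \<open>Hardy spaces, inner functions and model spaces\<close>

definition hardy2_disc :: "(complex \<Rightarrow> complex) set" where
  "hardy2_disc = {F. F holomorphic_on ball 0 1 \<and>
     bdd_above ((\<lambda>r. LINT z|circle_measure. (cmod (F (complex_of_real r * z)))\<^sup>2) ` {0..<1})}"

definition hardy_inf_disc :: "(complex \<Rightarrow> complex) set" where
  "hardy_inf_disc = {F. F holomorphic_on ball 0 1 \<and> bounded (F ` ball 0 1)}"

text \<open>The boundary function of \<open>F\<close> is the limit in \<open>L\<^sup>2(\<T>)\<close> of its dilations \<open>z \<mapsto> F (r z)\<close> as
  \<open>r \<rightarrow> 1\<close>; for \<open>F\<close> in the Hardy space this limit exists and is also the almost everywhere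
  radial limit.\<close>

definition has_boundary_values :: "(complex \<Rightarrow> complex) \<Rightarrow> ltwo \<Rightarrow> bool" where
  "has_boundary_values F f \<longleftrightarrow>
     ((\<lambda>r. to_L2 (\<lambda>z. F (complex_of_real r * z))) \<longlongrightarrow> f) (at_left 1)"

definition hardy2 :: "ltwo set" where
  "hardy2 = {f. \<exists>F\<in>hardy2_disc. has_boundary_values F f}"

definition hardy_inf :: "ltwo set" where
  "hardy_inf = {f. \<exists>F\<in>hardy_inf_disc. has_boundary_values F f}"

definition inner_function :: "ltwo \<Rightarrow> bool" where
  "inner_function u \<longleftrightarrow> u \<in> hardy_inf \<and> l2_unimodular u"

definition model_space :: "ltwo \<Rightarrow> ltwo set" where
  "model_space u = {f \<in> hardy2. \<forall>h\<in>hardy2. l2_cinner f (l2_mult u h) = 0}"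


section \<open>Truncated Toeplitz operators and Sedlock classes\<close>

text \<open>\<open>is_tto u \<phi> A\<close> expresses that \<open>f \<mapsto> P (\<phi> f)\<close> on the bounded functions in the model space
  extends to a bounded operator on the model space, and that \<open>A\<close> is this extension.\<close>

definition is_tto :: "ltwo \<Rightarrow> ltwo \<Rightarrow> (ltwo \<Rightarrow> ltwo) \<Rightarrow> bool" where
  "is_tto u \<phi> A \<longleftrightarrow>
     bounded_operator_on (model_space u) A \<and>
     (\<forall>f \<in> model_space u \<inter> hardy_inf. A f = orth_proj (model_space u) (l2_mult \<phi> f))"

definition ttos :: "ltwo \<Rightarrow> (ltwo \<Rightarrow> ltwo) set" where
  "ttos u = {A. \<exists>\<phi>. is_tto u \<phi> A}"

definition model_shift :: "ltwo \<Rightarrow> ltwo \<Rightarrow> ltwo" where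
  "model_shift u f = orth_proj (model_space u) (l2_mult l2_z f)"

definition model_conj :: "ltwo \<Rightarrow> ltwo \<Rightarrow> ltwo" where
  "model_conj u f = l2_mult u (l2_mult (l2_cnj l2_z) (l2_cnj f))"

definition sedlock_class :: "ltwo \<Rightarrow> complex \<Rightarrow> (ltwo \<Rightarrow> ltwo) set" where
  "sedlock_class u \<alpha> = {A \<in> ttos u. \<exists>\<phi>\<in>model_space u. \<exists>c.
     is_tto u (\<phi> + \<alpha> *\<^sub>C l2_cnj (model_shift u (model_conj u \<phi>)) + l2_const c) A}"

end

theory Submission
  imports Defs "HOL-Complex_Analysis.Complex_Analysis" "HOL-Probability.Probability_Measure"
begin

text \<open>
  Write \<open>K\<close> for the model space, \<open>S\<close> for its shift, \<open>S\<^sup>*\<close> for the backward shift, \<open>C\<close> for the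
  conjugation and \<open>k\<^sub>0\<close> for the projection of the constant 1. After subtracting a multiple of the
  identity, \<open>A\<close> has a symbol \<open>\<psi> + cnj \<eta>\<close> with \<open>\<psi>, \<eta> \<in> K\<close> vanishing at the origin.
  Since \<open>C T C = T\<^sup>*\<close> for every truncated Toeplitz operator \<open>T\<close>, while \<open>C\<close> changes the sign of the
  self-commutator of \<open>A\<close>, that self-commutator is truncated Toeplitz only if it is 0. For the
  description of the normal operators, the displacement equation \<open>A - S A S\<^sup>* = \<psi> \<otimes> k\<^sub>0 + k\<^sub>0 \<otimes> \<eta>\<close>
  leads to a formula for the change of \<open>\<parallel>A\<^sup>* f\<parallel>\<^sup>2 - \<parallel>A f\<parallel>\<^sup>2\<close> under \<open>f \<mapsto> S\<^sup>* f\<close>; with \<open>J f = u cnj f\<close> it is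
  \<open>|\<langle>f, \<psi>\<rangle>|\<^sup>2 + |\<langle>f, J \<psi>\<rangle>|\<^sup>2 - |\<langle>f, \<eta>\<rangle>|\<^sup>2 - |\<langle>f, J \<eta>\<rangle>|\<^sup>2\<close> whenever \<open>f\<close> is orthogonal to \<open>k\<^sub>0\<close>.
  If \<open>A\<close> is normal this rank-two form vanishes, which forces \<open>\<eta> = x \<psi>\<close> (a rotated selfadjoint
  operator) or \<open>\<eta> = y J \<psi>\<close> (a Sedlock class) with a unimodular factor. Conversely, if \<open>\<eta> = y J \<psi>\<close> then
  \<open>\<parallel>A\<^sup>* f\<parallel>\<^sup>2 - \<parallel>A f\<parallel>\<^sup>2\<close> is invariant under \<open>S\<^sup>*\<close>, and it is 0 because the powers of \<open>S\<^sup>*\<close> tend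
  strongly to 0.
\<close>

text \<open>The obstacle is that a symbol may be unbounded, so the symbol describes A only on
  bounded functions. A product of A with its adjoint is therefore never written through symbols.
  Normality is treated as equality of the norms of \<open>A f\<close> and
  \<open>adjoint_on K A f\<close>, and the displacement equation, whose error has rank two, tells
  how each norm changes under one backward shift. The sign change under C has the same source: C is
  isometric and carries A to its adjoint, so passing from f to \<open>C f\<close> exchanges the two
  norms. Vanishing at the origin has two effects. For the symbols it makes J equal to S C, so J maps
  them back into K. For the test vector f it removes the terms containing \<open>A \<eta>\<close>
  and \<open>A' \<psi>\<close>, which is enough for the necessary condition. The converse needs
  every f in K, and there these terms must agree: they do because |\<eta>| = |\<psi>| on the circle.
  The Hardy space is given by boundary values of functions on the disc. It is first translated into
  vanishing negative Fourier coefficients, and only this description is used for operators.\<close>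

section \<open>Normalized arc length\<close>

notation l2_mult (infixl "\<odot>" 70)
notation l2_cinner ("\<langle>_, _\<rangle>")

lemma space_circle_measure [simp]: "space circle_measure = sphere 0 1"
  by (simp add: circle_measure_def space_restrict_space)

lemma sets_circle_measure: "sets circle_measure = sets (restrict_space borel (sphere 0 1))"
  by (simp add: circle_measure_def)

lemma measurable_cis:
  "cis \<in> uniform_measure lborel {0..2 * pi} \<rightarrow>\<^sub>M restrict_space borel (sphere 0 1)"
proof (rule measurable_restrict_space2)
  have "continuous_on UNIV cis" by (intro continuous_intros)
  then show "cis \<in> uniform_measure lborel {0..2 * pi} \<rightarrow>\<^sub>M borel"
    by (simp add: borel_measurable_continuous_onI uniform_measure_def)
qed auto

lemma prob_space_circle_measure: "prob_space circle_measure"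
  unfolding circle_measure_def
proof (rule prob_space.prob_space_distr[OF _ measurable_cis])
  show "prob_space (uniform_measure lborel {0..2 * pi})"
    by (rule prob_space_uniform_measure) auto
qed

interpretation circle: prob_space circle_measure
  by (rule prob_space_circle_measure)

lemma measurable_circle_continuous:
  fixes f :: "complex \<Rightarrow> 'a::topological_space"
  assumes "continuous_on (sphere 0 1) f"
  shows "f \<in> borel_measurable circle_measure"
proof -
  have "f \<in> borel_measurable (restrict_space borel (sphere 0 1))"
    by (rule borel_measurable_continuous_on_restrict[OF assms])
  also have "\<dots> = borel_measurable circle_measure"
    by (rule measurable_cong_sets) (simp_all add: sets_circle_measure)
  finally show ?thesis .
qed

lemma circle_integral_eq:
  fixes f :: "complex \<Rightarrow> complex"
  assumes "continuous_on (sphere 0 1) f"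
  shows "(LINT z|circle_measure. f z) = integral {0..2*pi} (\<lambda>t. f (cis t)) / (2 * pi)"
proof -
  have f: "f \<in> borel_measurable (restrict_space borel (sphere 0 1))"
    by (rule borel_measurable_continuous_on_restrict[OF assms])
  have cont: "continuous_on {0..2*pi} (\<lambda>t. f (cis t))"
    by (intro continuous_on_compose2[OF assms] continuous_intros) auto
  have meas: "(\<lambda>t. f (cis t)) \<in> borel_measurable lborel"
  proof -
    have "continuous_on UNIV (\<lambda>t. f (cis t))"
      by (intro continuous_on_compose2[OF assms] continuous_intros) auto
    then show ?thesis by (simp add: borel_measurable_continuous_onI)
  qed
  have eq: "uniform_measure lborel {0..2*pi} =
      density lborel (\<lambda>t. ennreal (indicator {0..2*pi} t / (2*pi)))"
    unfolding uniform_measure_def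
    by (intro density_cong) (auto simp: divide_ennreal[symmetric] indicator_def split: if_splits)
  have "(LINT z|circle_measure. f z) = (LINT t|uniform_measure lborel {0..2*pi}. f (cis t))"
    unfolding circle_measure_def by (rule integral_distr[OF measurable_cis f])
  also have "\<dots> = (LINT t|lborel. (indicator {0..2*pi} t / (2*pi)) *\<^sub>R f (cis t))"
    unfolding eq by (rule integral_density[OF meas]) auto
  also have "\<dots> = (LINT t|lborel. (1 / (2*pi)) *\<^sub>R (indicator {0..2*pi} t *\<^sub>R f (cis t)))"
    by (intro Bochner_Integration.integral_cong) auto
  also have "\<dots> = (1 / (2*pi)) *\<^sub>R (LINT t:{0..2*pi}|lborel. f (cis t))"
    unfolding set_lebesgue_integral_def by (rule integral_scaleR_right)
  also have "(LINT t:{0..2*pi}|lborel. f (cis t)) = integral {0..2*pi} (\<lambda>t. f (cis t))"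
    by (rule set_borel_integral_eq_integral(2)[OF borel_integrable_atLeastAtMost'[OF cont]])
  finally show ?thesis by (simp add: scaleR_conv_of_real)
qed

lemma circle_integral_power:
  assumes "n > 0"
  shows "(LINT z|circle_measure. z ^ n) = 0"
proof -
  have "((\<lambda>t. cis t ^ n) has_integral
      (cis (real n * (2*pi)) / (\<i> * n) - cis (real n * 0) / (\<i> * n))) {0..2*pi}"
  proof (rule fundamental_theorem_of_calculus)
    fix x assume "x \<in> {0..2*pi}"
    have "((\<lambda>t. cis (real n * t) / (\<i> * n)) has_vector_derivative
        ((real n) *\<^sub>R (\<i> * cis (real n * x)) / (\<i> * n))) (at x within {0..2*pi})"
      by (rule derivative_eq_intros refl | simp add: has_vector_derivative_def)+
         (auto simp: has_vector_derivative_def cis_conv_exp intro!: derivative_eq_intros)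
    then show "((\<lambda>t. cis (real n * t) / (\<i> * n)) has_vector_derivative cis x ^ n)
        (at x within {0..2*pi})"
      unfolding Complex.DeMoivre using assms by (simp add: scaleR_conv_of_real)
  qed simp
  moreover have "cis (real n * (2*pi)) = 1"
    using cis_multiple_2pi[of "real n"] by (simp add: mult_ac)
  ultimately have "integral {0..2*pi} (\<lambda>t. cis t ^ n) = 0"
    by (auto dest!: integral_unique)
  then show ?thesis
    by (subst circle_integral_eq) (auto intro!: continuous_intros)
qed

lemma square_integrable_mult_bounded:
  assumes f: "f \<in> borel_measurable circle_measure" "AE z in circle_measure. cmod (f z) \<le> M"
    and g: "square_integrable g"
  shows "square_integrable (\<lambda>z. f z * g z)"
  unfolding square_integrable_def
proof
  show meas: "(\<lambda>z. f z * g z) \<in> borel_measurable circle_measure"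
    using f g by measurable
  show "integrable circle_measure (\<lambda>z. (cmod (f z * g z))\<^sup>2)"
  proof (rule Bochner_Integration.integrable_bound)
    show "integrable circle_measure (\<lambda>z. M\<^sup>2 * (cmod (g z))\<^sup>2)"
      using g by (simp add: square_integrable_def)
    show "AE z in circle_measure. norm ((cmod (f z * g z))\<^sup>2) \<le> norm (M\<^sup>2 * (cmod (g z))\<^sup>2)"
      using f(2) by eventually_elim
        (auto simp: norm_mult power_mult_distrib intro!: mult_right_mono power_mono)
  qed (use meas in measurable)
qed

lemma square_integrable_bounded:
  assumes "f \<in> borel_measurable circle_measure" "AE z in circle_measure. cmod (f z) \<le> M"
  shows "square_integrable f"
  using square_integrable_mult_bounded[OF assms, of "\<lambda>_. 1"] by (simp add: square_integrable_def)

lemma circle_continuous_bounded: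
  fixes f :: "complex \<Rightarrow> complex"
  assumes "continuous_on (sphere 0 1) f"
  shows "\<exists>M. AE z in circle_measure. cmod (f z) \<le> M"
proof -
  have "bounded (f ` sphere 0 1)"
    by (intro compact_imp_bounded compact_continuous_image assms) auto
  then obtain M where "\<And>z. z \<in> sphere 0 1 \<Longrightarrow> cmod (f z) \<le> M"
    unfolding bounded_iff by blast
  then show ?thesis by (intro exI[of _ M] AE_I2) auto
qed

lemma square_integrable_continuous:
  assumes "continuous_on (sphere 0 1) f"
  shows "square_integrable f"
  using circle_continuous_bounded[OF assms] measurable_circle_continuous[OF assms]
  by (auto intro: square_integrable_bounded)

section \<open>Algebra in \<open>L\<^sup>2(\<T>)\<close>\<close>

text \<open>The type class supplies real scalars only; the laws for complex scaling come from this
  interpretation.\<close>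

interpretation l2: vector_space l2_scale
proof
  fix a b :: complex and f g :: ltwo
  show "a *\<^sub>C (f + g) = a *\<^sub>C f + a *\<^sub>C g"
    by transfer (auto simp: l2_rel_def distrib_left intro!: square_integrable_add square_integrable_scale)
  show "(a + b) *\<^sub>C f = a *\<^sub>C f + b *\<^sub>C f"
    by transfer (auto simp: l2_rel_def distrib_right intro!: square_integrable_add square_integrable_scale)
  show "a *\<^sub>C b *\<^sub>C f = (a * b) *\<^sub>C f"
    by transfer (auto simp: l2_rel_def mult.assoc intro!: square_integrable_scale)
  show "1 *\<^sub>C f = f"
    by transfer (auto simp: l2_rel_def)
qed

lemma scaleR_eq_scaleC: "r *\<^sub>R (f :: ltwo) = complex_of_real r *\<^sub>C f"
  by (fact scaleR_ltwo_def)

lemma cinner_add_left: "\<langle>f + g, h\<rangle> = \<langle>f, h\<rangle> + \<langle>g, h\<rangle>"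
  by transfer (simp add: l2_rel_def integrable_mult_cnj distrib_right)

lemma cinner_scale_left [simp]: "\<langle>c *\<^sub>C f, h\<rangle> = c * \<langle>f, h\<rangle>"
  by transfer (simp add: mult.assoc)

lemma cinner_commute: "\<langle>f, g\<rangle> = cnj \<langle>g, f\<rangle>"
proof transfer
  fix f g
  assume "l2_rel f f" "l2_rel g g"
  then have "(LINT z|circle_measure. cnj (g z * cnj (f z))) = cnj (LINT z|circle_measure. g z * cnj (f z))"
    by (intro integral_bounded_linear bounded_linear_cnj integrable_mult_cnj) (auto simp: l2_rel_def)
  then show "(LINT z|circle_measure. f z * cnj (g z)) = cnj (LINT z|circle_measure. g z * cnj (f z))"
    by (simp add: mult.commute)
qed

lemma cinner_scale_right [simp]: "\<langle>f, c *\<^sub>C h\<rangle> = cnj c * \<langle>f, h\<rangle>"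
  by (metis cinner_commute cinner_scale_left complex_cnj_mult)

lemma cinner_add_right: "\<langle>f, g + h\<rangle> = \<langle>f, g\<rangle> + \<langle>f, h\<rangle>"
  by (metis cinner_commute cinner_add_left complex_cnj_add)

lemma cinner_zero_left [simp]: "\<langle>0, f\<rangle> = 0"
  using cinner_scale_left[of 0 0 f] by simp

lemma cinner_zero_right [simp]: "\<langle>f, 0\<rangle> = 0"
  using cinner_scale_right[of f 0 0] by simp

lemma cinner_minus_left [simp]: "\<langle>- f, g\<rangle> = - \<langle>f, g\<rangle>"
  using cinner_add_left[of f "-f" g] by (simp add: add_eq_0_iff)

lemma cinner_minus_right [simp]: "\<langle>f, - g\<rangle> = - \<langle>f, g\<rangle>"
  using cinner_add_right[of f g "-g"] by (simp add: add_eq_0_iff)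

lemma cinner_diff_left: "\<langle>f - g, h\<rangle> = \<langle>f, h\<rangle> - \<langle>g, h\<rangle>"
  using cinner_add_left[of f "-g" h] by simp

lemma cinner_diff_right: "\<langle>f, g - h\<rangle> = \<langle>f, g\<rangle> - \<langle>f, h\<rangle>"
  using cinner_add_right[of f g "-h"] by simp

lemmas cinner_simps = cinner_add_left cinner_add_right cinner_diff_left cinner_diff_right

lemma cinner_self: "\<langle>f, f\<rangle> = complex_of_real ((norm f)\<^sup>2)"
proof -
  have "Im \<langle>f, f\<rangle> = 0"
    using arg_cong[OF cinner_commute[of f f], of Im] by simp
  moreover have "Re \<langle>f, f\<rangle> = (norm f)\<^sup>2"
    by (simp add: power2_norm_eq_inner inner_ltwo_def)
  ultimately show ?thesis by (simp add: complex_eq_iff)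
qed

lemma cinner_self_eq_0 [simp]: "\<langle>f, f\<rangle> = 0 \<longleftrightarrow> f = 0"
  by (simp add: cinner_self)

lemma norm_scaleC [simp]: "norm (c *\<^sub>C f) = cmod c * norm f"
proof -
  have "complex_of_real ((norm (c *\<^sub>C f))\<^sup>2) = complex_of_real ((cmod c * norm f)\<^sup>2)"
    by (simp add: power_mult_distrib cinner_self[of f, simplified]
        mult.commute[of "cnj c"] complex_norm_square[of c, simplified] flip: cinner_self[of "c *\<^sub>C f", simplified])
  then have "(norm (c *\<^sub>C f))\<^sup>2 = (cmod c * norm f)\<^sup>2"
    by (rule of_real_eq_iff[THEN iffD1])
  then show ?thesis by (simp add: power2_eq_iff_nonneg)
qed

text \<open>A unimodular factor on f makes the pairing real and nonnegative, which reduces the claim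
  to the real inner product.\<close>

lemma cinner_Cauchy_Schwarz: "cmod \<langle>f, g\<rangle> \<le> norm f * norm g"
proof (cases "\<langle>f, g\<rangle> = 0")
  case False
  define c where "c = cnj (sgn \<langle>f, g\<rangle>)"
  have c: "cmod c = 1" using False by (simp add: c_def norm_sgn)
  have "\<langle>c *\<^sub>C f, g\<rangle> = complex_of_real (cmod \<langle>f, g\<rangle>)"
    using False
    by (simp add: c_def sgn_eq complex_norm_square[symmetric] mult.commute[of "cnj _"] power2_eq_square)
  then have "cmod \<langle>f, g\<rangle> = inner (c *\<^sub>C f) g"
    by (simp add: inner_ltwo_def)
  also have "\<dots> \<le> norm (c *\<^sub>C f) * norm g"
    by (rule norm_cauchy_schwarz)
  finally show ?thesis by (simp add: c)
qed simp

lemma norm_diff_sq: "(norm (f - g :: ltwo))\<^sup>2 = (norm f)\<^sup>2 - 2 * Re \<langle>f, g\<rangle> + (norm g)\<^sup>2"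
  by (simp add: power2_norm_eq_inner inner_diff_left inner_diff_right inner_commute[of g f]
      inner_ltwo_def[of f g])

lemma norm_add_sq: "(norm (f + g :: ltwo))\<^sup>2 = (norm f)\<^sup>2 + 2 * Re \<langle>f, g\<rangle> + (norm g)\<^sup>2"
  by (simp add: power2_norm_eq_inner inner_add_left inner_add_right inner_commute[of g f]
      inner_ltwo_def[of f g])

lemma tendsto_cinner:
  assumes "(f \<longlongrightarrow> a) F"
  shows "((\<lambda>x. \<langle>f x, g\<rangle>) \<longlongrightarrow> \<langle>a, g\<rangle>) F"
proof -
  have "bounded_linear (\<lambda>f. \<langle>f, g\<rangle>)"
    by (rule bounded_linear_intro[where K = "norm g"])
       (auto simp: cinner_add_left scaleR_eq_scaleC cinner_Cauchy_Schwarz scaleR_conv_of_real)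
  from bounded_linear.tendsto[OF this assms] show ?thesis .
qed

text \<open>Essential boundedness is the side condition that keeps the default value 0 of
  \<open>l2_mult\<close> out of the algebra: with one bounded factor the product really is the
  pointwise one.\<close>

lift_definition l2_bdd :: "ltwo \<Rightarrow> bool" is "\<lambda>f. \<exists>M. AE z in circle_measure. cmod (f z) \<le> M"
proof -
  fix f g assume *: "l2_rel f g"
  have "(AE z in circle_measure. cmod (f z) \<le> M) \<longleftrightarrow> (AE z in circle_measure. cmod (g z) \<le> M)" for M
    using * by (intro iffI) (auto simp: l2_rel_def)
  then show "(\<exists>M. AE z in circle_measure. cmod (f z) \<le> M) \<longleftrightarrow> (\<exists>M. AE z in circle_measure. cmod (g z) \<le> M)"
    by simp
qed

lemma ltwo_cases:
  obtains f' where "square_integrable f'" "f = to_L2 f'"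
proof -
  have "\<exists>f'. square_integrable f' \<and> f = to_L2 f'"
    by transfer (auto simp: l2_rel_def)
  with that show ?thesis by blast
qed

lemma to_L2_eq_iff:
  assumes "square_integrable f" "square_integrable g"
  shows "to_L2 f = to_L2 g \<longleftrightarrow> (AE z in circle_measure. f z = g z)"
  using assms by transfer (simp add: l2_rel_def)

lemma to_L2_add: "square_integrable f \<Longrightarrow> square_integrable g \<Longrightarrow> to_L2 (\<lambda>z. f z + g z) = to_L2 f + to_L2 g"
  by transfer (simp add: l2_rel_def square_integrable_add)

lemma to_L2_diff: "square_integrable f \<Longrightarrow> square_integrable g \<Longrightarrow> to_L2 (\<lambda>z. f z - g z) = to_L2 f - to_L2 g"
  by transfer (simp add: l2_rel_def square_integrable_diff)

lemma to_L2_scale: "square_integrable f \<Longrightarrow> to_L2 (\<lambda>z. c * f z) = c *\<^sub>C to_L2 f"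
  by transfer (simp add: l2_rel_def square_integrable_scale)

lemma to_L2_cnj: "square_integrable f \<Longrightarrow> to_L2 (\<lambda>z. cnj (f z)) = l2_cnj (to_L2 f)"
  by transfer (simp add: l2_rel_def square_integrable_cnj)

lemma to_L2_zero: "to_L2 (\<lambda>z. 0) = 0"
  by transfer (simp add: l2_rel_def)

lemma to_L2_mult:
  assumes "square_integrable f" "square_integrable g" "square_integrable (\<lambda>z. f z * g z)"
  shows "to_L2 f \<odot> to_L2 g = to_L2 (\<lambda>z. f z * g z)"
  using assms by transfer (simp add: l2_rel_def)

lemma cinner_to_L2:
  assumes "square_integrable f" "square_integrable g"
  shows "\<langle>to_L2 f, to_L2 g\<rangle> = (LINT z|circle_measure. f z * cnj (g z))"
  using assms by transfer simp

lemma norm_to_L2: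
  assumes "square_integrable f"
  shows "(norm (to_L2 f))\<^sup>2 = (LINT z|circle_measure. (cmod (f z))\<^sup>2)"
proof -
  have "complex_of_real ((norm (to_L2 f))\<^sup>2) = (LINT z|circle_measure. complex_of_real ((cmod (f z))\<^sup>2))"
    unfolding cinner_self[symmetric] cinner_to_L2[OF assms assms]
    by (simp only: complex_norm_square)
  then show ?thesis by (metis integral_complex_of_real of_real_eq_iff)
qed

lemma l2_bdd_to_L2:
  assumes "square_integrable f"
  shows "l2_bdd (to_L2 f) \<longleftrightarrow> (\<exists>M. AE z in circle_measure. cmod (f z) \<le> M)"
  using assms by transfer simp

lemma unimodular_to_L2:
  assumes "square_integrable f"
  shows "l2_unimodular (to_L2 f) \<longleftrightarrow> (AE z in circle_measure. cmod (f z) = 1)"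
  using assms by transfer simp

lemma bdd_mult_to_L2:
  assumes "square_integrable f" "l2_bdd (to_L2 f)" "square_integrable g"
  shows "square_integrable (\<lambda>z. f z * g z)" "to_L2 f \<odot> to_L2 g = to_L2 (\<lambda>z. f z * g z)"
proof -
  show "square_integrable (\<lambda>z. f z * g z)"
    using assms by (auto simp: l2_bdd_to_L2 intro: square_integrable_mult_bounded)
  then show "to_L2 f \<odot> to_L2 g = to_L2 (\<lambda>z. f z * g z)" by (intro to_L2_mult assms)
qed

lemma l2_bdd_continuous:
  assumes "continuous_on (sphere 0 1) f"
  shows "l2_bdd (to_L2 f)"
  using circle_continuous_bounded[OF assms] square_integrable_continuous[OF assms]
  by (simp add: l2_bdd_to_L2)

lemma l2_bdd_z [simp]: "l2_bdd l2_z" and l2_bdd_const [simp]: "l2_bdd (l2_const c)"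
  by (auto intro!: l2_bdd_continuous continuous_intros)

lemma l2_bdd_zero [simp]: "l2_bdd 0"
  using l2_bdd_const[of 0] by (simp add: to_L2_zero)

lemma l2_bdd_add [simp]: "l2_bdd f \<Longrightarrow> l2_bdd g \<Longrightarrow> l2_bdd (f + g)"
proof transfer
  fix f g
  assume "\<exists>M. AE z in circle_measure. cmod (f z) \<le> M" "\<exists>M. AE z in circle_measure. cmod (g z) \<le> M"
  then obtain M N where *: "AE z in circle_measure. cmod (f z) \<le> M" "AE z in circle_measure. cmod (g z) \<le> N"
    by blast
  then have "AE z in circle_measure. cmod (f z + g z) \<le> M + N"
    by eventually_elim (rule norm_triangle_mono)
  then show "\<exists>M. AE z in circle_measure. cmod (f z + g z) \<le> M" by blast
qed

lemma l2_bdd_scale [simp]: "l2_bdd f \<Longrightarrow> l2_bdd (c *\<^sub>C f)"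
proof transfer
  fix c f
  assume "\<exists>M. AE z in circle_measure. cmod (f z) \<le> M"
  then obtain M where "AE z in circle_measure. cmod (f z) \<le> M" by blast
  then have "AE z in circle_measure. cmod (c * f z) \<le> cmod c * M"
    by eventually_elim (simp add: norm_mult mult_left_mono)
  then show "\<exists>M. AE z in circle_measure. cmod (c * f z) \<le> M" by blast
qed

lemma l2_bdd_diff [simp]: "l2_bdd f \<Longrightarrow> l2_bdd g \<Longrightarrow> l2_bdd (f - g)"
  using l2_bdd_add[of f "- g"] l2_bdd_scale[of g "-1"] by simp

lemma l2_bdd_cnj [simp]: "l2_bdd (l2_cnj f) \<longleftrightarrow> l2_bdd f"
  by transfer simp

lemma l2_bdd_unimodular: "l2_unimodular f \<Longrightarrow> l2_bdd f"
  by transfer (auto intro!: exI[of _ 1] elim!: AE_mp)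

lemma l2_bdd_mult [simp]:
  assumes "l2_bdd f" "l2_bdd g"
  shows "l2_bdd (f \<odot> g)"
proof -
  obtain f' where f': "square_integrable f'" "f = to_L2 f'" by (rule ltwo_cases)
  obtain g' where g': "square_integrable g'" "g = to_L2 g'" by (rule ltwo_cases)
  note * = f' g'
  obtain M N where MN: "AE z in circle_measure. cmod (f' z) \<le> M" "AE z in circle_measure. cmod (g' z) \<le> N"
    using assms * by (auto simp: l2_bdd_to_L2)
  have sq: "square_integrable (\<lambda>z. f' z * g' z)"
    using * MN by (auto intro: square_integrable_mult_bounded)
  have "AE z in circle_measure. cmod (f' z * g' z) \<le> M * N"
    using MN by eventually_elim (auto simp: norm_mult intro!: mult_mono intro: order_trans[OF norm_ge_zero])
  with sq show ?thesis by (auto simp: * to_L2_mult l2_bdd_to_L2)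
qed

lemma mult_commute: "f \<odot> g = g \<odot> f"
  by transfer (simp add: mult.commute l2_rel_def)

lemma mult_assoc:
  assumes "l2_bdd f" "l2_bdd g"
  shows "f \<odot> g \<odot> h = f \<odot> (g \<odot> h)"
proof -
  obtain f' where f': "square_integrable f'" "f = to_L2 f'" by (rule ltwo_cases)
  obtain g' where g': "square_integrable g'" "g = to_L2 g'" by (rule ltwo_cases)
  obtain h' where h': "square_integrable h'" "h = to_L2 h'" by (rule ltwo_cases)
  then show ?thesis
    using assms f' g' by (simp add: bdd_mult_to_L2 to_L2_mult mult.assoc)
qed

lemma mult_left_commute:
  assumes "l2_bdd f" "l2_bdd g"
  shows "f \<odot> (g \<odot> h) = g \<odot> (f \<odot> h)"
  by (simp flip: mult_assoc[OF assms] mult_assoc[OF assms(2,1)] add: mult_commute[of f g])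

lemma mult_add_right:
  assumes "l2_bdd f"
  shows "f \<odot> (g + h) = f \<odot> g + f \<odot> h"
proof -
  obtain f' where f': "square_integrable f'" "f = to_L2 f'" by (rule ltwo_cases)
  obtain g' where g': "square_integrable g'" "g = to_L2 g'" by (rule ltwo_cases)
  obtain h' where h': "square_integrable h'" "h = to_L2 h'" by (rule ltwo_cases)
  then show ?thesis
    using assms f' g' by (simp add: bdd_mult_to_L2 to_L2_add[symmetric] square_integrable_add distrib_left)
qed

lemma mult_scale_right:
  assumes "l2_bdd f"
  shows "f \<odot> (c *\<^sub>C g) = c *\<^sub>C (f \<odot> g)"
proof -
  obtain f' where f': "square_integrable f'" "f = to_L2 f'" by (rule ltwo_cases)
  obtain g' where g': "square_integrable g'" "g = to_L2 g'" by (rule ltwo_cases)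
  then show ?thesis
    using assms f' by (simp add: bdd_mult_to_L2 to_L2_scale[symmetric] square_integrable_scale mult.left_commute)
qed

lemma mult_diff_right:
  assumes "l2_bdd f"
  shows "f \<odot> (g - h) = f \<odot> g - f \<odot> h"
  using mult_add_right[OF assms, of g "- h"] mult_scale_right[OF assms, of "-1" h] by simp

lemma mult_add_left: "l2_bdd h \<Longrightarrow> (f + g) \<odot> h = f \<odot> h + g \<odot> h"
  using mult_add_right[of h f g] by (simp add: mult_commute)

lemma mult_scale_left: "l2_bdd g \<Longrightarrow> (c *\<^sub>C f) \<odot> g = c *\<^sub>C (f \<odot> g)"
  using mult_scale_right[of g c f] by (simp add: mult_commute)

lemma mult_const_left: "l2_const c \<odot> f = c *\<^sub>C f"
proof -
  obtain f' where f': "square_integrable f'" "f = to_L2 f'" by (rule ltwo_cases)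
  then have "l2_const c \<odot> f = to_L2 (\<lambda>z. c * f' z)"
    by (simp add: to_L2_mult square_integrable_scale square_integrable_continuous)
  then show ?thesis by (simp add: f' to_L2_scale)
qed

lemma const_scale: "l2_const c = c *\<^sub>C l2_const 1"
  using to_L2_scale[of "\<lambda>_. 1" c] by (simp add: square_integrable_continuous)

lemma one_mult [simp]: "l2_const 1 \<odot> f = f" "f \<odot> l2_const 1 = f"
  using mult_const_left[of 1 f] by (simp_all add: mult_commute)

text \<open>In contrast to \<open>mult_scale_left\<close>, boundedness is asked of the scaled
  factor, so h may be an unbounded symbol. The same distinction separates
  \<open>bdd_add_mult\<close> from \<open>mult_add_left\<close>.\<close>

lemma bdd_scale_mult:
  assumes "l2_bdd f"
  shows "(c *\<^sub>C f) \<odot> h = c *\<^sub>C (f \<odot> h)"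
  using mult_assoc[OF l2_bdd_const assms, of c h] by (simp add: mult_const_left)

lemma bdd_add_mult:
  assumes "l2_bdd f" "l2_bdd g"
  shows "(f + g) \<odot> h = f \<odot> h + g \<odot> h"
proof -
  obtain f' where f': "square_integrable f'" "f = to_L2 f'" by (rule ltwo_cases)
  obtain g' where g': "square_integrable g'" "g = to_L2 g'" by (rule ltwo_cases)
  obtain h' where h': "square_integrable h'" "h = to_L2 h'" by (rule ltwo_cases)
  have fh: "square_integrable (\<lambda>z. f' z * h' z)" and gh: "square_integrable (\<lambda>z. g' z * h' z)"
    using assms f' g' h' by (simp_all add: bdd_mult_to_L2)
  have "square_integrable (\<lambda>z. (f' z + g' z) * h' z)"
    using square_integrable_add[OF fh gh] by (simp add: distrib_right)
  then have "(f + g) \<odot> h = to_L2 (\<lambda>z. (f' z + g' z) * h' z)"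
    using f' g' h' by (simp add: to_L2_add[symmetric] square_integrable_add to_L2_mult)
  also have "\<dots> = f \<odot> h + g \<odot> h"
    using f' g' h' fh gh by (simp add: to_L2_add to_L2_mult distrib_right)
  finally show ?thesis .
qed

lemma cnj_cnj [simp]: "l2_cnj (l2_cnj f) = f"
  by transfer (simp add: l2_rel_def)

lemma cnj_add: "l2_cnj (f + g) = l2_cnj f + l2_cnj g"
  by transfer (simp add: l2_rel_def square_integrable_add square_integrable_cnj)

lemma cnj_diff: "l2_cnj (f - g) = l2_cnj f - l2_cnj g"
  by transfer (simp add: l2_rel_def square_integrable_diff square_integrable_cnj)

lemma cnj_scale: "l2_cnj (c *\<^sub>C f) = cnj c *\<^sub>C l2_cnj f"
  by transfer (simp add: l2_rel_def square_integrable_scale square_integrable_cnj)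

lemma cnj_const [simp]: "l2_cnj (l2_const c) = l2_const (cnj c)"
  using to_L2_cnj[of "\<lambda>_. c"] by (simp add: square_integrable_continuous)

lemma cnj_mult:
  assumes "l2_bdd f"
  shows "l2_cnj (f \<odot> g) = l2_cnj f \<odot> l2_cnj g"
proof -
  obtain f' where f': "square_integrable f'" "f = to_L2 f'" by (rule ltwo_cases)
  obtain g' where g': "square_integrable g'" "g = to_L2 g'" by (rule ltwo_cases)
  have fg: "square_integrable (\<lambda>z. f' z * g' z)"
    using assms f' g' by (simp add: bdd_mult_to_L2)
  moreover have "square_integrable (\<lambda>z. cnj (f' z) * cnj (g' z))"
    using square_integrable_cnj[OF fg] by simp
  ultimately show ?thesis
    using f' g' by (simp add: to_L2_cnj[symmetric] square_integrable_cnj to_L2_mult)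
qed

lemma cinner_cnj_cnj: "\<langle>l2_cnj f, l2_cnj g\<rangle> = \<langle>g, f\<rangle>"
  by transfer (simp add: mult.commute)

lemma norm_cnj [simp]: "norm (l2_cnj f) = norm f"
  by (simp add: norm_eq_sqrt_inner inner_ltwo_def cinner_cnj_cnj)

lemma cinner_mult_left:
  assumes "l2_bdd f"
  shows "\<langle>f \<odot> g, h\<rangle> = \<langle>g, l2_cnj f \<odot> h\<rangle>"
proof -
  obtain f' where f': "square_integrable f'" "f = to_L2 f'" by (rule ltwo_cases)
  obtain g' where g': "square_integrable g'" "g = to_L2 g'" by (rule ltwo_cases)
  obtain h' where h': "square_integrable h'" "h = to_L2 h'" by (rule ltwo_cases)
  note * = f' g' h'
  obtain M where M: "AE z in circle_measure. cmod (f' z) \<le> M"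
    using assms * by (auto simp: l2_bdd_to_L2)
  have "square_integrable (\<lambda>z. f' z * g' z)" "square_integrable (\<lambda>z. cnj (f' z) * h' z)"
    using * M square_integrable_cnj[of f']
    by (auto intro!: square_integrable_mult_bounded[where M = M])
  with * show ?thesis
    by (simp add: to_L2_cnj[symmetric] square_integrable_cnj to_L2_mult cinner_to_L2 mult_ac)
qed

lemma cinner_mult_right:
  assumes "l2_bdd f"
  shows "\<langle>g, f \<odot> h\<rangle> = \<langle>l2_cnj f \<odot> g, h\<rangle>"
  using cinner_mult_left[of "l2_cnj f" g h] assms by simp

lemma unimodular_mult_cnj:
  assumes "l2_unimodular f"
  shows "f \<odot> l2_cnj f = l2_const 1"
proof -
  obtain f' where *: "square_integrable f'" "f = to_L2 f'" by (rule ltwo_cases)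
  have ae: "AE z in circle_measure. cmod (f' z) = 1"
    using assms * by (simp add: unimodular_to_L2)
  have sq: "square_integrable (\<lambda>z. f' z * cnj (f' z))"
    using * ae by (intro square_integrable_mult_bounded[where M = 1] square_integrable_cnj)
      (auto elim!: AE_mp simp: square_integrable_def)
  have "to_L2 (\<lambda>z. f' z * cnj (f' z)) = l2_const 1"
  proof (subst to_L2_eq_iff[OF sq square_integrable_continuous])
    show "AE z in circle_measure. f' z * cnj (f' z) = 1"
      using ae by eventually_elim (simp add: complex_norm_square[symmetric])
  qed auto
  with * sq show ?thesis
    by (simp add: to_L2_cnj[symmetric] square_integrable_cnj to_L2_mult)
qed

lemma unimodular_cnj_mult: "l2_unimodular f \<Longrightarrow> l2_cnj f \<odot> f = l2_const 1"
  using unimodular_mult_cnj[of f] by (simp add: mult_commute)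

lemma unimodular_cancel:
  assumes "l2_unimodular f"
  shows "f \<odot> (l2_cnj f \<odot> g) = g" "l2_cnj f \<odot> (f \<odot> g) = g"
  using l2_bdd_unimodular[OF assms]
  by (simp_all flip: mult_assoc add: unimodular_mult_cnj unimodular_cnj_mult assms)

lemma cinner_unimodular:
  assumes "l2_unimodular f"
  shows "\<langle>f \<odot> g, f \<odot> h\<rangle> = \<langle>g, h\<rangle>"
  using l2_bdd_unimodular[OF assms] by (simp add: cinner_mult_left unimodular_cancel assms)

lemma unimodular_cnj [simp]: "l2_unimodular (l2_cnj f) \<longleftrightarrow> l2_unimodular f"
  by transfer simp

lemma unimodular_z [simp]: "l2_unimodular l2_z"
  by (subst unimodular_to_L2) (auto intro!: square_integrable_continuous continuous_intros AE_I2)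

lemma norm_unimodular_mult: "l2_unimodular f \<Longrightarrow> norm (f \<odot> g) = norm g"
  by (simp add: norm_eq_sqrt_inner inner_ltwo_def cinner_unimodular)

lemma norm_l2_one [simp]: "norm (l2_const 1) = 1"
  using norm_to_L2[of "\<lambda>_. 1"] norm_ge_zero[of "l2_const 1"] by (auto simp add: square_integrable_continuous circle.prob_space[simplified]
      power2_eq_1_iff)

section \<open>Hilbert space theory\<close>

lemma nn_integral_norm_to_L2:
  assumes "square_integrable f"
  shows "(\<integral>\<^sup>+z. ennreal ((cmod (f z))\<^sup>2) \<partial>circle_measure) = ennreal ((norm (to_L2 f))\<^sup>2)"
  unfolding norm_to_L2[OF assms]
  by (rule nn_integral_eq_integral) (use assms in \<open>auto simp: square_integrable_def\<close>)

lemma integral_norm_le: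
  assumes "square_integrable f"
  shows "(LINT z|circle_measure. cmod (f z)) \<le> norm (to_L2 f)"
proof -
  define g where "g = (\<lambda>z. complex_of_real (cmod (f z)))"
  have g: "square_integrable g"
    using assms by (auto simp: square_integrable_def g_def)
  have "complex_of_real (LINT z|circle_measure. cmod (f z)) = \<langle>to_L2 g, l2_const 1\<rangle>"
    using g by (subst cinner_to_L2) (auto simp: g_def square_integrable_continuous)
  from arg_cong[OF this, of cmod] have "\<bar>LINT z|circle_measure. cmod (f z)\<bar> \<le> norm (to_L2 g)"
    using cinner_Cauchy_Schwarz[of "to_L2 g" "l2_const 1"]
    by (simp only: norm_of_real norm_l2_one mult_1_right)
  moreover have "(norm (to_L2 g))\<^sup>2 = (norm (to_L2 f))\<^sup>2"
    unfolding norm_to_L2[OF assms] norm_to_L2[OF g] by (simp add: g_def)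
  ultimately show ?thesis by (simp add: power2_eq_iff_nonneg)
qed

lemma integrable_norm:
  assumes "square_integrable f"
  shows "integrable circle_measure (\<lambda>z. cmod (f z))"
proof -
  have "integrable circle_measure (\<lambda>z. f z * cnj 1)"
    by (rule integrable_mult_cnj[OF assms]) (simp add: square_integrable_continuous)
  then show ?thesis by simp
qed

text \<open>A sequence whose consecutive distances are summable converges almost everywhere; Fatou's
  lemma identifies the pointwise limit as the norm limit.\<close>

lemma ltwo_converges_of_fast_Cauchy:
  fixes X :: "nat \<Rightarrow> ltwo"
  assumes fast: "\<And>n. norm (X (Suc n) - X n) \<le> (1/2) ^ n" and "Cauchy X"
  shows "convergent X"
proof -
  have "\<forall>n. \<exists>f. square_integrable f \<and> X n = to_L2 f"
    by (meson ltwo_cases)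
  from choice[OF this] obtain f where "\<And>n. square_integrable (f n) \<and> X n = to_L2 (f n)"
    by blast
  then have sq: "square_integrable (f n)" and X: "X n = to_L2 (f n)" for n by auto
  have [measurable]: "f n \<in> borel_measurable circle_measure" for n
    using sq by measurable
  have sqd: "square_integrable (\<lambda>z. f m z - f n z)" for m n
    by (intro square_integrable_diff sq)
  have nd: "norm (to_L2 (\<lambda>z. f m z - f n z)) = norm (X m - X n)" for m n
    by (simp add: X to_L2_diff sq)
  have "(\<integral>\<^sup>+z. (\<Sum>n. ennreal (cmod (f (Suc n) z - f n z))) \<partial>circle_measure) =
      (\<Sum>n. \<integral>\<^sup>+z. ennreal (cmod (f (Suc n) z - f n z)) \<partial>circle_measure)"
    by (rule nn_integral_suminf) measurable
  also have "\<dots> \<le> (\<Sum>n. ennreal ((1/2) ^ n))"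
  proof (intro suminf_le allI)
    fix n
    have "(\<integral>\<^sup>+z. ennreal (cmod (f (Suc n) z - f n z)) \<partial>circle_measure) =
        ennreal (LINT z|circle_measure. cmod (f (Suc n) z - f n z))"
      by (intro nn_integral_eq_integral integrable_norm sqd) auto
    also have "\<dots> \<le> ennreal ((1/2) ^ n)"
      using integral_norm_le[OF sqd, of "Suc n" n] fast[of n] by (intro ennreal_leI) (simp add: nd)
    finally show "(\<integral>\<^sup>+z. ennreal (cmod (f (Suc n) z - f n z)) \<partial>circle_measure) \<le> ennreal ((1/2) ^ n)" .
  qed auto
  also have "\<dots> = ennreal (\<Sum>n. (1/2) ^ n)"
    by (intro suminf_ennreal2 summable_geometric) auto
  also have "\<dots> < \<infinity>" by simp
  finally have fin: "(\<integral>\<^sup>+z. (\<Sum>n. ennreal (cmod (f (Suc n) z - f n z))) \<partial>circle_measure) \<noteq> \<infinity>"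
    by simp
  have "AE z in circle_measure. (\<Sum>n. ennreal (cmod (f (Suc n) z - f n z))) \<noteq> \<infinity>"
    by (rule nn_integral_PInf_AE[OF _ fin]) measurable
  then have conv: "AE z in circle_measure. convergent (\<lambda>n. f n z)"
  proof eventually_elim
    case (elim z)
    then have "summable (\<lambda>n. cmod (f (Suc n) z - f n z))"
      by (intro summable_suminf_not_top) (auto simp: top_ennreal_def infinity_ennreal_def)
    then have "summable (\<lambda>n. f (Suc n) z - f n z)"
      by (rule summable_norm_cancel)
    then have "convergent (\<lambda>n. \<Sum>i<n. f (Suc i) z - f i z)"
      by (simp add: summable_iff_convergent)
    then have "convergent (\<lambda>n. (f n z - f 0 z) + f 0 z)"
      unfolding sum_lessThan_telescope[of "\<lambda>i. f i z"] by (rule convergent_add) (simp add: convergent_const)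
    then show ?case by simp
  qed
  define g where "g z = lim (\<lambda>n. f n z)" for z
  have [measurable]: "g \<in> borel_measurable circle_measure"
    unfolding g_def by measurable
  have lim: "AE z in circle_measure. (\<lambda>n. f n z) \<longlonglongrightarrow> g z"
    using conv by eventually_elim (simp add: g_def convergent_LIMSEQ_iff)
  have fatou: "(\<integral>\<^sup>+z. ennreal ((cmod (g z - f n z))\<^sup>2) \<partial>circle_measure) \<le> ennreal (e\<^sup>2)"
    if e: "\<And>m. m \<ge> n \<Longrightarrow> norm (X m - X n) \<le> e" for n e
  proof -
    have "(\<integral>\<^sup>+z. ennreal ((cmod (g z - f n z))\<^sup>2) \<partial>circle_measure) =
        (\<integral>\<^sup>+z. liminf (\<lambda>m. ennreal ((cmod (f m z - f n z))\<^sup>2)) \<partial>circle_measure)"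
    proof (rule nn_integral_cong_AE)
      show "AE z in circle_measure. ennreal ((cmod (g z - f n z))\<^sup>2) =
          liminf (\<lambda>m. ennreal ((cmod (f m z - f n z))\<^sup>2))"
        using lim
      proof eventually_elim
        case (elim z)
        have "(\<lambda>m. ennreal ((cmod (f m z - f n z))\<^sup>2)) \<longlonglongrightarrow> ennreal ((cmod (g z - f n z))\<^sup>2)"
          using elim by (intro tendsto_intros tendsto_ennrealI)
        then show ?case using lim_imp_Liminf[OF sequentially_bot] by metis
      qed
    qed
    also have "\<dots> \<le> liminf (\<lambda>m. \<integral>\<^sup>+z. ennreal ((cmod (f m z - f n z))\<^sup>2) \<partial>circle_measure)"
      by (rule nn_integral_liminf) measurable
    also have "\<dots> = liminf (\<lambda>m. ennreal ((norm (X m - X n))\<^sup>2))"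
      by (simp add: nn_integral_norm_to_L2 sqd nd)
    also have "\<dots> \<le> limsup (\<lambda>m. ennreal ((norm (X m - X n))\<^sup>2))"
      by (rule Liminf_le_Limsup) simp
    also have "\<dots> \<le> ennreal (e\<^sup>2)"
      by (rule Limsup_bounded, rule eventually_sequentiallyI[of n])
        (auto intro!: ennreal_leI power_mono e)
    finally show ?thesis .
  qed
  have sqg: "square_integrable (\<lambda>z. g z - f n z)"
    if e: "\<And>m. m \<ge> n \<Longrightarrow> norm (X m - X n) \<le> e" for n e
    unfolding square_integrable_def
  proof
    show "integrable circle_measure (\<lambda>z. (cmod (g z - f n z))\<^sup>2)"
      using fatou[OF e] by (intro integrableI_bounded) (auto simp: less_top[symmetric] top_unique)
  qed measurable
  have "X \<longlonglongrightarrow> to_L2 g"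
  proof (rule LIMSEQ_I)
    fix r :: real assume "r > 0"
    then obtain N where N: "\<And>m n. m \<ge> N \<Longrightarrow> n \<ge> N \<Longrightarrow> norm (X m - X n) < r / 2"
      using CauchyD[OF \<open>Cauchy X\<close>, of "r/2"] by auto
    have "norm (X n - to_L2 g) < r" if "n \<ge> N" for n
    proof -
      have e: "norm (X m - X n) \<le> r/2" if "m \<ge> n" for m
        using N[of m n] that \<open>n \<ge> N\<close> by simp
      have sq1: "square_integrable (\<lambda>z. g z - f n z)" by (rule sqg[OF e])
      have "square_integrable g"
        using square_integrable_add[OF sq1 sq[of n]] by simp
      then have "to_L2 g - X n = to_L2 (\<lambda>z. g z - f n z)"
        by (simp add: to_L2_diff sq X)
      then have "ennreal ((norm (to_L2 g - X n))\<^sup>2) \<le> ennreal ((r/2)\<^sup>2)"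
        using fatou[OF e] by (simp add: nn_integral_norm_to_L2[OF sq1])
      then have "norm (to_L2 g - X n) \<le> r/2"
        using \<open>r > 0\<close> by (simp add: power2_le_iff_abs_le)
      then show ?thesis using \<open>r > 0\<close> by (simp add: norm_minus_commute)
    qed
    then show "\<exists>N. \<forall>n\<ge>N. norm (X n - to_L2 g) < r" by blast
  qed
  then show ?thesis by (auto simp: convergent_def)
qed

instance ltwo :: complete_space
proof
  fix X :: "nat \<Rightarrow> ltwo"
  assume X: "Cauchy X"
  have "\<exists>N. \<forall>m\<ge>N. \<forall>n\<ge>N. norm (X m - X n) < (1/2)^i" for i
    by (rule CauchyD[OF X]) simp
  then obtain N where N: "\<And>i n m. n \<ge> N i \<Longrightarrow> m \<ge> N i \<Longrightarrow> norm (X m - X n) < (1/2)^i"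
    by metis
  \<comment> \<open>Summing the thresholds makes r dominate every N i, and the summand i makes it
    strictly increasing.\<close>
  define r where "r i = (\<Sum>j\<le>i. N j) + i" for i
  have r: "strict_mono r"
    by (rule strict_mono_Suc_iff[THEN iffD2]) (auto simp: r_def)
  have rN: "r i \<ge> N i" for i
  proof -
    have "N i \<le> (\<Sum>j\<le>i. N j)" by (rule member_le_sum) auto
    then show ?thesis by (simp add: r_def)
  qed
  have "convergent (X \<circ> r)"
  proof (rule ltwo_converges_of_fast_Cauchy)
    show "norm ((X \<circ> r) (Suc n) - (X \<circ> r) n) \<le> (1/2) ^ n" for n
      using N[of n "r n" "r (Suc n)"] rN[of n] strict_mono_less_eq[OF r, of n "Suc n"] by simp
    show "Cauchy (X \<circ> r)"
      by (rule Cauchy_subseq_Cauchy[OF X r])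
  qed
  then obtain L where "(X \<circ> r) \<longlonglongrightarrow> L" by (auto simp: convergent_def)
  then have "X \<longlonglongrightarrow> L" by (rule Cauchy_converges_subseq[OF X r])
  then show "convergent X" by (auto simp: convergent_def)
qed

section \<open>Closed subspaces, orthogonal projections, Riesz representation\<close>

definition closed_csubspace :: "ltwo set \<Rightarrow> bool" where
  "closed_csubspace K \<longleftrightarrow>
     0 \<in> K \<and> (\<forall>f\<in>K. \<forall>g\<in>K. f + g \<in> K) \<and> (\<forall>c. \<forall>f\<in>K. c *\<^sub>C f \<in> K) \<and> closed K"

lemma closed_csubspaceD:
  assumes "closed_csubspace K"
  shows "0 \<in> K" "f \<in> K \<Longrightarrow> g \<in> K \<Longrightarrow> f + g \<in> K" "f \<in> K \<Longrightarrow> c *\<^sub>C f \<in> K"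
    "closed K" "f \<in> K \<Longrightarrow> g \<in> K \<Longrightarrow> f - g \<in> K" "f \<in> K \<Longrightarrow> - f \<in> K"
proof -
  show *: "0 \<in> K" "f \<in> K \<Longrightarrow> g \<in> K \<Longrightarrow> f + g \<in> K" "f \<in> K \<Longrightarrow> c *\<^sub>C f \<in> K" "closed K" for f g c
    using assms by (auto simp: closed_csubspace_def)
  show **: "f \<in> K \<Longrightarrow> - f \<in> K" for f
    using *(3)[of f "-1"] by simp
  show "f \<in> K \<Longrightarrow> g \<in> K \<Longrightarrow> f - g \<in> K"
    using *(2)[of f "- g"] **[of g] by simp
qed

lemma parallelogram_ltwo:
  "(norm (f - g :: ltwo))\<^sup>2 = 2 * (norm f)\<^sup>2 + 2 * (norm g)\<^sup>2 - (norm (f + g))\<^sup>2"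
  by (simp add: norm_diff_sq norm_add_sq)

text \<open>A minimizing sequence is Cauchy by the parallelogram law, because the midpoints of its
  members stay in K and so are at squared distance at least D from f.\<close>

lemma orth_proj_exists:
  assumes K: "closed_csubspace K"
  shows "\<exists>g\<in>K. \<forall>h\<in>K. \<langle>f - g, h\<rangle> = 0"
proof -
  note K = closed_csubspaceD[OF K]
  define D where "D = (INF g\<in>K. (norm (f - g))\<^sup>2)"
  have D: "D \<le> (norm (f - g))\<^sup>2" if "g \<in> K" for g
    unfolding D_def using that by (intro cINF_lower bdd_belowI2[where m = 0]) auto
  have "\<exists>g\<in>K. (norm (f - g))\<^sup>2 < D + inverse (real (Suc n))" for n
  proof -
    have "Inf ((\<lambda>g. (norm (f - g))\<^sup>2) ` K) < D + inverse (real (Suc n))"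
      unfolding D_def by simp
    from cInf_lessD[OF _ this] K(1) show ?thesis by blast
  qed
  then have "\<forall>n. \<exists>g. g \<in> K \<and> (norm (f - g))\<^sup>2 < D + inverse (real (Suc n))" by blast
  from choice[OF this] obtain g where gK: "\<And>n. g n \<in> K"
    and g: "\<And>n. (norm (f - g n))\<^sup>2 < D + inverse (real (Suc n))"
    by blast
  have dist: "(norm (g m - g n))\<^sup>2 \<le> 2 * inverse (real (Suc m)) + 2 * inverse (real (Suc n))" for m n
  proof -
    have "(1/2) *\<^sub>C (g m + g n) \<in> K" by (intro K(2,3) gK)
    from D[OF this] have "4 * D \<le> (norm (2 *\<^sub>C (f - (1/2) *\<^sub>C (g m + g n))))\<^sup>2"
      by (simp add: power_mult_distrib)
    also have "2 *\<^sub>C (f - (1/2) *\<^sub>C (g m + g n)) = (f - g n) + (f - g m)"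
      using l2.scale_left_distrib[of 1 1 f] by (simp add: l2.scale_right_diff_distrib)
    finally have "4 * D \<le> (norm ((f - g n) + (f - g m)))\<^sup>2" .
    moreover have "(norm (g m - g n))\<^sup>2 =
        2 * (norm (f - g n))\<^sup>2 + 2 * (norm (f - g m))\<^sup>2 - (norm ((f - g n) + (f - g m)))\<^sup>2"
      using parallelogram_ltwo[of "f - g n" "f - g m"] by simp
    ultimately show ?thesis using g[of n] g[of m] by linarith
  qed
  have "Cauchy g"
  proof (rule CauchyI)
    fix e :: real assume e: "e > 0"
    obtain N where N: "inverse (real (Suc N)) < e\<^sup>2 / 4"
      using reals_Archimedean[of "e\<^sup>2 / 4"] e by auto
    have "norm (g m - g n) < e" if "m \<ge> N" "n \<ge> N" for m n
    proof -
      have "inverse (real (Suc m)) \<le> inverse (real (Suc N))" "inverse (real (Suc n)) \<le> inverse (real (Suc N))"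
        using that by (auto simp: field_simps)
      then have "(norm (g m - g n))\<^sup>2 < e\<^sup>2" using dist[of m n] N by linarith
      then show ?thesis using e by (simp add: power_less_imp_less_base)
    qed
    then show "\<exists>M. \<forall>m\<ge>M. \<forall>n\<ge>M. norm (g m - g n) < e" by blast
  qed
  then obtain p where p: "g \<longlonglongrightarrow> p" by (auto simp: Cauchy_convergent_iff convergent_def)
  have pK: "p \<in> K" by (rule closed_sequentially[OF K(4) gK p])
  have "(\<lambda>n. (norm (f - g n))\<^sup>2) \<longlonglongrightarrow> (norm (f - p))\<^sup>2"
    by (intro tendsto_intros p)
  moreover have "(\<lambda>n. D + inverse (real (Suc n))) \<longlonglongrightarrow> D + 0"
    by (intro tendsto_intros LIMSEQ_inverse_real_of_nat)
  ultimately have min: "(norm (f - p))\<^sup>2 \<le> D"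
    using g by (intro LIMSEQ_le) (auto intro: less_imp_le)
  have "\<langle>f - p, h\<rangle> = 0" if h: "h \<in> K" for h
  proof (cases "h = 0")
    case False
    \<comment> \<open>This is the coefficient of f - p along h. Moving p by t h lowers the squared
      distance by |t|^2 times the squared norm of h, which minimality excludes unless t = 0.\<close>
    define t where "t = \<langle>f - p, h\<rangle> / complex_of_real ((norm h)\<^sup>2)"
    have nh: "(norm h)\<^sup>2 > 0" using False by simp
    have "p + t *\<^sub>C h \<in> K" by (intro K(2,3) pK h)
    then have "(norm (f - p))\<^sup>2 \<le> (norm (f - (p + t *\<^sub>C h)))\<^sup>2"
      using D min order_trans by blast
    also have "f - (p + t *\<^sub>C h) = (f - p) - t *\<^sub>C h" by simp
    also have "(norm ((f - p) - t *\<^sub>C h))\<^sup>2 =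
        (norm (f - p))\<^sup>2 - 2 * Re (cnj t * \<langle>f - p, h\<rangle>) + (cmod t)\<^sup>2 * (norm h)\<^sup>2"
      by (simp add: norm_diff_sq power_mult_distrib)
    also have "\<langle>f - p, h\<rangle> = t * complex_of_real ((norm h)\<^sup>2)"
      using nh by (simp add: t_def)
    also have "cnj t * (t * complex_of_real ((norm h)\<^sup>2)) = cnj t * t * complex_of_real ((norm h)\<^sup>2)"
      by (rule mult.assoc[symmetric])
    also have "cnj t * t = complex_of_real ((cmod t)\<^sup>2)"
      using complex_norm_square[of t] by (simp add: mult.commute)
    finally have "(cmod t)\<^sup>2 * (norm h)\<^sup>2 \<le> 0" by (simp add: mult.commute)
    with nh have "t = 0" by (simp add: mult_le_0_iff)
    with nh show ?thesis by (simp add: t_def)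
  qed simp
  with pK show ?thesis by blast
qed

lemma cinner_eqI:
  assumes "closed_csubspace K" "f \<in> K" "g \<in> K" "\<And>h. h \<in> K \<Longrightarrow> \<langle>f, h\<rangle> = \<langle>g, h\<rangle>"
  shows "f = g"
proof -
  have "f - g \<in> K" by (intro closed_csubspaceD(5) assms)
  then have "\<langle>f - g, f - g\<rangle> = 0" using assms(4) by (simp add: cinner_diff_left)
  then show ?thesis by simp
qed

lemma orth_proj_eqI:
  assumes "closed_csubspace K" "g \<in> K" "\<And>h. h \<in> K \<Longrightarrow> \<langle>f, h\<rangle> = \<langle>g, h\<rangle>"
  shows "orth_proj K f = g"
  unfolding orth_proj_def
proof (rule the_equality)
  show "g \<in> K \<and> (\<forall>h\<in>K. \<langle>f - g, h\<rangle> = 0)" using assms by (simp add: cinner_diff_left)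
  fix g' assume "g' \<in> K \<and> (\<forall>h\<in>K. \<langle>f - g', h\<rangle> = 0)"
  then show "g' = g" using assms by (intro cinner_eqI[OF assms(1)]) (auto simp: cinner_diff_left)
qed

lemma
  assumes K: "closed_csubspace K"
  shows orth_proj_in: "orth_proj K f \<in> K"
    and cinner_orth_proj: "h \<in> K \<Longrightarrow> \<langle>orth_proj K f, h\<rangle> = \<langle>f, h\<rangle>"
    and cinner_orth_proj_right: "h \<in> K \<Longrightarrow> \<langle>h, orth_proj K f\<rangle> = \<langle>h, f\<rangle>"
proof -
  obtain g where g: "g \<in> K" "\<And>h. h \<in> K \<Longrightarrow> \<langle>f, h\<rangle> = \<langle>g, h\<rangle>"
    using orth_proj_exists[OF K, of f] by (auto simp: cinner_diff_left)
  have eq: "orth_proj K f = g" by (rule orth_proj_eqI[OF K g])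
  show "orth_proj K f \<in> K" using eq g by simp
  show *: "h \<in> K \<Longrightarrow> \<langle>orth_proj K f, h\<rangle> = \<langle>f, h\<rangle>" for h using eq g by simp
  show "h \<in> K \<Longrightarrow> \<langle>h, orth_proj K f\<rangle> = \<langle>h, f\<rangle>" using * by (metis cinner_commute)
qed

lemma Riesz_representation:
  assumes K: "closed_csubspace K"
    and add: "\<And>f g. f \<in> K \<Longrightarrow> g \<in> K \<Longrightarrow> L (f + g) = L f + L g"
    and scale: "\<And>c f. f \<in> K \<Longrightarrow> L (c *\<^sub>C f) = c * L f"
    and bound: "\<And>f. f \<in> K \<Longrightarrow> cmod (L f) \<le> C * norm f"
  shows "\<exists>h\<in>K. \<forall>f\<in>K. L f = \<langle>f, h\<rangle>"
proof (cases "\<forall>f\<in>K. L f = 0")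
  case True
  then show ?thesis using closed_csubspaceD(1)[OF K] by (intro bexI[of _ 0]) auto
next
  case False
  then obtain f0 where f0: "f0 \<in> K" "L f0 \<noteq> 0" by blast
  note KD = closed_csubspaceD[OF K]
  have diff: "L (f - g) = L f - L g" if "f \<in> K" "g \<in> K" for f g
    using add[of f "- g"] scale[of g "-1"] that KD(6) by simp
  define N where "N = {f \<in> K. L f = 0}"
  have "closed N"
    unfolding closed_sequential_limits
  proof (intro allI impI)
    fix x l assume *: "(\<forall>n. x n \<in> N) \<and> x \<longlonglongrightarrow> l"
    then have lK: "l \<in> K" using closed_sequentially[OF KD(4), of x l] by (auto simp: N_def)
    have "cmod (L l) \<le> C * norm (l - x n)" for n
    proof -
      have "x n \<in> K" "L (x n) = 0" using * by (auto simp: N_def)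
      with lK show ?thesis using diff[of l "x n"] bound[of "l - x n"] KD(5)[of l "x n"] by simp
    qed
    moreover have "(\<lambda>n. C * norm (l - x n)) \<longlonglongrightarrow> C * norm (l - l)"
      using * by (intro tendsto_intros) auto
    ultimately have "cmod (L l) \<le> C * norm (l - l)"
      by (intro LIMSEQ_le_const) auto
    with lK show "l \<in> N" by (simp add: N_def)
  qed
  moreover have "L 0 = 0" using scale[OF KD(1), of 0] by simp
  ultimately have N: "closed_csubspace N"
    using KD add scale by (auto simp: closed_csubspace_def N_def)
  obtain p where p: "p \<in> N" "\<And>h. h \<in> N \<Longrightarrow> \<langle>f0 - p, h\<rangle> = 0"
    using orth_proj_exists[OF N] by blast
  define e where "e = f0 - p"
  have e: "e \<in> K" "L e = L f0" "\<And>h. h \<in> N \<Longrightarrow> \<langle>e, h\<rangle> = 0"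
    using p f0 KD(5) diff by (auto simp: e_def N_def)
  have e0: "e \<noteq> 0" using e(2) f0 \<open>L 0 = 0\<close> by auto
  show ?thesis
  proof (intro bexI ballI)
    \<comment> \<open>Since f - (L f / L e) e lies in the kernel N and e is orthogonal to N, pairing
      with e determines the scalar in front of e.\<close>
    show "(cnj (L e) / complex_of_real ((norm e)\<^sup>2)) *\<^sub>C e \<in> K" by (intro KD(3) e(1))
    fix f assume f: "f \<in> K"
    then have "f - (L f / L e) *\<^sub>C e \<in> N"
      using e f0 KD diff scale by (simp add: N_def)
    then have "\<langle>f - (L f / L e) *\<^sub>C e, e\<rangle> = 0" by (metis cinner_commute complex_cnj_zero e(3))
    then have "\<langle>f, e\<rangle> = L f / L e * complex_of_real ((norm e)\<^sup>2)"
      by (simp add: cinner_diff_left cinner_self)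
    then show "L f = \<langle>f, (cnj (L e) / complex_of_real ((norm e)\<^sup>2)) *\<^sub>C e\<rangle>"
      using e0 e(2) f0 by (simp add: field_simps)
  qed
qed

section \<open>Bounded operators on a closed subspace and their adjoints\<close>

lemma bounded_operator_onD:
  assumes "bounded_operator_on K A"
  shows "f \<in> K \<Longrightarrow> A f \<in> K" "f \<in> K \<Longrightarrow> g \<in> K \<Longrightarrow> A (f + g) = A f + A g"
    "f \<in> K \<Longrightarrow> A (c *\<^sub>C f) = c *\<^sub>C A f" "\<exists>C. \<forall>f\<in>K. norm (A f) \<le> C * norm f"
  using assms by (auto simp: bounded_operator_on_def)

lemma adjoint_on_eqI:
  assumes K: "closed_csubspace K" and "h \<in> K" "\<And>f. f \<in> K \<Longrightarrow> \<langle>A f, g\<rangle> = \<langle>f, h\<rangle>"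
  shows "adjoint_on K A g = h"
  unfolding adjoint_on_def
proof (rule the_equality)
  fix h' assume "h' \<in> K \<and> (\<forall>f\<in>K. \<langle>A f, g\<rangle> = \<langle>f, h'\<rangle>)"
  then show "h' = h"
    using assms by (intro cinner_eqI[OF K]) (metis cinner_commute)+
qed (use assms in auto)

lemma
  assumes K: "closed_csubspace K" and A: "bounded_operator_on K A" and g: "g \<in> K"
  shows adjoint_on_in: "adjoint_on K A g \<in> K"
    and cinner_adjoint_on: "f \<in> K \<Longrightarrow> \<langle>A f, g\<rangle> = \<langle>f, adjoint_on K A g\<rangle>"
    and cinner_adjoint_on_left: "f \<in> K \<Longrightarrow> \<langle>adjoint_on K A g, f\<rangle> = \<langle>g, A f\<rangle>"
proof -
  note A = bounded_operator_onD[OF A]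
  obtain C where C: "\<And>f. f \<in> K \<Longrightarrow> norm (A f) \<le> C * norm f" using A(4) by blast
  have "\<exists>h\<in>K. \<forall>f\<in>K. \<langle>A f, g\<rangle> = \<langle>f, h\<rangle>"
  proof (rule Riesz_representation[OF K, where C = "C * norm g"])
    fix f assume "f \<in> K"
    have "cmod \<langle>A f, g\<rangle> \<le> norm (A f) * norm g" by (rule cinner_Cauchy_Schwarz)
    also have "\<dots> \<le> C * norm f * norm g" by (intro mult_right_mono C \<open>f \<in> K\<close>) auto
    finally show "cmod \<langle>A f, g\<rangle> \<le> C * norm g * norm f" by (simp add: mult_ac)
  qed (auto simp: A cinner_add_left)
  then obtain h where h: "h \<in> K" "\<And>f. f \<in> K \<Longrightarrow> \<langle>A f, g\<rangle> = \<langle>f, h\<rangle>" by blast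
  have eq: "adjoint_on K A g = h" by (rule adjoint_on_eqI[OF K h])
  show "adjoint_on K A g \<in> K" using eq h by simp
  show *: "f \<in> K \<Longrightarrow> \<langle>A f, g\<rangle> = \<langle>f, adjoint_on K A g\<rangle>" for f using eq h by simp
  show "f \<in> K \<Longrightarrow> \<langle>adjoint_on K A g, f\<rangle> = \<langle>g, A f\<rangle>" using * by (metis cinner_commute)
qed

lemma bounded_operator_on_adjoint:
  assumes K: "closed_csubspace K" and A: "bounded_operator_on K A"
  shows "bounded_operator_on K (adjoint_on K A)"
proof -
  note KD = closed_csubspaceD[OF K]
  note adj = adjoint_on_in[OF K A] cinner_adjoint_on[OF K A] cinner_adjoint_on_left[OF K A]
  obtain C where C: "\<And>f. f \<in> K \<Longrightarrow> norm (A f) \<le> C * norm f"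
    using bounded_operator_onD(4)[OF A] by blast
  show ?thesis
    unfolding bounded_operator_on_def
  proof (intro conjI ballI allI)
    fix f g c assume f: "f \<in> K"
    show "adjoint_on K A f \<in> K" by (rule adj(1)[OF f])
    show "adjoint_on K A (c *\<^sub>C f) = c *\<^sub>C adjoint_on K A f"
      by (rule adjoint_on_eqI[OF K]) (auto simp: KD adj f)
    show "g \<in> K \<Longrightarrow> adjoint_on K A (f + g) = adjoint_on K A f + adjoint_on K A g"
      by (rule adjoint_on_eqI[OF K]) (auto simp: KD adj f cinner_add_right)
  next
    show "\<exists>C. \<forall>f\<in>K. norm (adjoint_on K A f) \<le> C * norm f"
    proof (intro exI ballI)
      fix f assume f: "f \<in> K"
      define h where "h = adjoint_on K A f"
      have h: "h \<in> K" unfolding h_def by (rule adj(1)[OF f])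
      have "complex_of_real ((norm h)\<^sup>2) = \<langle>A h, f\<rangle>"
        using adj(2)[OF f h] by (simp add: h_def[symmetric] cinner_self)
      from arg_cong[OF this, of cmod] have "(norm h)\<^sup>2 = cmod \<langle>A h, f\<rangle>"
        by (simp only: norm_of_real abs_power2)
      also have "\<dots> \<le> norm (A h) * norm f" by (rule cinner_Cauchy_Schwarz)
      also have "\<dots> \<le> C * norm h * norm f" by (intro mult_right_mono C h) auto
      finally have "norm h * norm h \<le> C * norm f * norm h" by (simp add: power2_eq_square mult_ac)
      \<comment> \<open>The absolute value is for a negative bound C, which can occur on the trivial
        space, where h = 0.\<close>
      then have "norm h \<le> \<bar>C\<bar> * norm f"
      proof (cases "norm h = 0")
        case False
        then have "norm h \<le> C * norm f"
          using \<open>norm h * norm h \<le> C * norm f * norm h\<close> by (simp add: mult_le_cancel_right)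
        also have "\<dots> \<le> \<bar>C\<bar> * norm f" by (intro mult_right_mono) auto
        finally show ?thesis .
      qed simp
      then show "norm (adjoint_on K A f) \<le> \<bar>C\<bar> * norm f" by (simp add: h_def)
    qed
  qed
qed

lemma adjoint_on_adjoint_on:
  assumes K: "closed_csubspace K" and A: "bounded_operator_on K A" and f: "f \<in> K"
  shows "adjoint_on K (adjoint_on K A) f = A f"
  by (rule adjoint_on_eqI[OF K])
     (auto simp: bounded_operator_onD[OF A] f cinner_adjoint_on_left[OF K A])

lemma bounded_operator_on_translate:
  assumes K: "closed_csubspace K" and A: "bounded_operator_on K A"
  shows "bounded_operator_on K (\<lambda>f. a *\<^sub>C A f + b *\<^sub>C f)"
proof -
  note KD = closed_csubspaceD[OF K]
  note AD = bounded_operator_onD[OF A]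
  obtain C where C: "\<And>f. f \<in> K \<Longrightarrow> norm (A f) \<le> C * norm f" using AD(4) by blast
  show ?thesis
    unfolding bounded_operator_on_def
  proof (intro conjI ballI allI)
    show "\<exists>C. \<forall>f\<in>K. norm (a *\<^sub>C A f + b *\<^sub>C f) \<le> C * norm f"
    proof (intro exI ballI)
      fix f assume "f \<in> K"
      have "norm (a *\<^sub>C A f + b *\<^sub>C f) \<le> cmod a * norm (A f) + cmod b * norm f"
        by (metis norm_triangle_ineq norm_scaleC)
      also have "\<dots> \<le> cmod a * (C * norm f) + cmod b * norm f"
        using C[OF \<open>f \<in> K\<close>] by (intro add_mono mult_left_mono) auto
      finally show "norm (a *\<^sub>C A f + b *\<^sub>C f) \<le> (cmod a * C + cmod b) * norm f"
        by (simp add: algebra_simps)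
    qed
  qed (auto simp: KD AD l2.scale_right_distrib mult.commute)
qed

lemma adjoint_on_translate:
  assumes K: "closed_csubspace K" and A: "bounded_operator_on K A" and f: "f \<in> K"
  shows "adjoint_on K (\<lambda>f. a *\<^sub>C A f + b *\<^sub>C f) f = cnj a *\<^sub>C adjoint_on K A f + cnj b *\<^sub>C f"
  using closed_csubspaceD[OF K] adjoint_on_in[OF K A f] f
  by (intro adjoint_on_eqI[OF K]) (auto simp: cinner_simps cinner_adjoint_on[OF K A f])

text \<open>Polarization: a form that vanishes on the diagonal vanishes.\<close>

lemma normal_on_iff_norm:
  assumes K: "closed_csubspace K" and A: "bounded_operator_on K A"
  shows "normal_on K A \<longleftrightarrow> (\<forall>f\<in>K. norm (adjoint_on K A f) = norm (A f))"
proof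
  note KD = closed_csubspaceD[OF K]
  note AD = bounded_operator_onD[OF A]
  note SD = bounded_operator_onD[OF bounded_operator_on_adjoint[OF K A]]
  note adj = adjoint_on_in[OF K A] cinner_adjoint_on[OF K A] cinner_adjoint_on_left[OF K A]
  {
    assume N: "normal_on K A"
    show "\<forall>f\<in>K. norm (adjoint_on K A f) = norm (A f)"
    proof
      fix f assume f: "f \<in> K"
      have "\<langle>adjoint_on K A f, adjoint_on K A f\<rangle> = \<langle>A f, A f\<rangle>"
        using N f by (simp add: adj AD normal_on_def flip: adj(2))
      then have "(norm (adjoint_on K A f))\<^sup>2 = (norm (A f))\<^sup>2"
        unfolding cinner_self by (rule of_real_eq_iff[THEN iffD1])
      then show "norm (adjoint_on K A f) = norm (A f)" by (simp add: power2_eq_iff_nonneg)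
    qed
  }
  {
    assume N: "\<forall>f\<in>K. norm (adjoint_on K A f) = norm (A f)"
    define q where "q f g = \<langle>adjoint_on K A f, adjoint_on K A g\<rangle> - \<langle>A f, A g\<rangle>" for f g
    have q0: "q f f = 0" if "f \<in> K" for f
      using N that by (simp add: q_def cinner_self)
    have "q f g = 0" if f: "f \<in> K" and g: "g \<in> K" for f g
    proof -
      have "q (f + g) (f + g) = q f f + q f g + q g f + q g g"
        using f g by (simp add: q_def AD SD cinner_simps)
      moreover have "q (f + \<i> *\<^sub>C g) (f + \<i> *\<^sub>C g) = q f f - \<i> * q f g + \<i> * q g f + q g g"
        using f g by (simp add: q_def AD SD cinner_simps KD algebra_simps)
      ultimately have "q f g + q g f = 0" "\<i> * (q g f - q f g) = 0"
        using f g KD q0 by (auto simp: algebra_simps)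
      then have "q f g + q g f = 0" "q g f - q f g = 0" by auto
      then show ?thesis by (auto simp: algebra_simps)
    qed
    then show "normal_on K A"
      unfolding normal_on_def
      by (intro ballI cinner_eqI[OF K]) (auto simp: adj AD q_def)
  }
qed

section \<open>The trigonometric system is total\<close>

definition zp :: "nat \<Rightarrow> ltwo" where "zp n = to_L2 (\<lambda>z. z ^ n)"

lemma square_integrable_power [simp]: "square_integrable (\<lambda>z. z ^ n)"
  by (intro square_integrable_continuous continuous_intros)

lemma square_integrable_id [simp]: "square_integrable (\<lambda>z. z)"
  using square_integrable_power[of 1] by simp

lemma square_integrable_const [simp]: "square_integrable (\<lambda>z. c)"
  by (intro square_integrable_continuous continuous_intros)

lemma zp_0: "zp 0 = l2_const 1"
  by (simp add: zp_def)

lemma zp_add: "zp m \<odot> zp n = zp (m + n)"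
  by (simp add: zp_def to_L2_mult power_add[symmetric])

lemma z_mult_zp: "l2_z \<odot> zp n = zp (Suc n)"
  using zp_add[of 1 n] by (simp add: zp_def)

lemma unimodular_zp [simp]: "l2_unimodular (zp n)"
  unfolding zp_def by (subst unimodular_to_L2) (auto simp: norm_power intro!: AE_I2)

lemma l2_bdd_zp [simp]: "l2_bdd (zp n)"
  by (simp add: l2_bdd_unimodular)

lemma norm_zp [simp]: "norm (zp n) = 1"
  using norm_unimodular_mult[of "zp n" "l2_const 1"] by simp

lemma cinner_one_one [simp]: "\<langle>l2_const 1, l2_const 1\<rangle> = 1"
  by (simp add: cinner_self)

lemma cinner_zp_one:
  assumes "n > 0"
  shows "\<langle>zp n, l2_const 1\<rangle> = 0"
  unfolding zp_def using circle_integral_power[OF assms] by (subst cinner_to_L2) auto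

lemma cinner_zp: "\<langle>zp m, zp n\<rangle> = (if m = n then 1 else 0)"
proof -
  have *: "\<langle>zp m, zp n\<rangle> = 0" if "m > n" for m n
  proof -
    have "\<langle>zp m, zp n\<rangle> = \<langle>zp n \<odot> zp (m - n), zp n \<odot> l2_const 1\<rangle>"
      using that by (simp add: zp_add)
    also have "\<dots> = 0" using that by (simp only: cinner_unimodular[OF unimodular_zp] cinner_zp_one zero_less_diff)
    finally show ?thesis .
  qed
  consider "m > n" | "n > m" | "m = n" by linarith
  then show ?thesis
  proof cases
    case 2
    then show ?thesis using *[OF 2] cinner_commute[of "zp m" "zp n"] by simp
  qed (auto simp: * cinner_self)
qed

lemma z_cnj_zp: "l2_cnj l2_z \<odot> zp (Suc n) = zp n"
  by (simp add: z_mult_zp[symmetric] unimodular_cancel)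

lemma cnj_z_cnj_zp: "l2_cnj l2_z \<odot> l2_cnj (zp n) = l2_cnj (zp (Suc n))"
  by (simp add: z_mult_zp[symmetric] cnj_mult)

definition fourier_null :: "ltwo set" where
  "fourier_null = {h. \<forall>n. \<langle>h, zp n\<rangle> = 0 \<and> \<langle>h, l2_cnj (zp n)\<rangle> = 0}"

text \<open>Multiplication by z shifts the two-sided sequence of exponents by one. The case
  distinctions on n treat the passage through exponent 0, where the families \<open>zp n\<close> and
  \<open>l2_cnj (zp n)\<close> meet.\<close>

lemma fourier_null_z:
  assumes h: "h \<in> fourier_null"
  shows "l2_z \<odot> h \<in> fourier_null" "l2_cnj l2_z \<odot> h \<in> fourier_null"
proof -
  have a: "\<langle>h, l2_cnj l2_z \<odot> zp n\<rangle> = 0" "\<langle>h, l2_z \<odot> l2_cnj (zp n)\<rangle> = 0" for n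
  proof -
    have one: "l2_z \<odot> l2_cnj (zp 0) = zp 1" "l2_cnj l2_z \<odot> zp 0 = l2_cnj (zp 1)"
      by (simp_all add: zp_0, simp_all add: zp_def)
    show "\<langle>h, l2_cnj l2_z \<odot> zp n\<rangle> = 0"
      using h one by (cases n) (auto simp: z_cnj_zp fourier_null_def)
    have "l2_z \<odot> l2_cnj (zp (Suc m)) = l2_cnj (zp m)" for m
      by (simp add: z_mult_zp[symmetric] cnj_mult unimodular_cancel)
    then show "\<langle>h, l2_z \<odot> l2_cnj (zp n)\<rangle> = 0"
      using h one by (cases n) (auto simp: fourier_null_def)
  qed
  show "l2_z \<odot> h \<in> fourier_null" "l2_cnj l2_z \<odot> h \<in> fourier_null"
    using h by (auto simp: fourier_null_def cinner_mult_left a z_mult_zp cnj_z_cnj_zp)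
qed

lemma fourier_null_linear:
  "f \<in> fourier_null \<Longrightarrow> g \<in> fourier_null \<Longrightarrow> f + g \<in> fourier_null"
  "f \<in> fourier_null \<Longrightarrow> c *\<^sub>C f \<in> fourier_null"
  by (auto simp: fourier_null_def cinner_add_left)

lemma continuous_on_real_polynomial:
  assumes "real_polynomial_function (p :: complex \<Rightarrow> real)"
  shows "continuous_on S (\<lambda>z. complex_of_real (p z))"
  using continuous_real_polymonial_function[OF assms]
  by (intro continuous_intros continuous_at_imp_continuous_on) auto

text \<open>The induction carries invariance of the whole null space, because a product of
  polynomials acts by one factor after the other. In the linear case a real functional of z is
  written as a z plus its conjugate.\<close>

lemma fourier_null_polynomial:
  assumes "real_polynomial_function (p :: complex \<Rightarrow> real)" "h \<in> fourier_null"
  shows "to_L2 (\<lambda>z. complex_of_real (p z)) \<odot> h \<in> fourier_null"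
  using assms
proof (induction arbitrary: h)
  case (linear f)
  note h = linear.prems
  interpret bounded_linear f by (rule linear.hyps)
  define a where "a = (complex_of_real (f 1) - \<i> * complex_of_real (f \<i>)) / 2"
  have f: "f z = Re z * f 1 + Im z * f \<i>" for z
  proof -
    have "z = Re z *\<^sub>R 1 + Im z *\<^sub>R \<i>" by (simp add: complex_eq_iff)
    then have "f z = f (Re z *\<^sub>R 1 + Im z *\<^sub>R \<i>)" by (rule arg_cong)
    then show ?thesis by (simp only: add scaleR real_scaleR_def)
  qed
  have "complex_of_real (f z) = a * z + cnj a * cnj z" for z
    unfolding f[of z] a_def by (simp add: complex_eq_iff field_simps)
  then have "to_L2 (\<lambda>z. complex_of_real (f z)) = a *\<^sub>C l2_z + cnj a *\<^sub>C l2_cnj l2_z"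
    by (simp add: to_L2_add to_L2_scale to_L2_cnj square_integrable_scale square_integrable_cnj)
  moreover have "(a *\<^sub>C l2_z + cnj a *\<^sub>C l2_cnj l2_z) \<odot> h =
      a *\<^sub>C (l2_z \<odot> h) + cnj a *\<^sub>C (l2_cnj l2_z \<odot> h)"
    by (simp add: bdd_add_mult bdd_scale_mult)
  ultimately show ?case
    using h by (auto intro!: fourier_null_linear fourier_null_z)
next
  case (const c)
  then show ?case by (simp add: mult_const_left fourier_null_linear)
next
  case (add f g)
  have *: "square_integrable (\<lambda>z. complex_of_real (f z))" "square_integrable (\<lambda>z. complex_of_real (g z))"
    "l2_bdd (to_L2 (\<lambda>z. complex_of_real (f z)))" "l2_bdd (to_L2 (\<lambda>z. complex_of_real (g z)))"
    using add.hyps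
    by (auto intro!: square_integrable_continuous l2_bdd_continuous continuous_on_real_polynomial)
  then have "to_L2 (\<lambda>z. complex_of_real (f z + g z)) \<odot> h =
      to_L2 (\<lambda>z. complex_of_real (f z)) \<odot> h + to_L2 (\<lambda>z. complex_of_real (g z)) \<odot> h"
    by (simp add: to_L2_add bdd_add_mult)
  with add show ?case by (simp add: fourier_null_linear)
next
  case (mult f g)
  have *: "square_integrable (\<lambda>z. complex_of_real (f z))" "square_integrable (\<lambda>z. complex_of_real (g z))"
    "square_integrable (\<lambda>z. complex_of_real (f z * g z))"
    "l2_bdd (to_L2 (\<lambda>z. complex_of_real (f z)))" "l2_bdd (to_L2 (\<lambda>z. complex_of_real (g z)))"
    using mult.hyps
    by (auto intro!: square_integrable_continuous l2_bdd_continuous continuous_on_real_polynomial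
        simp del: of_real_mult)
  then have "to_L2 (\<lambda>z. complex_of_real (f z * g z)) =
      to_L2 (\<lambda>z. complex_of_real (f z)) \<odot> to_L2 (\<lambda>z. complex_of_real (g z))"
    by (simp add: to_L2_mult)
  with * mult show ?case by (simp add: mult_assoc)
qed

lemma norm_to_L2_le:
  assumes f: "continuous_on (sphere 0 1) f" and le: "\<And>z. z \<in> sphere 0 1 \<Longrightarrow> cmod (f z) \<le> e"
  shows "norm (to_L2 f) \<le> e"
proof -
  have "e \<ge> 0" using le[of 1] order_trans[OF norm_ge_zero[of "f 1"]] by simp
  have sq: "square_integrable f" by (rule square_integrable_continuous[OF f])
  have "(norm (to_L2 f))\<^sup>2 = (LINT z|circle_measure. (cmod (f z))\<^sup>2)" by (rule norm_to_L2[OF sq])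
  also have "\<dots> \<le> (LINT z|circle_measure. e\<^sup>2)"
    using sq le by (intro integral_mono) (auto simp: square_integrable_def intro!: power_mono)
  also have "\<dots> = e\<^sup>2" using circle.prob_space by simp
  finally show ?thesis using \<open>e \<ge> 0\<close> by (rule power2_le_imp_le)
qed

text \<open>Stone-Weierstrass replaces g by a polynomial p up to a uniform error e. The pairing with
  p is the zeroth coefficient of p h, which is 0, and the error is at most e times the norm of
  h.\<close>

lemma fourier_null_continuous:
  fixes g :: "complex \<Rightarrow> real"
  assumes h: "to_L2 h \<in> fourier_null" "square_integrable h" and g: "continuous_on (sphere 0 1) g"
  shows "(LINT z|circle_measure. g z *\<^sub>R h z) = 0"
proof -
  define G where "G = to_L2 (\<lambda>z. complex_of_real (g z))"
  have gc: "continuous_on (sphere 0 1) (\<lambda>z. complex_of_real (g z))"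
    by (intro continuous_intros g)
  have G: "square_integrable (\<lambda>z. complex_of_real (g z))" "l2_bdd G"
    unfolding G_def by (intro square_integrable_continuous l2_bdd_continuous gc)+
  have le: "cmod \<langle>to_L2 h, G\<rangle> \<le> norm (to_L2 h) * e" if "e > 0" for e
  proof -
    obtain p where p: "real_polynomial_function p" "\<And>z. z \<in> sphere 0 1 \<Longrightarrow> \<bar>g z - p z\<bar> < e"
      using Stone_Weierstrass_real_polynomial_function[OF compact_sphere g \<open>e > 0\<close>] by blast
    define P where "P = to_L2 (\<lambda>z. complex_of_real (p z))"
    have pc: "continuous_on (sphere 0 1) (\<lambda>z. complex_of_real (p z))"
      by (rule continuous_on_real_polynomial[OF p(1)])
    have P: "square_integrable (\<lambda>z. complex_of_real (p z))" "l2_bdd P"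
      unfolding P_def by (intro square_integrable_continuous l2_bdd_continuous pc)+
    have "l2_cnj P = P"
      unfolding P_def using to_L2_cnj[OF P(1)] by simp
    then have "\<langle>to_L2 h, P\<rangle> = \<langle>P \<odot> to_L2 h, zp 0\<rangle>"
      using P by (simp add: cinner_mult_left zp_0)
    also have "\<dots> = 0"
      using fourier_null_polynomial[OF p(1) h(1)] by (simp add: P_def fourier_null_def)
    finally have "cmod \<langle>to_L2 h, G\<rangle> = cmod \<langle>to_L2 h, G - P\<rangle>" by (simp add: cinner_diff_right)
    also have "\<dots> \<le> norm (to_L2 h) * norm (G - P)" by (rule cinner_Cauchy_Schwarz)
    also have "G - P = to_L2 (\<lambda>z. complex_of_real (g z) - complex_of_real (p z))"
      by (simp add: G_def P_def to_L2_diff G P)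
    also have "norm \<dots> \<le> e"
    proof (rule norm_to_L2_le)
      show "cmod (complex_of_real (g z) - complex_of_real (p z)) \<le> e" if "z \<in> sphere 0 1" for z
        using p(2)[OF that] by (metis less_imp_le norm_of_real of_real_diff)
    qed (intro continuous_intros gc pc)
    finally show ?thesis by (simp add: mult_left_mono)
  qed
  have "\<langle>to_L2 h, G\<rangle> = 0"
  proof (cases "norm (to_L2 h) = 0")
    case False
    then have pos: "norm (to_L2 h) > 0" by simp
    show ?thesis
    proof (rule ccontr)
      assume "\<langle>to_L2 h, G\<rangle> \<noteq> 0"
      then have "cmod \<langle>to_L2 h, G\<rangle> / (2 * norm (to_L2 h)) > 0" using pos by simp
      from le[OF this] pos \<open>\<langle>to_L2 h, G\<rangle> \<noteq> 0\<close> show False by simp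
    qed
  qed simp
  then show ?thesis
    unfolding G_def cinner_to_L2[OF h(2) G(1)] by (simp add: scaleR_conv_of_real mult.commute)
qed

lemma fourier_null_closed:
  assumes h: "to_L2 h \<in> fourier_null" "square_integrable h" and S: "closed S"
  shows "(LINT z|circle_measure. indicator S z *\<^sub>R h z) = 0"
\<comment> \<open>\<open>infdist\<close> to the empty set is 0 by convention, so the cut-offs below
  would be 1 there and not approximate the indicator.\<close>
proof (cases "S = {}")
  case False
  \<comment> \<open>Continuous cut-offs that equal 1 on S and decrease to its indicator, since a
    point outside the closed set S has positive distance from it.\<close>
  define g where "g n z = max 0 (1 - real n * infdist z S)" for n z
  have gc: "continuous_on A (g n)" for A n
    unfolding g_def by (intro continuous_intros)
  have [measurable]: "h \<in> borel_measurable circle_measure" "g n \<in> borel_measurable circle_measure" for n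
    using h(2) measurable_circle_continuous[OF gc] by (auto simp: square_integrable_def)
  have lim: "(\<lambda>n. g n z) \<longlonglongrightarrow> indicator S z" for z
  proof (cases "z \<in> S")
    case True
    then have "g n z = 1" for n by (simp add: g_def)
    with True show ?thesis by simp
  next
    case zS: False
    then have d: "infdist z S > 0"
      using in_closed_iff_infdist_zero[OF S False] infdist_nonneg[of z S] by fastforce
    obtain N where N: "1 < real N * infdist z S" using reals_Archimedean3[OF d] by blast
    have "g n z = 0" if "n \<ge> N" for n
    proof -
      have "real N * infdist z S \<le> real n * infdist z S" using that d by (intro mult_right_mono) auto
      then show ?thesis using N by (simp add: g_def)
    qed
    then have "eventually (\<lambda>n. g n z = indicator S z) sequentially"
      using zS by (auto simp: eventually_sequentially)
    then show ?thesis by (rule tendsto_eventually)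
  qed
  have "(\<lambda>n. LINT z|circle_measure. g n z *\<^sub>R h z) \<longlonglongrightarrow> (LINT z|circle_measure. indicator S z *\<^sub>R h z)"
  proof (rule integral_dominated_convergence)
    show "integrable circle_measure (\<lambda>z. cmod (h z))" by (rule integrable_norm[OF h(2)])
    show "AE z in circle_measure. (\<lambda>n. g n z *\<^sub>R h z) \<longlonglongrightarrow> indicator S z *\<^sub>R h z"
      by (intro AE_I2 tendsto_intros lim)
    show "AE z in circle_measure. norm (g n z *\<^sub>R h z) \<le> cmod (h z)" for n
    proof (rule AE_I2)
      fix z
      have "\<bar>g n z\<bar> \<le> 1" using infdist_nonneg[of z S] by (auto simp: g_def)
      then show "norm (g n z *\<^sub>R h z) \<le> cmod (h z)" by (simp add: mult_left_le_one_le)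
    qed
    show "(\<lambda>z. indicator S z *\<^sub>R h z) \<in> borel_measurable circle_measure"
    proof (rule borel_measurable_LIMSEQ_metric[where f = "\<lambda>n z. g n z *\<^sub>R h z"])
      show "(\<lambda>n. g n z *\<^sub>R h z) \<longlonglongrightarrow> indicator S z *\<^sub>R h z" for z
        by (intro tendsto_intros lim)
    qed measurable
  qed measurable
  moreover have "(LINT z|circle_measure. g n z *\<^sub>R h z) = 0" for n
    by (rule fourier_null_continuous[OF h gc])
  ultimately show ?thesis by (simp add: LIMSEQ_const_iff)
qed simp

text \<open>Closed sets are an intersection-stable generator of the Borel sets, so vanishing
  integrals over closed sets pass to all Borel sets by Dynkin induction. An integrable function
  whose integrals over all measurable sets vanish is 0 almost everywhere.\<close>

lemma fourier_null_eq_0: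
  assumes "f \<in> fourier_null"
  shows "f = 0"
proof -
  obtain h where h: "square_integrable h" "f = to_L2 h" by (rule ltwo_cases)
  have int: "integrable circle_measure h"
    using integrable_mult_cnj[OF h(1) square_integrable_const[of 1]] by simp
  have null: "to_L2 h \<in> fourier_null" using assms h by simp
  have sets: "B \<inter> sphere 0 1 \<in> sets circle_measure" if "B \<in> sets borel" for B
    using that by (auto simp: sets_circle_measure sets_restrict_space Int_commute)
  have sint: "set_integrable circle_measure (B \<inter> sphere 0 1) h" if "B \<in> sets borel" for B
    unfolding set_integrable_def by (rule integrable_mult_indicator[OF sets[OF that] int])
  have closed: "(LINT z:(S \<inter> sphere 0 1)|circle_measure. h z) = 0" if "closed S" for S
    using fourier_null_closed[OF null h(1), of "S \<inter> sphere 0 1"] that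
    by (simp add: set_lebesgue_integral_def closed_Int)
  have borel: "(LINT z:(B \<inter> sphere 0 1)|circle_measure. h z) = 0" if "B \<in> sets borel" for B
  proof -
    have bs: "A \<in> sets borel" if "A \<in> sigma_sets UNIV {S. closed S}" for A :: "complex set"
      using that by (simp add: borel_eq_closed)
    have "Int_stable {S :: complex set. closed S}"
      by (auto simp: Int_stable_def)
    moreover have "{S :: complex set. closed S} \<subseteq> Pow UNIV" by simp
    moreover have "B \<in> sigma_sets UNIV {S. closed S}"
      using that by (simp add: borel_eq_closed)
    ultimately show ?thesis
    proof (induction rule: sigma_sets_induct_disjoint)
      case (basic A)
      then show ?case using closed by simp
    next
      case empty
      then show ?case by (simp add: set_lebesgue_integral_def)
    next
      case (compl A)
      have A: "A \<in> sets borel" by (rule bs[OF compl(1)])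
      have "(LINT z:((UNIV - A) \<inter> sphere 0 1) \<union> (A \<inter> sphere 0 1)|circle_measure. h z) =
          (LINT z:((UNIV - A) \<inter> sphere 0 1)|circle_measure. h z) + (LINT z:(A \<inter> sphere 0 1)|circle_measure. h z)"
        using A by (intro set_integral_Un sint) auto
      moreover have "((UNIV - A) \<inter> sphere 0 1) \<union> (A \<inter> sphere 0 1) = UNIV \<inter> sphere (0::complex) 1" by auto
      ultimately show ?case using compl closed[OF closed_UNIV] by simp
    next
      case (union A)
      have "(LINT z:(\<Union>i. A i \<inter> sphere 0 1)|circle_measure. h z) =
          (\<Sum>i. LINT z:(A i \<inter> sphere 0 1)|circle_measure. h z)"
      proof (rule lebesgue_integral_countable_add)
        show "A i \<inter> sphere 0 1 \<in> sets circle_measure" for i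
          using union(2) by (intro sets bs) auto
        have "(\<Union>i. A i) \<in> sets borel" using union(2) by (intro sets.countable_UN') (auto intro: bs)
        from sint[OF this] show "set_integrable circle_measure (\<Union>i. A i \<inter> sphere 0 1) h" by simp
      qed (use union in \<open>auto simp: disjoint_family_on_def\<close>)
      with union show ?case by simp
    qed
  qed
  have "AE z in circle_measure. h z = 0"
  proof (rule circle.density_zero[OF int])
    fix A assume "A \<in> sets circle_measure"
    then obtain B where "B \<in> sets borel" "A = B \<inter> sphere 0 1"
      by (auto simp: sets_circle_measure sets_restrict_space)
    then show "(LINT z:A|circle_measure. h z) = 0" using borel by simp
  qed
  then have "to_L2 h = to_L2 (\<lambda>_. 0)" using h by (simp add: to_L2_eq_iff)
  with h show ?thesis by (simp add: to_L2_zero)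
qed

section \<open>The Hardy space through Fourier coefficients\<close>

text \<open>On the circle the conjugate of z^n is z^(-n), so all coefficients of negative index
  vanish; \<open>Suc n\<close> lets the list start at index -1. \<open>hardy2_eq\<close> identifies
  this with the space of boundary values.\<close>

definition H2 :: "ltwo set" where
  "H2 = {f. \<forall>n. \<langle>f, l2_cnj (zp (Suc n))\<rangle> = 0}"

lemma H2D: "f \<in> H2 \<Longrightarrow> \<langle>f, l2_cnj (zp (Suc n))\<rangle> = 0"
  by (simp add: H2_def)

lemma H2_closed: "closed_csubspace H2"
proof -
  have "closed H2"
    unfolding closed_sequential_limits
  proof (intro allI impI)
    fix x l assume *: "(\<forall>n. x n \<in> H2) \<and> x \<longlonglongrightarrow> l"
    show "l \<in> H2"
      unfolding H2_def
    proof (intro CollectI allI)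
      fix n
      have "(\<lambda>k. \<langle>x k, l2_cnj (zp (Suc n))\<rangle>) \<longlonglongrightarrow> \<langle>l, l2_cnj (zp (Suc n))\<rangle>"
        using * by (intro tendsto_cinner) auto
      then show "\<langle>l, l2_cnj (zp (Suc n))\<rangle> = 0"
        using * by (simp add: H2D LIMSEQ_const_iff)
    qed
  qed
  then show ?thesis by (auto simp: closed_csubspace_def H2_def cinner_add_left)
qed

lemmas H2_subspace = closed_csubspaceD[OF H2_closed]

lemma zp_mult_H2:
  assumes "f \<in> H2"
  shows "zp n \<odot> f \<in> H2"
  unfolding H2_def
proof (intro CollectI allI)
  fix m
  have "\<langle>zp n \<odot> f, l2_cnj (zp (Suc m))\<rangle> = \<langle>f, l2_cnj (zp (Suc (n + m)))\<rangle>"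
    by (simp add: cinner_mult_left zp_add flip: cnj_mult)
  then show "\<langle>zp n \<odot> f, l2_cnj (zp (Suc m))\<rangle> = 0" using H2D[OF assms] by simp
qed

lemma z_mult_H2: "f \<in> H2 \<Longrightarrow> l2_z \<odot> f \<in> H2"
  using zp_mult_H2[of f 1] by (simp add: zp_def)

lemma one_H2 [simp]: "l2_const 1 \<in> H2"
  unfolding H2_def
proof (intro CollectI allI)
  fix n
  have "\<langle>l2_const 1, l2_cnj (zp (Suc n))\<rangle> = \<langle>zp (Suc n), l2_const 1\<rangle>"
    using cinner_mult_left[of "zp (Suc n)" "l2_const 1" "l2_const 1"] by simp
  then show "\<langle>l2_const 1, l2_cnj (zp (Suc n))\<rangle> = 0" by (simp add: cinner_zp_one)
qed

lemma zp_H2 [simp]: "zp n \<in> H2"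
  using zp_mult_H2[OF one_H2, of n] by simp

lemma H2_total:
  assumes "f \<in> H2" "\<And>n. \<langle>f, zp n\<rangle> = 0"
  shows "f = 0"
proof (rule fourier_null_eq_0)
  have "\<langle>f, l2_cnj (zp n)\<rangle> = 0" for n
    using assms(2)[of 0] H2D[OF assms(1)] by (cases n) (auto simp: zp_0)
  with assms show "f \<in> fourier_null" by (simp add: fourier_null_def)
qed

text \<open>Totality speaks about members of \<open>H2\<close> only, so it is applied to the
  projection of h, which has the same nonnegative coefficients.\<close>

lemma H2_orth:
  assumes f: "f \<in> H2" and h: "\<And>n. \<langle>h, zp n\<rangle> = 0"
  shows "\<langle>f, h\<rangle> = 0"
proof -
  note P = orth_proj_in[OF H2_closed, of h] cinner_orth_proj_right[OF H2_closed, of _ h]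
    cinner_orth_proj[OF H2_closed, of _ h]
  have "orth_proj H2 h = 0"
    by (rule H2_total) (auto simp: P h)
  then show ?thesis using P(2)[OF f] by simp
qed

text \<open>The conjugate of z g has strictly negative frequencies only. Most later orthogonality
  claims are brought into this form.\<close>

lemma H2_orth_cnj:
  assumes "f \<in> H2" "g \<in> H2"
  shows "\<langle>f, l2_cnj (l2_z \<odot> g)\<rangle> = 0"
proof (rule H2_orth[OF assms(1)])
  fix n
  have "\<langle>l2_cnj (l2_z \<odot> g), zp n\<rangle> = \<langle>l2_cnj (zp n), l2_z \<odot> g\<rangle>"
    using cinner_cnj_cnj[of "l2_z \<odot> g" "l2_cnj (zp n)"] by simp
  also have "\<dots> = \<langle>l2_cnj (zp (Suc n)), g\<rangle>"
    by (simp add: cinner_mult_right cnj_z_cnj_zp)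
  also have "\<dots> = 0" using H2D[OF assms(2), of n] by (metis cinner_commute complex_cnj_zero)
  finally show "\<langle>l2_cnj (l2_z \<odot> g), zp n\<rangle> = 0" .
qed

lemma mult_H2:
  assumes "f \<in> H2" "g \<in> H2" "l2_bdd g"
  shows "g \<odot> f \<in> H2"
  unfolding H2_def
proof (intro CollectI allI)
  fix n
  have "l2_z \<odot> (zp n \<odot> g) = g \<odot> zp (Suc n)"
    by (simp add: mult_assoc[symmetric] z_mult_zp mult_commute[of g])
  then have "l2_cnj g \<odot> l2_cnj (zp (Suc n)) = l2_cnj (l2_z \<odot> (zp n \<odot> g))"
    using assms(3) by (simp add: cnj_mult)
  then have "\<langle>g \<odot> f, l2_cnj (zp (Suc n))\<rangle> = \<langle>f, l2_cnj (l2_z \<odot> (zp n \<odot> g))\<rangle>"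
    using assms(3) by (simp add: cinner_mult_left)
  also have "\<dots> = 0" by (intro H2_orth_cnj zp_mult_H2 assms)
  finally show "\<langle>g \<odot> f, l2_cnj (zp (Suc n))\<rangle> = 0" .
qed

lemma cnj_z_mult_H2:
  assumes "f \<in> H2" "\<langle>f, l2_const 1\<rangle> = 0"
  shows "l2_cnj l2_z \<odot> f \<in> H2"
  unfolding H2_def
proof (intro CollectI allI)
  fix n
  have "\<langle>l2_cnj l2_z \<odot> f, l2_cnj (zp (Suc n))\<rangle> = \<langle>f, l2_z \<odot> l2_cnj (zp (Suc n))\<rangle>"
    by (simp add: cinner_mult_left)
  also have "l2_z \<odot> l2_cnj (zp (Suc n)) = l2_cnj (zp n)"
    by (simp add: z_mult_zp[symmetric] cnj_mult unimodular_cancel)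
  also have "\<langle>f, l2_cnj (zp n)\<rangle> = 0"
    using assms(2) H2D[OF assms(1)] by (cases n) (auto simp: zp_0)
  finally show "\<langle>l2_cnj l2_z \<odot> f, l2_cnj (zp (Suc n))\<rangle> = 0" .
qed

lemma ltwo_decomp:
  obtains g1 g2 where "g1 \<in> H2" "g2 \<in> H2" "f = g1 + l2_cnj g2"
proof
  show "orth_proj H2 f \<in> H2" by (rule orth_proj_in[OF H2_closed])
  show "f = orth_proj H2 f + l2_cnj (l2_cnj (f - orth_proj H2 f))" by simp
  have "\<langle>l2_cnj (f - orth_proj H2 f), l2_cnj (zp (Suc n))\<rangle> = 0" for n
    unfolding cinner_cnj_cnj by (simp add: cinner_diff_right cinner_orth_proj_right[OF H2_closed])
  then show "l2_cnj (f - orth_proj H2 f) \<in> H2" by (simp add: H2_def)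
qed

subsection \<open>Cauchy and Poisson kernels\<close>

text \<open>This is the reproducing kernel of \<open>H2\<close> at w: pairing with it sums the power
  series of the nonnegative coefficients at w.\<close>

definition cauchy_kernel :: "complex \<Rightarrow> ltwo" where
  "cauchy_kernel w = to_L2 (\<lambda>z. 1 / (1 - cnj w * z))"

lemma kernel_denominator:
  assumes "cmod w < 1" "z \<in> sphere 0 1"
  shows "1 - cnj w * z \<noteq> 0"
proof
  assume "1 - cnj w * z = 0"
  then have "cnj w * z = 1" by simp
  then have "cmod (cnj w * z) = 1" by simp
  then show False using assms by (simp add: norm_mult)
qed

lemma continuous_on_kernel:
  assumes "cmod w < 1"
  shows "continuous_on (sphere 0 1) (\<lambda>z. 1 / (1 - cnj w * z))"
  using kernel_denominator[OF assms] by (intro continuous_intros) auto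

text \<open>One step of the geometric series, with exact remainder. Iterating it, with the remainder
  damped by powers of w, gives the facts about the kernel without expanding it in norm.\<close>

lemma cauchy_kernel_rec:
  assumes "cmod w < 1"
  shows "cauchy_kernel w = l2_const 1 + cnj w *\<^sub>C (l2_z \<odot> cauchy_kernel w)"
proof -
  note c = continuous_on_kernel[OF assms]
  have sq: "square_integrable (\<lambda>z. 1 / (1 - cnj w * z))"
    by (rule square_integrable_continuous[OF c])
  have sqz: "square_integrable (\<lambda>z. z * (1 / (1 - cnj w * z)))"
    by (intro square_integrable_continuous continuous_intros c)
  have "l2_const 1 + cnj w *\<^sub>C (l2_z \<odot> cauchy_kernel w) =
      to_L2 (\<lambda>z. 1 + cnj w * (z * (1 / (1 - cnj w * z))))"
    unfolding cauchy_kernel_def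
    by (simp only: to_L2_mult[OF square_integrable_id sq sqz] to_L2_scale[OF sqz]
        to_L2_add[OF square_integrable_const square_integrable_scale[OF sqz]])
  also have "\<dots> = to_L2 (\<lambda>z. 1 / (1 - cnj w * z))"
  proof (subst to_L2_eq_iff)
    show "AE z in circle_measure. 1 + cnj w * (z * (1 / (1 - cnj w * z))) = 1 / (1 - cnj w * z)"
      using kernel_denominator[OF assms] by (intro AE_I2) (auto simp: field_simps)
  qed (intro square_integrable_add square_integrable_const square_integrable_scale sqz sq)+
  finally show ?thesis by (simp add: cauchy_kernel_def)
qed

lemma power_bound_imp_zero:
  fixes a :: complex
  assumes "cmod w < 1" "\<And>m. cmod a \<le> cmod w ^ m * C"
  shows "a = 0"
proof -
  have "(\<lambda>m. cmod w ^ m * C) \<longlonglongrightarrow> 0 * C"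
    using assms(1) by (intro tendsto_intros LIMSEQ_power_zero) auto
  then have "cmod a \<le> 0 * C" using assms(2) by (intro LIMSEQ_le_const) auto
  then show ?thesis by simp
qed

text \<open>By the recursion each negative coefficient is cnj w times the next one further out. All
  are bounded by the norm of the kernel, so iterating makes them 0.\<close>

lemma cauchy_kernel_H2:
  assumes w: "cmod w < 1"
  shows "cauchy_kernel w \<in> H2"
  unfolding H2_def
proof (intro CollectI allI)
  fix n
  define a where "a n = \<langle>cauchy_kernel w, l2_cnj (zp (Suc n))\<rangle>" for n
  have rec: "a n = cnj w * a (Suc n)" for n
  proof -
    have "a n = \<langle>l2_const 1 + cnj w *\<^sub>C (l2_z \<odot> cauchy_kernel w), l2_cnj (zp (Suc n))\<rangle>"
      unfolding a_def by (subst cauchy_kernel_rec[OF w]) simp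
    also have "\<dots> = cnj w * \<langle>l2_z \<odot> cauchy_kernel w, l2_cnj (zp (Suc n))\<rangle>"
      by (simp add: cinner_add_left H2D)
    also have "\<langle>l2_z \<odot> cauchy_kernel w, l2_cnj (zp (Suc n))\<rangle> = a (Suc n)"
      unfolding a_def by (simp add: cinner_mult_left cnj_z_cnj_zp)
    finally show ?thesis .
  qed
  have it: "a n = cnj w ^ m * a (n + m)" for m
    by (induction m) (simp_all add: rec[symmetric] mult_ac flip: rec[of "n + _"])
  show "\<langle>cauchy_kernel w, l2_cnj (zp (Suc n))\<rangle> = 0"
    unfolding a_def[symmetric]
  proof (rule power_bound_imp_zero[OF w])
    fix m
    have "cmod (a (n + m)) \<le> norm (cauchy_kernel w)"
      unfolding a_def using cinner_Cauchy_Schwarz[of "cauchy_kernel w" "l2_cnj (zp (Suc (n + m)))"] by simp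
    then show "cmod (a n) \<le> cmod w ^ m * norm (cauchy_kernel w)"
      unfolding it[of m] norm_mult norm_power by (simp add: mult_left_mono)
  qed
qed

lemma cinner_cauchy_kernel_sums:
  assumes w: "cmod w < 1"
  shows "(\<lambda>n. \<langle>f, zp n\<rangle> * w ^ n) sums \<langle>f, cauchy_kernel w\<rangle>"
proof -
  have step: "\<langle>f, zp m \<odot> cauchy_kernel w\<rangle> = \<langle>f, zp m\<rangle> + w * \<langle>f, zp (Suc m) \<odot> cauchy_kernel w\<rangle>" for m
  proof -
    have "zp m \<odot> cauchy_kernel w = zp m + cnj w *\<^sub>C (zp (Suc m) \<odot> cauchy_kernel w)"
      by (subst cauchy_kernel_rec[OF w])
        (simp add: mult_add_right mult_scale_right mult_commute[of l2_z "zp m"]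
          flip: mult_assoc z_mult_zp)
    then show ?thesis by (simp add: cinner_add_right)
  qed
  have part: "\<langle>f, cauchy_kernel w\<rangle> =
      (\<Sum>n<m. \<langle>f, zp n\<rangle> * w ^ n) + w ^ m * \<langle>f, zp m \<odot> cauchy_kernel w\<rangle>" for m
  proof (induction m)
    case (Suc m)
    then show ?case by (subst (asm) step) (simp add: algebra_simps)
  qed (simp add: zp_0)
  have "(\<lambda>m. w ^ m * \<langle>f, zp m \<odot> cauchy_kernel w\<rangle>) \<longlonglongrightarrow> 0"
  proof (rule Lim_null_comparison)
    show "\<forall>\<^sub>F m in sequentially. cmod (w ^ m * \<langle>f, zp m \<odot> cauchy_kernel w\<rangle>) \<le>
        cmod w ^ m * (norm f * norm (cauchy_kernel w))"
    proof (intro always_eventually allI)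
      fix m
      have "cmod \<langle>f, zp m \<odot> cauchy_kernel w\<rangle> \<le> norm f * norm (cauchy_kernel w)"
        using cinner_Cauchy_Schwarz[of f "zp m \<odot> cauchy_kernel w"] by (simp add: norm_unimodular_mult)
      then show "cmod (w ^ m * \<langle>f, zp m \<odot> cauchy_kernel w\<rangle>) \<le> cmod w ^ m * (norm f * norm (cauchy_kernel w))"
        by (simp add: norm_mult norm_power mult_left_mono)
    qed
    have "(\<lambda>m. cmod w ^ m * (norm f * norm (cauchy_kernel w))) \<longlonglongrightarrow> 0 * (norm f * norm (cauchy_kernel w))"
      using w by (intro tendsto_intros LIMSEQ_power_zero) auto
    then show "(\<lambda>m. cmod w ^ m * (norm f * norm (cauchy_kernel w))) \<longlonglongrightarrow> 0" by simp
  qed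
  then have "(\<lambda>m. \<langle>f, cauchy_kernel w\<rangle> - w ^ m * \<langle>f, zp m \<odot> cauchy_kernel w\<rangle>) \<longlonglongrightarrow> \<langle>f, cauchy_kernel w\<rangle> - 0"
    by (intro tendsto_intros)
  moreover have "\<langle>f, cauchy_kernel w\<rangle> - w ^ m * \<langle>f, zp m \<odot> cauchy_kernel w\<rangle> = (\<Sum>n<m. \<langle>f, zp n\<rangle> * w ^ n)" for m
    using part[of m] by simp
  ultimately show ?thesis by (simp add: sums_def)
qed

definition disc_fun :: "ltwo \<Rightarrow> complex \<Rightarrow> complex" where
  "disc_fun f w = \<langle>f, cauchy_kernel w\<rangle>"

lemma disc_fun_sums: "w \<in> ball 0 1 \<Longrightarrow> (\<lambda>n. \<langle>f, zp n\<rangle> * w ^ n) sums disc_fun f w"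
  by (simp add: disc_fun_def cinner_cauchy_kernel_sums)

lemma disc_fun_holomorphic: "disc_fun f holomorphic_on ball 0 1"
  by (rule power_series_holomorphic[where a = "\<lambda>n. \<langle>f, zp n\<rangle>"]) (simp add: disc_fun_sums)

text \<open>The Cauchy kernel has no sign, so it is replaced by the Poisson kernel p. On
  \<open>H2\<close> both give the same pairing, and p is nonnegative with integral 1, which
  transfers an essential bound of f to its extension.\<close>

lemma disc_fun_bounded:
  assumes f: "f \<in> H2" and "l2_bdd f"
  obtains M where "\<And>w. cmod w < 1 \<Longrightarrow> cmod (disc_fun f w) \<le> M"
proof -
  obtain f' where f': "square_integrable f'" "f = to_L2 f'" by (rule ltwo_cases)
  obtain M where M: "AE z in circle_measure. cmod (f' z) \<le> M"
    using assms f' by (auto simp: l2_bdd_to_L2)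
  have "cmod (disc_fun f w) \<le> M" if w: "cmod w < 1" for w
  proof -
    define p where "p z = (1 - (cmod w)\<^sup>2) / (cmod (1 - cnj w * z))\<^sup>2" for z
    have p0: "p z \<ge> 0" for z
      unfolding p_def using w by (intro divide_nonneg_nonneg) (auto simp: power_le_one)
    have pc: "continuous_on (sphere 0 1) (\<lambda>z. complex_of_real (p z))"
      unfolding p_def using kernel_denominator[OF w] by (intro continuous_intros) auto
    have psq: "square_integrable (\<lambda>z. complex_of_real (p z))"
      by (rule square_integrable_continuous[OF pc])
    define P where "P = to_L2 (\<lambda>z. complex_of_real (p z))"
    have ksq: "square_integrable (\<lambda>z. 1 / (1 - cnj w * z))"
      by (rule square_integrable_continuous[OF continuous_on_kernel[OF w]])
    have "P = cauchy_kernel w + (l2_cnj (cauchy_kernel w) - l2_const 1)"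
    proof -
      have "P = to_L2 (\<lambda>z. 1 / (1 - cnj w * z) + (cnj (1 / (1 - cnj w * z)) - 1))"
        unfolding P_def
      proof (subst to_L2_eq_iff)
        show "AE z in circle_measure. complex_of_real (p z) = 1 / (1 - cnj w * z) + (cnj (1 / (1 - cnj w * z)) - 1)"
        proof (rule AE_I2)
          fix z assume "z \<in> space circle_measure"
          then have z: "z \<in> sphere 0 1" by simp
          define a where "a = cnj w * z"
          have a: "1 - a \<noteq> 0" using kernel_denominator[OF w z] by (simp add: a_def)
          then have a': "1 - cnj a \<noteq> 0" by (metis complex_cnj_cancel_iff complex_cnj_diff complex_cnj_one complex_cnj_zero)
          have "cmod a = cmod w" using z by (simp add: a_def norm_mult)
          then have "complex_of_real (p z) = (1 - a * cnj a) / ((1 - a) * cnj (1 - a))"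
            unfolding p_def a_def[symmetric]
            using complex_norm_square[of a] complex_norm_square[of "1 - a"] by simp
          also have "\<dots> = 1 / (1 - a) + (cnj (1 / (1 - a)) - 1)"
            using a a' by (simp add: field_simps)
          finally show "complex_of_real (p z) = 1 / (1 - cnj w * z) + (cnj (1 / (1 - cnj w * z)) - 1)"
            by (simp only: a_def)
        qed
      qed (intro psq square_integrable_add square_integrable_diff ksq square_integrable_const square_integrable_cnj)+
      also have "\<dots> = cauchy_kernel w + (l2_cnj (cauchy_kernel w) - l2_const 1)"
        unfolding cauchy_kernel_def
        by (simp only: to_L2_add[OF ksq square_integrable_diff[OF square_integrable_cnj[OF ksq] square_integrable_const]]
          to_L2_diff[OF square_integrable_cnj[OF ksq] square_integrable_const] to_L2_cnj[OF ksq])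
      finally show ?thesis .
    qed
    \<comment> \<open>Without its constant term the Cauchy kernel is a multiple of z, so the
      conjugate part of P is orthogonal to \<open>H2\<close> and pairing with P evaluates at
      w.\<close>
    also have "l2_cnj (cauchy_kernel w) - l2_const 1 = l2_cnj (l2_z \<odot> (cnj w *\<^sub>C cauchy_kernel w))"
      by (subst cauchy_kernel_rec[OF w]) (simp add: cnj_add mult_scale_right)
    finally have P: "\<langle>g, P\<rangle> = disc_fun g w" if "g \<in> H2" for g
      using H2_orth_cnj[OF that H2_subspace(3)[OF cauchy_kernel_H2[OF w]]]
      by (simp add: cinner_add_right disc_fun_def)
    \<comment> \<open>Evaluating the constant function 1 computes the integral of the Poisson
      kernel.\<close>
    have "\<langle>l2_const 1, P\<rangle> = \<langle>l2_const 1, l2_const 1 + cnj w *\<^sub>C (l2_z \<odot> cauchy_kernel w)\<rangle>"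
      unfolding P[OF one_H2] disc_fun_def by (subst cauchy_kernel_rec[OF w]) simp
    also have "\<langle>l2_const 1, l2_z \<odot> cauchy_kernel w\<rangle> = cnj \<langle>cauchy_kernel w, l2_cnj (zp (Suc 0))\<rangle>"
      by (subst cinner_commute) (simp add: cinner_mult_left zp_def)
    then have "\<langle>l2_const 1, l2_const 1 + cnj w *\<^sub>C (l2_z \<odot> cauchy_kernel w)\<rangle> = 1"
      using H2D[OF cauchy_kernel_H2[OF w], of 0] by (simp add: cinner_add_right)
    finally have "(LINT z|circle_measure. complex_of_real (p z)) = 1"
      unfolding P_def by (subst (asm) cinner_to_L2) (auto simp: psq)
    then have int1: "(LINT z|circle_measure. p z) = 1"
      by (metis integral_complex_of_real of_real_eq_1_iff)
    have pint: "integrable circle_measure p"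
      using integrable_mult_cnj[OF psq square_integrable_const[of 1]]
      by (simp add: complex_of_real_integrable_eq)
    have fpint: "integrable circle_measure (\<lambda>z. f' z * complex_of_real (p z))"
      using integrable_mult_cnj[OF f'(1) psq] by simp
    have "disc_fun f w = \<langle>to_L2 f', P\<rangle>" using P[OF f] f'(2) by simp
    also have "\<dots> = (LINT z|circle_measure. f' z * complex_of_real (p z))"
      unfolding P_def by (subst cinner_to_L2) (auto simp: f' psq)
    also have "cmod \<dots> \<le> (LINT z|circle_measure. cmod (f' z * complex_of_real (p z)))"
      by (rule integral_norm_bound)
    also have "\<dots> \<le> (LINT z|circle_measure. M * p z)"
    proof (rule integral_mono_AE)
      show "AE z in circle_measure. cmod (f' z * complex_of_real (p z)) \<le> M * p z"
        using M by eventually_elim (use p0 in \<open>auto simp: norm_mult intro!: mult_right_mono\<close>)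
    qed (use fpint pint in auto)
    also have "\<dots> = M" using int1 by simp
    finally show ?thesis .
  qed
  with that show ?thesis by blast
qed

subsection \<open>Boundary values\<close>

lemma H2_power_series_limit:
  assumes r: "0 \<le> r" "r < 1" and sums: "\<And>w. w \<in> ball 0 1 \<Longrightarrow> (\<lambda>n. a n * w ^ n) sums F w"
  shows "square_integrable (\<lambda>z. F (of_real r * z))"
    and "(\<lambda>N. \<Sum>n<N. (a n * of_real r ^ n) *\<^sub>C zp n) \<longlonglongrightarrow> to_L2 (\<lambda>z. F (of_real r * z))"
proof -
  define c where "c n = a n * of_real r ^ n" for n
  have ball: "complex_of_real r * z \<in> ball 0 1" if "z \<in> sphere 0 1" for z
    using that r by (simp add: norm_mult)
  have "F holomorphic_on ball 0 1"
    by (rule power_series_holomorphic[where a = a]) (simp add: sums)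
  then have "continuous_on (ball 0 1) F" by (rule holomorphic_on_imp_continuous_on)
  then have Fc: "continuous_on (sphere 0 1) (\<lambda>z. F (of_real r * z))"
    by (rule continuous_on_compose2) (use ball in \<open>auto intro!: continuous_intros\<close>)
  then show Fsq: "square_integrable (\<lambda>z. F (of_real r * z))"
    by (rule square_integrable_continuous)
  \<comment> \<open>A radius strictly between r and 1: convergence of the series at s gives absolute
    convergence at r, hence uniform convergence on the circle.\<close>
  define s where "s = complex_of_real ((1 + r) / 2)"
  have "cmod s = (1 + r) / 2" unfolding s_def norm_of_real using r by simp
  then have "s \<in> ball 0 1" "cmod (complex_of_real r) < cmod s" using r by auto
  then have "summable (\<lambda>n. cmod (c n))"
    unfolding c_def by (intro powser_insidea[of a s] sums_summable[OF sums])
  then have lim: "uniform_limit (sphere 0 1) (\<lambda>N z. \<Sum>n<N. c n * z ^ n) (\<lambda>z. \<Sum>n. c n * z ^ n) sequentially"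
    by (intro Weierstrass_m_test[where M = "\<lambda>n. cmod (c n)"]) (auto simp: norm_mult norm_power)
  have Feq: "(\<Sum>n. c n * z ^ n) = F (of_real r * z)" if "z \<in> sphere 0 1" for z
    using sums[OF ball[OF that]] by (simp add: c_def sums_iff power_mult_distrib mult.assoc)
  have pc: "continuous_on (sphere 0 1) (\<lambda>z. \<Sum>n<N. c n * z ^ n)" for N
    by (intro continuous_intros)
  have poly: "to_L2 (\<lambda>z. \<Sum>n<N. c n * z ^ n) = (\<Sum>n<N. c n *\<^sub>C zp n)" for N
  proof (induction N)
    case (Suc N)
    then show ?case
      using to_L2_add[OF square_integrable_continuous[OF pc[of N]] square_integrable_scale[OF square_integrable_power]]
      by (simp add: to_L2_scale zp_def)
  qed (simp add: to_L2_zero)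
  show "(\<lambda>N. \<Sum>n<N. (a n * of_real r ^ n) *\<^sub>C zp n) \<longlonglongrightarrow> to_L2 (\<lambda>z. F (of_real r * z))"
    unfolding c_def[symmetric] poly[symmetric]
  proof (rule tendstoI)
    fix e :: real assume e: "e > 0"
    then have "\<forall>\<^sub>F N in sequentially. \<forall>z\<in>sphere 0 1. dist (\<Sum>n<N. c n * z ^ n) (\<Sum>n. c n * z ^ n) < e / 2"
      by (intro uniform_limitD[OF lim]) simp
    then show "\<forall>\<^sub>F N in sequentially. dist (to_L2 (\<lambda>z. \<Sum>n<N. c n * z ^ n)) (to_L2 (\<lambda>z. F (of_real r * z))) < e"
    proof eventually_elim
      case (elim N)
      have "norm (to_L2 (\<lambda>z. (\<Sum>n<N. c n * z ^ n) - F (of_real r * z))) \<le> e / 2"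
      proof (rule norm_to_L2_le)
        fix z assume z: "z \<in> sphere (0::complex) 1"
        then have "dist (\<Sum>n<N. c n * z ^ n) (\<Sum>n. c n * z ^ n) < e / 2" using elim by blast
        then show "cmod ((\<Sum>n<N. c n * z ^ n) - F (of_real r * z)) \<le> e / 2"
          unfolding Feq[OF z] dist_norm by (rule less_imp_le)
      qed (intro continuous_intros pc Fc)
      then show ?case
        using e by (simp add: dist_norm to_L2_diff[OF square_integrable_continuous[OF pc] Fsq])
    qed
  qed
qed

lemma sum_zp_H2: "(\<Sum>n<N. c n *\<^sub>C zp n) \<in> H2"
  by (induction N) (auto intro!: H2_subspace)

lemma norm_sum_zp: "(norm (\<Sum>n<N. c n *\<^sub>C zp n))\<^sup>2 = (\<Sum>n<N. (cmod (c n))\<^sup>2)"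
proof (induction N)
  case (Suc N)
  have "\<langle>\<Sum>n<M. c n *\<^sub>C zp n, zp N\<rangle> = 0" if "M \<le> N" for M
    using that by (induction M) (auto simp: cinner_add_left cinner_zp)
  then show ?case by (simp add: norm_add_sq Suc power_mult_distrib)
qed simp

lemma Bessel: "(\<Sum>n<N. (cmod \<langle>f, zp n\<rangle>)\<^sup>2) \<le> (norm f)\<^sup>2"
proof -
  define s where "s = (\<Sum>n<N. \<langle>f, zp n\<rangle> *\<^sub>C zp n)"
  have "\<langle>f, \<Sum>n<M. \<langle>f, zp n\<rangle> *\<^sub>C zp n\<rangle> = complex_of_real (\<Sum>n<M. (cmod \<langle>f, zp n\<rangle>)\<^sup>2)" for M
  proof (induction M)
    case (Suc M)
    then show ?case
      using complex_norm_square[of "\<langle>f, zp M\<rangle>"] by (simp add: cinner_add_right mult.commute)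
  qed simp
  then have "Re \<langle>f, s\<rangle> = (\<Sum>n<N. (cmod \<langle>f, zp n\<rangle>)\<^sup>2)"
    unfolding s_def by (metis Re_complex_of_real)
  then have "(norm (f - s))\<^sup>2 = (norm f)\<^sup>2 - (\<Sum>n<N. (cmod \<langle>f, zp n\<rangle>)\<^sup>2)"
    unfolding norm_diff_sq by (simp add: s_def norm_sum_zp)
  then show ?thesis using zero_le_power2[of "norm (f - s)"] by linarith
qed

definition dilate :: "ltwo \<Rightarrow> real \<Rightarrow> ltwo" where
  "dilate f r = to_L2 (\<lambda>z. disc_fun f (of_real r * z))"

lemma square_integrable_dilate:
  assumes "0 \<le> r" "r < 1"
  shows "square_integrable (\<lambda>z. disc_fun f (of_real r * z))"
  using H2_power_series_limit(1)[OF assms disc_fun_sums] .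

lemma dilate_limit:
  assumes "0 \<le> r" "r < 1"
  shows "(\<lambda>N. \<Sum>n<N. (\<langle>f, zp n\<rangle> * of_real r ^ n) *\<^sub>C zp n) \<longlonglongrightarrow> dilate f r"
  unfolding dilate_def using H2_power_series_limit(2)[OF assms disc_fun_sums] .

lemma norm_dilate_le:
  assumes r: "0 \<le> r" "r < 1"
  shows "norm (dilate f r) \<le> norm f"
proof (rule LIMSEQ_le_const2[OF tendsto_norm[OF dilate_limit[OF r]]], intro exI allI impI)
  fix N
  have "(norm (\<Sum>n<N. (\<langle>f, zp n\<rangle> * of_real r ^ n) *\<^sub>C zp n))\<^sup>2 \<le> (\<Sum>n<N. (cmod \<langle>f, zp n\<rangle>)\<^sup>2)"
    unfolding norm_sum_zp
  proof (intro sum_mono power_mono)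
    fix n
    have "r ^ n \<le> 1" using r by (simp add: power_le_one)
    then show "cmod (\<langle>f, zp n\<rangle> * of_real r ^ n) \<le> cmod \<langle>f, zp n\<rangle>"
      using r by (simp add: norm_mult norm_power mult_left_le)
  qed auto
  also have "\<dots> \<le> (norm f)\<^sup>2" by (rule Bessel)
  finally show "norm (\<Sum>n<N. (\<langle>f, zp n\<rangle> * of_real r ^ n) *\<^sub>C zp n) \<le> norm f"
    by (rule power2_le_imp_le) simp
qed

lemma disc_fun_add: "disc_fun (f + g) w = disc_fun f w + disc_fun g w"
  by (simp add: disc_fun_def cinner_add_left)

lemma disc_fun_scale: "disc_fun (c *\<^sub>C f) w = c * disc_fun f w"
  by (simp add: disc_fun_def)

lemma dilate_add: "0 \<le> r \<Longrightarrow> r < 1 \<Longrightarrow> dilate (f + g) r = dilate f r + dilate g r"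
  unfolding dilate_def
  by (subst to_L2_add[symmetric]) (auto simp: square_integrable_dilate disc_fun_add)

lemma dilate_scale: "0 \<le> r \<Longrightarrow> r < 1 \<Longrightarrow> dilate (c *\<^sub>C f) r = c *\<^sub>C dilate f r"
  unfolding dilate_def
  by (subst to_L2_scale[symmetric]) (auto simp: square_integrable_dilate disc_fun_scale)

lemma dilate_diff: "0 \<le> r \<Longrightarrow> r < 1 \<Longrightarrow> dilate (f - g) r = dilate f r - dilate g r"
  using dilate_add[of r f "- g"] dilate_scale[of r "-1" g] by simp

lemma dilate_zp:
  assumes "0 \<le> r" "r < 1"
  shows "dilate (zp n) r = of_real r ^ n *\<^sub>C zp n"
proof -
  have "(\<Sum>k<N. (\<langle>zp n, zp k\<rangle> * of_real r ^ k) *\<^sub>C zp k) = of_real r ^ n *\<^sub>C zp n" if "N > n" for N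
  proof -
    have "(\<Sum>k<N. (\<langle>zp n, zp k\<rangle> * of_real r ^ k) *\<^sub>C zp k) =
        (\<Sum>k<N. if k = n then of_real r ^ n *\<^sub>C zp n else 0)"
      by (intro sum.cong) (auto simp: cinner_zp)
    then show ?thesis using that by simp
  qed
  then have "(\<lambda>N. \<Sum>k<N. (\<langle>zp n, zp k\<rangle> * of_real r ^ k) *\<^sub>C zp k) \<longlonglongrightarrow> of_real r ^ n *\<^sub>C zp n"
    by (intro tendsto_eventually eventually_sequentiallyI[of "Suc n"]) simp
  from LIMSEQ_unique[OF dilate_limit[OF assms] this] show ?thesis .
qed

lemma eventually_at_left_1: "\<forall>\<^sub>F r in at_left 1. 0 < r \<and> r < (1::real)"
  using eventually_at_left_real[of 0 1] by simp

text \<open>Dilations do not increase norms, so the functions for which they converge form a closed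
  subspace M of \<open>H2\<close>. It contains every \<open>zp n\<close>, and what is left over
  after projecting to M is 0 by \<open>H2_total\<close>.\<close>

lemma dilate_tendsto:
  assumes "f \<in> H2"
  shows "(dilate f \<longlongrightarrow> f) (at_left 1)"
proof -
  define M where "M = {f \<in> H2. (dilate f \<longlongrightarrow> f) (at_left 1)}"
  have "closed M"
    unfolding closed_sequential_limits
  proof (intro allI impI)
    fix x l assume *: "(\<forall>n. x n \<in> M) \<and> x \<longlonglongrightarrow> l"
    then have l: "l \<in> H2" using closed_sequentially[OF H2_subspace(4), of x l] by (auto simp: M_def)
    have "(dilate l \<longlongrightarrow> l) (at_left 1)"
    proof (rule tendstoI)
      fix e :: real assume e: "e > 0"
      then obtain k where k: "norm (x k - l) < e / 3"
        using * by (metis LIMSEQ_iff divide_pos_pos order_refl zero_less_numeral)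
      have "(dilate (x k) \<longlongrightarrow> x k) (at_left 1)" using * by (simp add: M_def)
      then have "\<forall>\<^sub>F r in at_left 1. dist (dilate (x k) r) (x k) < e / 3"
        using e by (intro tendstoD) auto
      with eventually_at_left_1 show "\<forall>\<^sub>F r in at_left 1. dist (dilate l r) l < e"
      proof eventually_elim
        case (elim r)
        have "dilate l r - l = dilate (l - x k) r + (dilate (x k) r - x k) + (x k - l)"
          using elim by (simp add: dilate_diff)
        then have "norm (dilate l r - l) \<le> norm (dilate (l - x k) r) + norm (dilate (x k) r - x k) + norm (x k - l)"
          by (metis norm_triangle_mono norm_triangle_ineq order_refl)
        moreover have "norm (dilate (l - x k) r) \<le> norm (x k - l)"
          using norm_dilate_le[of r "l - x k"] elim by (simp add: norm_minus_commute)
        ultimately show ?case using k elim by (simp add: dist_norm)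
      qed
    qed
    with l show "l \<in> M" by (simp add: M_def)
  qed
  moreover have "f + g \<in> M" if "f \<in> M" "g \<in> M" for f g
  proof -
    have "((\<lambda>r. dilate f r + dilate g r) \<longlongrightarrow> f + g) (at_left 1)"
      using that by (intro tendsto_add) (auto simp: M_def)
    then have "(dilate (f + g) \<longlongrightarrow> f + g) (at_left 1)"
      by (rule Lim_transform_eventually, use eventually_at_left_1 in eventually_elim) (simp add: dilate_add)
    with that show ?thesis using H2_subspace(2) by (simp add: M_def)
  qed
  moreover have "c *\<^sub>C f \<in> M" if "f \<in> M" for c f
  proof -
    have "bounded_linear (\<lambda>f. c *\<^sub>C f)"
    proof (rule bounded_linear_intro[where K = "cmod c"])
      fix x y :: ltwo and r :: real
      show "c *\<^sub>C (x + y) = c *\<^sub>C x + c *\<^sub>C y" by (rule l2.scale_right_distrib)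
      show "c *\<^sub>C (r *\<^sub>R x) = r *\<^sub>R (c *\<^sub>C x)"
        unfolding scaleR_eq_scaleC by (rule l2.scale_left_commute)
      show "norm (c *\<^sub>C x) \<le> norm x * cmod c" by (simp add: mult.commute)
    qed
    moreover have "(dilate f \<longlongrightarrow> f) (at_left 1)" using that by (simp add: M_def)
    ultimately have "((\<lambda>r. c *\<^sub>C dilate f r) \<longlongrightarrow> c *\<^sub>C f) (at_left 1)"
      by (rule bounded_linear.tendsto)
    then have "(dilate (c *\<^sub>C f) \<longlongrightarrow> c *\<^sub>C f) (at_left 1)"
      by (rule Lim_transform_eventually, use eventually_at_left_1 in eventually_elim) (simp add: dilate_scale)
    with that show ?thesis using H2_subspace(3) by (simp add: M_def)
  qed
  moreover have zpM: "zp n \<in> M" for n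
  proof -
    have "bounded_linear (\<lambda>c. c *\<^sub>C zp n)"
      by (rule bounded_linear_intro[where K = 1])
        (auto simp: l2.scale_left_distrib scaleR_eq_scaleC scaleR_conv_of_real)
    moreover have "((\<lambda>r. of_real r ^ n) \<longlongrightarrow> complex_of_real 1 ^ n) (at_left 1)"
      by (intro tendsto_intros)
    ultimately have "((\<lambda>r. of_real r ^ n *\<^sub>C zp n) \<longlongrightarrow> complex_of_real 1 ^ n *\<^sub>C zp n) (at_left 1)"
      by (rule bounded_linear.tendsto)
    then have "(dilate (zp n) \<longlongrightarrow> complex_of_real 1 ^ n *\<^sub>C zp n) (at_left 1)"
      by (rule Lim_transform_eventually, use eventually_at_left_1 in eventually_elim) (simp add: dilate_zp)
    then show ?thesis by (simp add: M_def)
  qed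
  ultimately have M: "closed_csubspace M"
    using l2.scale_zero_left[of "zp 0"] by (simp only: closed_csubspace_def) metis
  have "f - orth_proj M f = 0"
  proof (rule H2_total)
    have "orth_proj M f \<in> M" by (rule orth_proj_in[OF M])
    then show "f - orth_proj M f \<in> H2" using assms by (intro H2_subspace) (auto simp: M_def)
    show "\<langle>f - orth_proj M f, zp n\<rangle> = 0" for n
      by (simp add: cinner_diff_left cinner_orth_proj[OF M zpM])
  qed
  then have "f \<in> M" using orth_proj_in[OF M, of f] by simp
  then show ?thesis by (simp add: M_def)
qed

lemma holomorphic_boundary_H2:
  assumes F: "F holomorphic_on ball 0 1" and f: "has_boundary_values F f"
  shows "f \<in> H2"
proof (rule Lim_in_closed_set[OF H2_subspace(4)])
  show "((\<lambda>r. to_L2 (\<lambda>z. F (of_real r * z))) \<longlongrightarrow> f) (at_left 1)"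
    using f by (simp add: has_boundary_values_def)
  show "\<forall>\<^sub>F r in at_left 1. to_L2 (\<lambda>z. F (of_real r * z)) \<in> H2"
    using eventually_at_left_1
  proof eventually_elim
    case (elim r)
    have "(\<lambda>n. (deriv ^^ n) F 0 / fact n * w ^ n) sums F w" if "w \<in> ball 0 1" for w
      using holomorphic_power_series[OF F that] by simp
    from H2_power_series_limit(2)[OF _ _ this, of r] elim
    have "(\<lambda>N. \<Sum>n<N. ((deriv ^^ n) F 0 / fact n * of_real r ^ n) *\<^sub>C zp n)
        \<longlonglongrightarrow> to_L2 (\<lambda>z. F (of_real r * z))"
      by simp
    then show ?case by (rule closed_sequentially[OF H2_subspace(4) sum_zp_H2])
  qed
qed simp

lemma norm_to_L2_mono:
  assumes "square_integrable f" "square_integrable g" "\<And>z. z \<in> sphere 0 1 \<Longrightarrow> cmod (f z) \<le> cmod (g z)"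
  shows "norm (to_L2 f) \<le> norm (to_L2 g)"
proof -
  have "(norm (to_L2 f))\<^sup>2 \<le> (norm (to_L2 g))\<^sup>2"
    unfolding norm_to_L2[OF assms(1)] norm_to_L2[OF assms(2)]
    using assms by (intro integral_mono) (auto simp: square_integrable_def intro!: power_mono)
  then show ?thesis by (rule power2_le_imp_le) simp
qed

text \<open>The excess of |f'| over M is pointwise at most the distance of f' to any dilation of F,
  because those are bounded by M. Letting r tend to 1 makes the norm of the excess 0.\<close>

lemma holomorphic_boundary_bdd:
  assumes F: "F holomorphic_on ball 0 1" and M: "\<And>w. w \<in> ball 0 1 \<Longrightarrow> cmod (F w) \<le> M"
    and f: "has_boundary_values F f"
  shows "l2_bdd f"
proof -
  obtain f' where f': "square_integrable f'" "f = to_L2 f'" by (rule ltwo_cases)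
  have M0: "M \<ge> 0" using M[of 0] order_trans[OF norm_ge_zero] by simp
  define p where "p z = complex_of_real (max 0 (cmod (f' z) - M))" for z
  have "f' \<in> borel_measurable circle_measure" using f' by (simp add: square_integrable_def)
  then have "p \<in> borel_measurable circle_measure" unfolding p_def by measurable
  then have psq: "square_integrable p"
    using f'(1) M0 by (intro square_integrable_dominated[of "\<lambda>z. (cmod (f' z))\<^sup>2"])
      (auto simp: square_integrable_def p_def intro!: power_mono)
  have le: "norm (to_L2 p) \<le> norm (to_L2 (\<lambda>z. F (of_real r * z)) - f)" if r: "0 < r \<and> r < 1" for r
  proof -
    have "(\<lambda>n. (deriv ^^ n) F 0 / fact n * w ^ n) sums F w" if "w \<in> ball 0 1" for w
      using holomorphic_power_series[OF F that] by simp
    from H2_power_series_limit(1)[OF _ _ this, of r] r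
    have sq: "square_integrable (\<lambda>z. F (of_real r * z))" by simp
    have "to_L2 (\<lambda>z. F (of_real r * z)) - f = to_L2 (\<lambda>z. F (of_real r * z) - f' z)"
      by (simp add: to_L2_diff sq f')
    moreover have "norm (to_L2 p) \<le> norm (to_L2 (\<lambda>z. F (of_real r * z) - f' z))"
    proof (rule norm_to_L2_mono[OF psq square_integrable_diff[OF sq f'(1)]])
      fix z assume "z \<in> sphere (0::complex) 1"
      then have "cmod (F (of_real r * z)) \<le> M" using r by (intro M) (simp add: norm_mult)
      then have "cmod (f' z) - M \<le> cmod (F (of_real r * z) - f' z)"
        using norm_triangle_ineq2[of "f' z" "F (of_real r * z)"] by (simp add: norm_minus_commute)
      then show "cmod (p z) \<le> cmod (F (of_real r * z) - f' z)"
        unfolding p_def norm_of_real by simp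
    qed
    ultimately show ?thesis by simp
  qed
  have "((\<lambda>r. norm (to_L2 (\<lambda>z. F (of_real r * z)) - f)) \<longlongrightarrow> norm (f - f)) (at_left 1)"
    using f by (intro tendsto_intros) (simp add: has_boundary_values_def)
  then have "norm (to_L2 p) \<le> norm (f - f)"
    by (rule tendsto_lowerbound) (use eventually_at_left_1 le in \<open>auto elim: eventually_mono\<close>)
  then have "to_L2 p = to_L2 (\<lambda>_. 0)" by (simp add: to_L2_zero)
  then have "AE z in circle_measure. p z = 0" by (simp add: to_L2_eq_iff psq)
  then have "AE z in circle_measure. cmod (f' z) \<le> M"
    by eventually_elim (simp add: p_def max_def split: if_splits)
  then show ?thesis using f' by (auto simp: l2_bdd_to_L2)
qed

lemma H2_boundary: "f \<in> H2 \<Longrightarrow> has_boundary_values (disc_fun f) f"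
  using dilate_tendsto by (simp add: has_boundary_values_def dilate_def[abs_def])

text \<open>\<open>disc_fun\<close> supplies the analytic extension, whose circle means are squared
  norms of dilations and hence bounded. With this identification the disc can be left
  behind.\<close>

lemma hardy2_eq: "hardy2 = H2"
proof (intro equalityI subsetI)
  fix f assume "f \<in> hardy2"
  then show "f \<in> H2" using holomorphic_boundary_H2 by (auto simp: hardy2_def hardy2_disc_def)
next
  fix f assume f: "f \<in> H2"
  have "disc_fun f \<in> hardy2_disc"
    unfolding hardy2_disc_def
  proof (intro CollectI conjI disc_fun_holomorphic bdd_aboveI2)
    fix r :: real assume r: "r \<in> {0..<1}"
    then have "(LINT z|circle_measure. (cmod (disc_fun f (of_real r * z)))\<^sup>2) = (norm (dilate f r))\<^sup>2"
      by (simp add: dilate_def norm_to_L2 square_integrable_dilate)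
    also have "\<dots> \<le> (norm f)\<^sup>2" using r by (intro power_mono norm_dilate_le) auto
    finally show "(LINT z|circle_measure. (cmod (disc_fun f (of_real r * z)))\<^sup>2) \<le> (norm f)\<^sup>2" .
  qed
  then show "f \<in> hardy2" using H2_boundary[OF f] by (auto simp: hardy2_def)
qed

lemma hardy_inf_eq: "hardy_inf = {f \<in> H2. l2_bdd f}"
proof (intro equalityI subsetI)
  fix f assume "f \<in> hardy_inf"
  then obtain F where F: "F holomorphic_on ball 0 1" "bounded (F ` ball 0 1)" "has_boundary_values F f"
    by (auto simp: hardy_inf_def hardy_inf_disc_def)
  then obtain M where "\<And>w. w \<in> ball 0 1 \<Longrightarrow> cmod (F w) \<le> M"
    unfolding bounded_iff by blast
  then show "f \<in> {f \<in> H2. l2_bdd f}"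
    using F holomorphic_boundary_H2 holomorphic_boundary_bdd by blast
next
  fix f assume "f \<in> {f \<in> H2. l2_bdd f}"
  then have f: "f \<in> H2" "l2_bdd f" by auto
  obtain M where "\<And>w. cmod w < 1 \<Longrightarrow> cmod (disc_fun f w) \<le> M"
    using disc_fun_bounded[OF f] by blast
  then have "bounded (disc_fun f ` ball 0 1)" by (intro boundedI[where B = M]) auto
  then show "f \<in> hardy_inf"
    using H2_boundary[OF f(1)] disc_fun_holomorphic by (auto simp: hardy_inf_def hardy_inf_disc_def)
qed

section \<open>Backward shift and model spaces\<close>

abbreviation l2_one :: ltwo where "l2_one \<equiv> l2_const 1"

text \<open>On \<open>H2\<close> this is f |-> (f - f(0)) / z. Written for all of L2 it also maps
  the model space to itself, where it is the adjoint of the compressed shift.\<close>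

definition backshift :: "ltwo \<Rightarrow> ltwo" where
  "backshift f = l2_cnj l2_z \<odot> (f - \<langle>f, l2_one\<rangle> *\<^sub>C l2_one)"

lemma cinner_z_mult_one:
  assumes "h \<in> H2"
  shows "\<langle>l2_z \<odot> h, l2_one\<rangle> = 0"
  using H2D[OF assms, of 0] by (simp add: cinner_mult_left zp_def)

lemma backshift_H2:
  assumes "f \<in> H2"
  shows "backshift f \<in> H2"
  unfolding backshift_def
  by (rule cnj_z_mult_H2) (auto intro!: H2_subspace assms simp: cinner_diff_left)

lemma z_mult_backshift: "l2_z \<odot> backshift f = f - \<langle>f, l2_one\<rangle> *\<^sub>C l2_one"
  by (simp add: backshift_def unimodular_cancel)

lemma cinner_backshift:
  "\<langle>backshift f, backshift g\<rangle> = \<langle>f, g\<rangle> - \<langle>f, l2_one\<rangle> * \<langle>l2_one, g\<rangle>"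
  by (simp add: backshift_def cinner_unimodular cinner_simps cinner_commute[of l2_one g])

lemma norm_backshift: "(norm (backshift f))\<^sup>2 = (norm f)\<^sup>2 - (cmod \<langle>f, l2_one\<rangle>)\<^sup>2"
proof -
  have "complex_of_real ((norm (backshift f))\<^sup>2) = complex_of_real ((norm f)\<^sup>2 - (cmod \<langle>f, l2_one\<rangle>)\<^sup>2)"
    unfolding cinner_self[symmetric] cinner_backshift
    by (simp only: of_real_diff cinner_self complex_norm_square cinner_commute[of l2_one f])
  then show ?thesis by (rule of_real_eq_iff[THEN iffD1])
qed

lemma norm_backshift_le: "norm (backshift f) \<le> norm f"
  by (rule power2_le_imp_le) (simp_all add: norm_backshift)

lemma backshift_add: "backshift (f + g) = backshift f + backshift g"
  by (simp add: backshift_def cinner_add_left l2.scale_left_distrib flip: mult_add_right)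
    (simp add: algebra_simps)

lemma backshift_scale: "backshift (c *\<^sub>C f) = c *\<^sub>C backshift f"
  by (simp add: backshift_def l2.scale_right_diff_distrib flip: mult_scale_right)

lemma backshift_diff: "backshift (f - g) = backshift f - backshift g"
  using backshift_add[of f "- g"] backshift_scale[of "-1" g] by simp

lemma backshift_bdd: "l2_bdd f \<Longrightarrow> l2_bdd (backshift f)"
  by (simp add: backshift_def)

lemma backshift_zp: "backshift (zp (Suc n)) = zp n" "backshift l2_one = 0"
  by (simp_all add: backshift_def cinner_zp_one z_cnj_zp)
    (use mult_scale_right[of "l2_cnj l2_z" 0 0] in simp)

lemma backshift_sum_zp: "(backshift ^^ N) (\<Sum>n<N. c n *\<^sub>C zp n) = 0"
proof (induction N arbitrary: c)
  case (Suc N)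
  have "backshift (\<Sum>n<Suc M. c n *\<^sub>C zp n) = (\<Sum>n<M. c (Suc n) *\<^sub>C zp n)" for M
  proof (induction M)
    case 0
    then show ?case by (simp add: backshift_scale zp_0 backshift_zp)
  next
    case (Suc M)
    then show ?case by (subst sum.lessThan_Suc) (simp only: backshift_add backshift_scale backshift_zp sum.lessThan_Suc)
  qed
  then show ?case using Suc by (simp only: funpow_Suc_right o_apply)
qed simp

lemma backshift_funpow_le: "norm ((backshift ^^ n) f) \<le> norm f"
  by (induction n) (auto intro: order_trans[OF norm_backshift_le])

lemma backshift_funpow_diff: "(backshift ^^ n) (f - g) = (backshift ^^ n) f - (backshift ^^ n) g"
  by (induction n) (simp_all add: backshift_diff)

text \<open>A function of \<open>H2\<close> is approximated by a polynomial, namely a partial sum of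
  the series of a dilation. N backward shifts annihilate a polynomial with N coefficients and do not
  increase the norm of the error.\<close>

lemma backshift_funpow_tendsto:
  assumes "f \<in> H2"
  shows "(\<lambda>n. norm ((backshift ^^ n) f)) \<longlonglongrightarrow> 0"
proof (rule LIMSEQ_I)
  fix e :: real assume e: "e > 0"
  have "\<forall>\<^sub>F r in at_left 1. dist (dilate f r) f < e / 2"
    using dilate_tendsto[OF assms] e by (intro tendstoD) auto
  with eventually_at_left_1 have "\<forall>\<^sub>F r in at_left 1. 0 < r \<and> r < 1 \<and> dist (dilate f r) f < e / 2"
    by eventually_elim auto
  then obtain r where r: "0 < r" "r < 1" "dist (dilate f r) f < e / 2"
    using eventually_happens'[of "at_left (1::real)"] by auto
  obtain N where N: "norm ((\<Sum>n<N. (\<langle>f, zp n\<rangle> * of_real r ^ n) *\<^sub>C zp n) - dilate f r) < e / 2"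
    using LIMSEQ_D[OF dilate_limit[of r f], of "e / 2"] r e by auto
  define p where "p = (\<Sum>n<N. (\<langle>f, zp n\<rangle> * of_real r ^ n) *\<^sub>C zp n)"
  have "norm (f - p) \<le> norm (f - dilate f r) + norm (dilate f r - p)"
    using norm_triangle_ineq[of "f - dilate f r" "dilate f r - p"] by simp
  then have fp: "norm (f - p) < e"
    using N r(3) by (simp add: p_def dist_norm norm_minus_commute)
  have "norm ((backshift ^^ n) f) < e" if "n \<ge> N" for n
  proof -
    have "(backshift ^^ N) f = (backshift ^^ N) (f - p)"
      by (simp add: backshift_funpow_diff p_def backshift_sum_zp)
    then have "norm ((backshift ^^ N) f) < e"
      using backshift_funpow_le[of N "f - p"] fp by simp
    moreover have "(backshift ^^ n) f = (backshift ^^ (n - N)) ((backshift ^^ N) f)"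
      using that by (simp flip: funpow_add[THEN fun_cong, unfolded o_apply])
    ultimately show ?thesis using backshift_funpow_le[of "n - N" "(backshift ^^ N) f"] by simp
  qed
  then show "\<exists>N. \<forall>n\<ge>N. norm (norm ((backshift ^^ n) f) - 0) < e" by auto
qed

text \<open>The pairing is the mean value of f g, to which only the constant terms
  contribute.\<close>

lemma H2_cinner_cnj:
  assumes "f \<in> H2" "g \<in> H2"
  shows "\<langle>f, l2_cnj g\<rangle> = \<langle>f, l2_one\<rangle> * \<langle>g, l2_one\<rangle>"
proof -
  have "g = \<langle>g, l2_one\<rangle> *\<^sub>C l2_one + l2_z \<odot> backshift g"
    by (simp add: z_mult_backshift)
  then have "l2_cnj g = cnj \<langle>g, l2_one\<rangle> *\<^sub>C l2_one + l2_cnj (l2_z \<odot> backshift g)"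
    by (metis cnj_add cnj_scale cnj_const complex_cnj_one)
  then show ?thesis
    using H2_orth_cnj[OF assms(1) backshift_H2[OF assms(2)]] by (simp add: cinner_add_right mult.commute)
qed

lemma H2_cinner_mult_one:
  assumes "f \<in> H2" "g \<in> H2" "l2_bdd g"
  shows "\<langle>g \<odot> f, l2_one\<rangle> = \<langle>f, l2_one\<rangle> * \<langle>g, l2_one\<rangle>"
  using H2_cinner_cnj[OF assms(1,2)] by (simp add: cinner_mult_left assms)

section \<open>The model space of an inner function: projection, conjugation, shift\<close>

locale inner_symbol =
  fixes u :: ltwo
  assumes inner: "inner_function u"
begin

abbreviation K where "K \<equiv> model_space u"
abbreviation C where "C \<equiv> model_conj u"
abbreviation S where "S \<equiv> model_shift u"

definition u0 :: complex where "u0 = \<langle>u, l2_one\<rangle>"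

text \<open>The reproducing kernel of K at the origin: by \<open>cinner_k0\<close>, pairing a member
  of K with it returns the constant coefficient. Modulo u H2 it is the constant 1.\<close>

definition k0 :: ltwo where "k0 = l2_one - cnj u0 *\<^sub>C u"

lemma u_H2: "u \<in> H2" and u_bdd [simp]: "l2_bdd u" and u_unimodular [simp]: "l2_unimodular u"
  using inner by (auto simp: inner_function_def hardy_inf_eq l2_bdd_unimodular)

lemma K_eq: "K = {f \<in> H2. \<forall>h\<in>H2. \<langle>f, u \<odot> h\<rangle> = 0}"
  by (simp add: model_space_def hardy2_eq)

lemma K_H2: "f \<in> K \<Longrightarrow> f \<in> H2"
  by (simp add: K_eq)

lemma K_orth: "f \<in> K \<Longrightarrow> h \<in> H2 \<Longrightarrow> \<langle>f, u \<odot> h\<rangle> = 0" "f \<in> K \<Longrightarrow> h \<in> H2 \<Longrightarrow> \<langle>u \<odot> h, f\<rangle> = 0"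
  by (auto simp: K_eq) (metis cinner_commute complex_cnj_zero)

lemma K_orth_u: "f \<in> K \<Longrightarrow> \<langle>f, u\<rangle> = 0" "f \<in> K \<Longrightarrow> \<langle>u, f\<rangle> = 0"
  using K_orth[of f l2_one] by auto

lemma K_closed: "closed_csubspace K"
proof -
  have "closed K"
    unfolding closed_sequential_limits
  proof (intro allI impI)
    fix x l assume *: "(\<forall>n. x n \<in> K) \<and> x \<longlonglongrightarrow> l"
    have "l \<in> H2" using * K_H2 closed_sequentially[OF H2_subspace(4), of x l] by blast
    moreover have "\<langle>l, u \<odot> h\<rangle> = 0" if "h \<in> H2" for h
    proof -
      have "(\<lambda>n. \<langle>x n, u \<odot> h\<rangle>) \<longlonglongrightarrow> \<langle>l, u \<odot> h\<rangle>"
        using * by (intro tendsto_cinner) auto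
      then show ?thesis using * that by (simp add: K_orth LIMSEQ_const_iff)
    qed
    ultimately show "l \<in> K" by (simp add: K_eq)
  qed
  then show ?thesis by (auto simp: closed_csubspace_def K_eq cinner_add_left H2_subspace)
qed

lemmas K_subspace = closed_csubspaceD[OF K_closed]

lemmas P_in = orth_proj_in[OF K_closed]

lemmas cinner_P = cinner_orth_proj[OF K_closed] cinner_orth_proj_right[OF K_closed]

text \<open>As u is unimodular, the projection of g to u H2 is u times the analytic part of cnj u g;
  what remains is the projection to K.\<close>

lemma H2_decomp_K:
  assumes "g \<in> H2"
  defines "h \<equiv> orth_proj H2 (l2_cnj u \<odot> g)"
  shows "h \<in> H2" "g - u \<odot> h \<in> K" "orth_proj K g = g - u \<odot> h"
proof -
  show h: "h \<in> H2" unfolding h_def by (rule orth_proj_in[OF H2_closed])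
  show "g - u \<odot> h \<in> K"
    unfolding K_eq
  proof (intro CollectI conjI ballI)
    show "g - u \<odot> h \<in> H2" by (intro H2_subspace mult_H2 assms h u_H2 u_bdd)
    fix k assume "k \<in> H2"
    then have "\<langle>l2_cnj u \<odot> g, k\<rangle> = \<langle>h, k\<rangle>"
      by (simp add: h_def cinner_orth_proj[OF H2_closed])
    then show "\<langle>g - u \<odot> h, u \<odot> k\<rangle> = 0"
      by (simp add: cinner_diff_left cinner_unimodular cinner_mult_right unimodular_cancel)
  qed
  then show "orth_proj K g = g - u \<odot> h"
    by (intro orth_proj_eqI[OF K_closed]) (auto simp: cinner_diff_left K_orth h)
qed

text \<open>The analytic part h of cnj u z^n has no coefficient beyond n, because u times a positive
  power of z has mean 0. So h is a polynomial, and z^n - u h is bounded.\<close>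

lemma P_zp_bdd: "l2_bdd (orth_proj K (zp n))"
proof -
  define h where "h = orth_proj H2 (l2_cnj u \<odot> zp n)"
  have hH: "h \<in> H2" unfolding h_def by (rule orth_proj_in[OF H2_closed])
  have h0: "\<langle>h, zp m\<rangle> = 0" if "m > n" for m
  proof -
    have "\<langle>h, zp m\<rangle> = \<langle>zp n, u \<odot> zp m\<rangle>"
      by (simp add: h_def cinner_orth_proj[OF H2_closed] cinner_mult_left)
    also have "u \<odot> zp m = zp n \<odot> (u \<odot> zp (m - n))"
      using that mult_left_commute[of u "zp n" "zp (m - n)"] by (simp add: zp_add)
    also have "\<langle>zp n, zp n \<odot> (u \<odot> zp (m - n))\<rangle> = \<langle>l2_one, u \<odot> zp (m - n)\<rangle>"
      using cinner_unimodular[of "zp n" l2_one] by simp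
    also have "\<dots> = cnj \<langle>u \<odot> zp (m - n), l2_one\<rangle>" by (rule cinner_commute)
    also have "\<dots> = 0" using that by (simp add: H2_cinner_mult_one u_H2 cinner_zp_one)
    finally show ?thesis .
  qed
  define p where "p N = (\<Sum>j<N. \<langle>h, zp j\<rangle> *\<^sub>C zp j)" for N
  have pz: "\<langle>p N, zp m\<rangle> = (if m < N then \<langle>h, zp m\<rangle> else 0)" for m N
    by (induction N) (auto simp: p_def cinner_add_left cinner_zp less_Suc_eq)
  \<comment> \<open>\<open>p N\<close> sums over exponents below N, so the exponent n itself
    requires \<open>Suc n\<close>.\<close>
  have "h - p (Suc n) = 0"
    by (rule H2_total) (auto simp: p_def sum_zp_H2 hH pz[unfolded p_def] h0 cinner_diff_left
        intro!: H2_subspace(5) simp del: sum.lessThan_Suc)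
  moreover have "l2_bdd (p N)" for N by (induction N) (auto simp: p_def)
  ultimately have "l2_bdd h" by simp
  then show ?thesis unfolding H2_decomp_K(3)[OF zp_H2] h_def by simp
qed

text \<open>Density of the bounded members of K, in the form in which it is used: an identity in K
  may be tested on bounded f, where the symbol determines A. The projections of the
  \<open>zp n\<close> provide enough test functions.\<close>

lemma K_total:
  assumes "x \<in> K" "y \<in> K" "\<And>f. f \<in> K \<Longrightarrow> l2_bdd f \<Longrightarrow> \<langle>f, x\<rangle> = \<langle>f, y\<rangle>"
  shows "x = y"
proof -
  have "x - y = 0"
  proof (rule H2_total)
    show "x - y \<in> H2" using assms by (intro K_H2 K_subspace)
    fix n
    have "\<langle>zp n, x - y\<rangle> = \<langle>orth_proj K (zp n), x - y\<rangle>"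
      using assms by (subst cinner_P(1)) (auto intro: K_subspace)
    also have "\<dots> = 0" using assms(3)[OF P_in P_zp_bdd] by (simp add: cinner_diff_right)
    finally show "\<langle>x - y, zp n\<rangle> = 0" by (metis cinner_commute complex_cnj_zero)
  qed
  then show ?thesis by simp
qed

lemma K_hardy_inf: "K \<inter> hardy_inf = {f \<in> K. l2_bdd f}"
  using K_H2 by (auto simp: hardy_inf_eq)

text \<open>Conjugation exchanges the two conditions: orthogonality of f to u H2 makes
  \<open>C f\<close> analytic, and analyticity of f makes \<open>C f\<close> orthogonal to u
  H2.\<close>

lemma C_in: assumes "f \<in> K" shows "C f \<in> K"
  unfolding K_eq
proof (intro CollectI conjI ballI)
  show "C f \<in> H2"
    unfolding H2_def
  proof (intro CollectI allI)
    fix n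
    have "\<langle>C f, l2_cnj (zp (Suc n))\<rangle> = \<langle>l2_cnj l2_z \<odot> (u \<odot> l2_cnj f), l2_cnj l2_z \<odot> l2_cnj (zp n)\<rangle>"
      by (simp add: model_conj_def cnj_z_cnj_zp mult_left_commute[of u])
    also have "\<dots> = \<langle>u \<odot> l2_cnj f, l2_cnj (zp n)\<rangle>" by (rule cinner_unimodular) simp
    also have "\<dots> = \<langle>l2_cnj f, l2_cnj u \<odot> l2_cnj (zp n)\<rangle>" by (rule cinner_mult_left) simp
    also have "\<dots> = \<langle>u \<odot> zp n, f\<rangle>" by (simp add: cinner_cnj_cnj flip: cnj_mult)
    also have "\<dots> = 0" using assms by (simp add: K_orth)
    finally show "\<langle>C f, l2_cnj (zp (Suc n))\<rangle> = 0" .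
  qed
  fix h assume h: "h \<in> H2"
  have "\<langle>C f, u \<odot> h\<rangle> = \<langle>l2_cnj (l2_z \<odot> f), h\<rangle>"
    by (simp add: model_conj_def cinner_unimodular cnj_mult)
  also have "\<dots> = cnj \<langle>h, l2_cnj (l2_z \<odot> f)\<rangle>" by (rule cinner_commute)
  finally show "\<langle>C f, u \<odot> h\<rangle> = 0" using H2_orth_cnj[OF h K_H2[OF assms]] by simp
qed

lemma C_C [simp]: "C (C f) = f"
  by (simp add: model_conj_def cnj_mult unimodular_cancel mult_left_commute[of "l2_cnj l2_z" "l2_cnj u"])

lemma cinner_C_C: "\<langle>C f, C g\<rangle> = \<langle>g, f\<rangle>"
  by (simp add: model_conj_def cinner_unimodular cinner_cnj_cnj)

lemma cinner_C_left: "\<langle>C f, g\<rangle> = \<langle>C g, f\<rangle>"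
  using cinner_C_C[of f "C g"] by simp

lemma norm_C [simp]: "norm (C f) = norm f"
  by (simp add: norm_eq_sqrt_inner inner_ltwo_def cinner_C_C)

lemma C_bdd: "l2_bdd f \<Longrightarrow> l2_bdd (C f)"
  by (simp add: model_conj_def)

lemma C_scale: "C (c *\<^sub>C f) = cnj c *\<^sub>C C f"
  by (simp add: model_conj_def cnj_scale mult_scale_right)

lemma C_add: "C (f + g) = C f + C g"
  by (simp add: model_conj_def cnj_add mult_add_right)

lemma k0_bdd: "l2_bdd k0"
  by (simp add: k0_def)

lemma k0_in: "k0 \<in> K"
  unfolding K_eq
proof (intro CollectI conjI ballI)
  show "k0 \<in> H2" unfolding k0_def by (intro H2_subspace one_H2 u_H2)
  fix h assume h: "h \<in> H2"
  have "\<langle>l2_one, u \<odot> h\<rangle> = cnj \<langle>u \<odot> h, l2_one\<rangle>" by (rule cinner_commute)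
  also have "\<dots> = cnj u0 * \<langle>l2_one, h\<rangle>"
    using h by (simp add: H2_cinner_mult_one u_H2 u0_def cinner_commute[of l2_one h])
  finally show "\<langle>k0, u \<odot> h\<rangle> = 0"
    using cinner_unimodular[OF u_unimodular, of l2_one h] by (simp add: k0_def cinner_diff_left)
qed

lemma cinner_k0: "f \<in> K \<Longrightarrow> \<langle>f, k0\<rangle> = \<langle>f, l2_one\<rangle>" "f \<in> K \<Longrightarrow> \<langle>k0, f\<rangle> = \<langle>l2_one, f\<rangle>"
  by (simp_all add: k0_def cinner_simps K_orth_u)

lemma cinner_k0_k0: "\<langle>k0, k0\<rangle> = complex_of_real (1 - (cmod u0)\<^sup>2)"
proof -
  have "\<langle>k0, k0\<rangle> = \<langle>k0, l2_one\<rangle>" by (rule cinner_k0(1)[OF k0_in])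
  also have "\<dots> = 1 - cnj u0 * u0" by (simp add: k0_def cinner_diff_left u0_def)
  also have "cnj u0 * u0 = complex_of_real ((cmod u0)\<^sup>2)"
    using complex_norm_square[of u0] by (simp add: mult.commute)
  finally show ?thesis by simp
qed

lemma backshift_in:
  assumes f: "f \<in> K"
  shows "backshift f \<in> K"
  unfolding K_eq
proof (intro CollectI conjI ballI)
  show "backshift f \<in> H2" by (intro backshift_H2 K_H2 f)
  fix h assume h: "h \<in> H2"
  have "\<langle>backshift f, u \<odot> h\<rangle> = \<langle>f - \<langle>f, l2_one\<rangle> *\<^sub>C l2_one, l2_z \<odot> (u \<odot> h)\<rangle>"
    by (simp add: backshift_def cinner_mult_left)
  also have "l2_z \<odot> (u \<odot> h) = u \<odot> (l2_z \<odot> h)" by (rule mult_left_commute) auto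
  also have "\<langle>f - \<langle>f, l2_one\<rangle> *\<^sub>C l2_one, u \<odot> (l2_z \<odot> h)\<rangle> =
      - \<langle>f, l2_one\<rangle> * cnj \<langle>u \<odot> (l2_z \<odot> h), l2_one\<rangle>"
    by (simp add: cinner_diff_left K_orth f z_mult_H2 h cinner_commute[of l2_one])
  also have "\<dots> = 0"
    by (simp add: H2_cinner_mult_one u_H2 z_mult_H2 h cinner_z_mult_one)
  finally show "\<langle>backshift f, u \<odot> h\<rangle> = 0" .
qed

lemma S_in: "S f \<in> K"
  by (simp add: model_shift_def P_in)

text \<open>Moving z across the pairing gives cnj z g, which differs from \<open>backshift g\<close>
  by a multiple of cnj z, and analytic f is orthogonal to that.\<close>

lemma cinner_S:
  assumes "f \<in> K" "g \<in> K"
  shows "\<langle>S f, g\<rangle> = \<langle>f, backshift g\<rangle>"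
proof -
  have "\<langle>f, l2_cnj l2_z\<rangle> = 0" using H2D[OF K_H2[OF assms(1)], of 0] by (simp add: zp_def)
  then show ?thesis
    by (simp add: model_shift_def cinner_P assms cinner_mult_left backshift_def mult_diff_right
        mult_scale_right cinner_diff_right)
qed

lemma cinner_C_backshift:
  assumes g: "g \<in> K"
  shows "\<langle>C g, backshift f\<rangle> = \<langle>u \<odot> l2_cnj g, f\<rangle>"
proof -
  have "\<langle>C g, backshift f\<rangle> = \<langle>u \<odot> l2_cnj g, f - \<langle>f, l2_one\<rangle> *\<^sub>C l2_one\<rangle>"
    by (simp add: model_conj_def backshift_def mult_left_commute[of u] cinner_unimodular)
  also have "\<langle>u \<odot> l2_cnj g, l2_one\<rangle> = \<langle>u, g\<rangle>"
    by (simp add: cinner_mult_left cinner_cnj_cnj)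
  then have "\<langle>u \<odot> l2_cnj g, f - \<langle>f, l2_one\<rangle> *\<^sub>C l2_one\<rangle> = \<langle>u \<odot> l2_cnj g, f\<rangle>"
    by (simp add: cinner_diff_right K_orth_u g)
  finally show ?thesis .
qed

lemma cinner_u_cnj: "\<langle>u \<odot> l2_cnj f, g\<rangle> = \<langle>u \<odot> l2_cnj g, f\<rangle>"
proof -
  have "\<langle>u \<odot> l2_cnj f, g\<rangle> = \<langle>l2_cnj f, l2_cnj (u \<odot> l2_cnj g)\<rangle>"
    by (simp add: cinner_mult_left cnj_mult)
  then show ?thesis by (simp add: cinner_cnj_cnj)
qed

text \<open>Tested against g, both sides become the mean of u times the conjugates of f and g, which
  is symmetric in f and g by \<open>cinner_u_cnj\<close>.\<close>

lemma S_C: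
  assumes f: "f \<in> K"
  shows "S (C f) = C (backshift f)"
proof (rule cinner_eqI[OF K_closed S_in C_in[OF backshift_in[OF f]]])
  fix g assume g: "g \<in> K"
  show "\<langle>S (C f), g\<rangle> = \<langle>C (backshift f), g\<rangle>"
    by (simp add: cinner_S C_in f g cinner_C_left[of "backshift f"] cinner_C_backshift cinner_u_cnj[of f])
qed

text \<open>S is the backward shift conjugated by the isometry C, so its norm loss at x is that of
  the backward shift at \<open>C x\<close>, namely the constant coefficient of
  \<open>C x\<close>.\<close>

lemma norm_S:
  assumes x: "x \<in> K"
  shows "(norm (S x))\<^sup>2 = (norm x)\<^sup>2 - (cmod \<langle>x, C k0\<rangle>)\<^sup>2"
proof -
  have "S x = C (backshift (C x))" using S_C[OF C_in[OF x]] by simp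
  then have "(norm (S x))\<^sup>2 = (norm x)\<^sup>2 - (cmod \<langle>C x, l2_one\<rangle>)\<^sup>2"
    by (simp add: norm_backshift)
  also have "\<langle>C x, l2_one\<rangle> = cnj \<langle>x, C k0\<rangle>"
    using cinner_C_left[of x k0] cinner_k0(1)[OF C_in[OF x]] cinner_commute[of "C k0" x] by simp
  finally show ?thesis by simp
qed

text \<open>On members of K that vanish at the origin J is S C, and it is an antilinear involution
  of that subspace: the result stays in K by \<open>J_in\<close>, and it vanishes at the origin
  because u is orthogonal to K.\<close>

abbreviation J where "J f \<equiv> u \<odot> l2_cnj f"

lemma J_eq_S_C:
  assumes "f \<in> K" "\<langle>f, l2_one\<rangle> = 0"
  shows "S (C f) = J f"
  unfolding S_C[OF assms(1)]
  by (simp add: backshift_def assms(2) model_conj_def cnj_mult unimodular_cancel)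

lemma J_in: "f \<in> K \<Longrightarrow> \<langle>f, l2_one\<rangle> = 0 \<Longrightarrow> J f \<in> K"
  using S_in[of "C f"] by (simp add: J_eq_S_C)

lemma J_one: "f \<in> K \<Longrightarrow> \<langle>J f, l2_one\<rangle> = 0"
  by (simp add: cinner_mult_left cinner_cnj_cnj K_orth_u)

lemma J_J [simp]: "J (J f) = f"
  by (simp add: cnj_mult unimodular_cancel)

lemma J_scale: "J (c *\<^sub>C f) = cnj c *\<^sub>C J f"
  by (simp add: cnj_scale mult_scale_right)

lemma J_add: "J (f + g) = J f + J g"
  by (simp add: cnj_add mult_add_right)

section \<open>Truncated Toeplitz operators\<close>

lemma is_tto_iff:
  "is_tto u \<phi> A \<longleftrightarrow> bounded_operator_on K A \<and>
     (\<forall>f\<in>K. l2_bdd f \<longrightarrow> (\<forall>g\<in>K. \<langle>A f, g\<rangle> = \<langle>\<phi> \<odot> f, g\<rangle>))"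
proof -
  have "A f = orth_proj K (\<phi> \<odot> f) \<longleftrightarrow> (\<forall>g\<in>K. \<langle>A f, g\<rangle> = \<langle>\<phi> \<odot> f, g\<rangle>)"
    if "bounded_operator_on K A" "f \<in> K" for f
  proof
    assume "\<forall>g\<in>K. \<langle>A f, g\<rangle> = \<langle>\<phi> \<odot> f, g\<rangle>"
    then have "orth_proj K (\<phi> \<odot> f) = A f"
      by (intro orth_proj_eqI[OF K_closed] bounded_operator_onD(1)[OF that]) simp
    then show "A f = orth_proj K (\<phi> \<odot> f)" by simp
  qed (simp add: cinner_P)
  then show ?thesis by (auto simp: is_tto_def K_hardy_inf)
qed

lemma ttoD:
  assumes "is_tto u \<phi> A"
  shows "bounded_operator_on K A"
    and "f \<in> K \<Longrightarrow> l2_bdd f \<Longrightarrow> g \<in> K \<Longrightarrow> \<langle>A f, g\<rangle> = \<langle>\<phi> \<odot> f, g\<rangle>"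
  using assms by (auto simp: is_tto_iff)

text \<open>With f and h bounded, the mean of \<phi> h cnj f can be regrouped at will, so even an
  unbounded symbol may be carried to the other side of the pairing.\<close>

lemma tto_adjoint:
  assumes A: "is_tto u \<phi> A"
  shows "is_tto u (l2_cnj \<phi>) (adjoint_on K A)"
  unfolding is_tto_iff
proof (intro conjI ballI impI)
  note Ab = ttoD(1)[OF A]
  show "bounded_operator_on K (adjoint_on K A)"
    by (rule bounded_operator_on_adjoint[OF K_closed Ab])
  fix f g assume f: "f \<in> K" "l2_bdd f" and g: "g \<in> K"
  have "adjoint_on K A f = orth_proj K (l2_cnj \<phi> \<odot> f)"
  proof (rule K_total[OF adjoint_on_in[OF K_closed Ab f(1)] P_in])
    fix h assume h: "h \<in> K" "l2_bdd h"
    have "\<langle>h, adjoint_on K A f\<rangle> = \<langle>\<phi> \<odot> h, f\<rangle>"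
      using cinner_adjoint_on[OF K_closed Ab f(1) h(1)] ttoD(2)[OF A h f(1)] by simp
    also have "\<dots> = \<langle>\<phi>, l2_cnj h \<odot> f\<rangle>"
      using h by (simp add: mult_commute[of \<phi>] cinner_mult_left)
    also have "\<dots> = \<langle>l2_cnj f \<odot> \<phi>, l2_cnj h\<rangle>"
      using f by (simp add: mult_commute[of "l2_cnj h"] cinner_mult_right)
    also have "\<dots> = \<langle>h, f \<odot> l2_cnj \<phi>\<rangle>"
      using f cinner_cnj_cnj[of "f \<odot> l2_cnj \<phi>" h] by (simp add: cnj_mult)
    also have "\<dots> = \<langle>h, orth_proj K (l2_cnj \<phi> \<odot> f)\<rangle>"
      by (simp add: cinner_P h mult_commute)
    finally show "\<langle>h, adjoint_on K A f\<rangle> = \<langle>h, orth_proj K (l2_cnj \<phi> \<odot> f)\<rangle>" .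
  qed
  then show "\<langle>adjoint_on K A f, g\<rangle> = \<langle>l2_cnj \<phi> \<odot> f, g\<rangle>" by (simp add: cinner_P g)
qed

text \<open>Pointwise, conjugating \<phi> f by C gives cnj \<phi> times \<open>C f\<close>, and cnj
  \<phi> is a symbol of the adjoint. Bounded test functions suffice because C preserves
  boundedness.\<close>

lemma tto_C_symmetric:
  assumes A: "is_tto u \<phi> A" and g: "g \<in> K"
  shows "adjoint_on K A g = C (A (C g))"
proof -
  note Ab = ttoD(1)[OF A]
  note At = tto_adjoint[OF A]
  have ACg: "A (C g) \<in> K" by (rule bounded_operator_onD(1)[OF Ab C_in[OF g]])
  show ?thesis
  proof (rule K_total[OF adjoint_on_in[OF K_closed Ab g] C_in[OF ACg]])
    fix f assume f: "f \<in> K" "l2_bdd f"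
    have "\<langle>f, C (A (C g))\<rangle> = \<langle>A (C g), C f\<rangle>"
      by (metis C_C cinner_C_C)
    also have "\<dots> = cnj \<langle>adjoint_on K A (C f), C g\<rangle>"
      using cinner_adjoint_on[OF K_closed Ab C_in[OF f(1)] C_in[OF g]]
      by (metis cinner_commute)
    also have "\<dots> = cnj \<langle>l2_cnj \<phi> \<odot> C f, C g\<rangle>"
      using ttoD(2)[OF At C_in[OF f(1)] C_bdd[OF f(2)] C_in[OF g]] by simp
    also have "\<langle>l2_cnj \<phi> \<odot> C f, C g\<rangle> = \<langle>C (f \<odot> \<phi>), C g\<rangle>"
    proof -
      have "l2_cnj \<phi> \<odot> C f = C f \<odot> l2_cnj \<phi>" by (rule mult_commute)
      also have "\<dots> = C (f \<odot> \<phi>)"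
        using f by (simp add: model_conj_def cnj_mult mult_assoc)
      finally show ?thesis by simp
    qed
    also have "cnj \<dots> = \<langle>\<phi> \<odot> f, g\<rangle>" by (simp add: cinner_C_C mult_commute cinner_commute[of g])
    also have "\<dots> = \<langle>f, adjoint_on K A g\<rangle>"
      using cinner_adjoint_on[OF K_closed Ab g f(1)] ttoD(2)[OF A f g] by simp
    finally show "\<langle>f, adjoint_on K A g\<rangle> = \<langle>f, C (A (C g))\<rangle>" by simp
  qed
qed

text \<open>The term u h1 f lies in u H2, hence is orthogonal to K. For the other term, cnj u f is
  the conjugate of z \<open>C f\<close>, so the whole product is the conjugate of z times an
  analytic function and is orthogonal to \<open>H2\<close>.\<close>

lemma tto_symbol_change:
  assumes A: "is_tto u \<phi> A" and h: "h1 \<in> H2" "h2 \<in> H2" and \<phi>': "\<phi> = \<phi>' + u \<odot> h1 + l2_cnj (u \<odot> h2)"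
  shows "is_tto u \<phi>' A"
  unfolding is_tto_iff
proof (intro conjI ballI impI ttoD(1)[OF A])
  fix f g assume f: "f \<in> K" "l2_bdd f" and g: "g \<in> K"
  have "(u \<odot> h1) \<odot> f = u \<odot> (f \<odot> h1)"
    using f mult_left_commute[of f u h1] by (simp add: mult_commute[of _ f])
  then have 1: "\<langle>(u \<odot> h1) \<odot> f, g\<rangle> = 0"
    using K_orth(2)[OF g mult_H2[OF h(1) K_H2[OF f(1)] f(2)]] by simp
  have Cf: "l2_bdd (C f)" "C f \<in> K" using f by (auto intro: C_bdd C_in)
  have "l2_cnj (u \<odot> h2) \<odot> f = f \<odot> (l2_cnj u \<odot> l2_cnj h2)"
    by (simp add: cnj_mult mult_commute[of _ f])
  also have "\<dots> = (l2_cnj u \<odot> f) \<odot> l2_cnj h2"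
    using f mult_left_commute[of f "l2_cnj u"] mult_assoc[of "l2_cnj u" f] by simp
  also have "l2_cnj u \<odot> f = l2_cnj (l2_z \<odot> C f)"
    by (simp add: model_conj_def cnj_mult mult_left_commute[of "l2_cnj l2_z" "l2_cnj u"] unimodular_cancel)
  also have "\<dots> \<odot> l2_cnj h2 = l2_cnj (l2_z \<odot> (C f \<odot> h2))"
    using Cf by (simp flip: cnj_mult mult_assoc)
  finally have "\<langle>l2_cnj (u \<odot> h2) \<odot> f, g\<rangle> = cnj \<langle>g, l2_cnj (l2_z \<odot> (C f \<odot> h2))\<rangle>"
    by (simp add: cinner_commute[of g])
  then have 2: "\<langle>l2_cnj (u \<odot> h2) \<odot> f, g\<rangle> = 0"
    using H2_orth_cnj[OF K_H2[OF g] mult_H2[OF h(2) K_H2[OF Cf(2)] Cf(1)]] by simp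
  have "\<langle>A f, g\<rangle> = \<langle>\<phi> \<odot> f, g\<rangle>" by (rule ttoD(2)[OF A f g])
  also have "\<phi> \<odot> f = \<phi>' \<odot> f + (u \<odot> h1) \<odot> f + l2_cnj (u \<odot> h2) \<odot> f"
    using f unfolding \<phi>' by (simp add: mult_add_left)
  finally show "\<langle>A f, g\<rangle> = \<langle>\<phi>' \<odot> f, g\<rangle>" by (simp add: cinner_add_left 1 2)
qed

lemma H2_normal_form:
  assumes "g \<in> H2"
  obtains \<psi> a h where "\<psi> \<in> K" "\<langle>\<psi>, l2_one\<rangle> = 0" "h \<in> H2" "g = \<psi> + l2_const a + u \<odot> h"
    "g \<in> K \<Longrightarrow> g = \<psi> + a *\<^sub>C k0"
proof -
  define p where "p = orth_proj K g"
  obtain h where h: "h \<in> H2" "p = g - u \<odot> h"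
    using H2_decomp_K[OF assms] unfolding p_def by blast
  \<comment> \<open>Chosen to make p - a k0 vanish at the origin. If k0(0) = 0, then k0 = 0, so p(0)
    = 0 as well, and the quotient takes the default value 0.\<close>
  define a where "a = \<langle>p, l2_one\<rangle> / \<langle>k0, l2_one\<rangle>"
  define \<psi> where "\<psi> = p - a *\<^sub>C k0"
  have p: "p \<in> K" unfolding p_def by (rule P_in)
  show ?thesis
  proof
    show "\<psi> \<in> K" unfolding \<psi>_def by (intro K_subspace p k0_in)
    have "\<langle>p, l2_one\<rangle> = 0" if "\<langle>k0, l2_one\<rangle> = 0"
    proof -
      have "k0 = 0" using that cinner_k0(1)[OF k0_in] by simp
      then show ?thesis using cinner_k0(1)[OF p] by simp
    qed
    then show "\<langle>\<psi>, l2_one\<rangle> = 0" by (auto simp: \<psi>_def a_def cinner_diff_left)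
    \<comment> \<open>Replacing a k0 by the constant a leaves the term - a cnj u0 u, which is
      absorbed into u H2.\<close>
    show "h - (a * cnj u0) *\<^sub>C l2_one \<in> H2" by (intro H2_subspace h one_H2)
    have "g = \<psi> + a *\<^sub>C k0 + u \<odot> h" using h(2) by (simp add: \<psi>_def)
    then show "g = \<psi> + l2_const a + u \<odot> (h - (a * cnj u0) *\<^sub>C l2_one)"
      by (simp add: k0_def l2.scale_right_diff_distrib mult_diff_right mult_scale_right const_scale[of a])
    assume "g \<in> K"
    then have "p = g" unfolding p_def by (intro orth_proj_eqI[OF K_closed]) auto
    then show "g = \<psi> + a *\<^sub>C k0" by (simp add: \<psi>_def)
  qed
qed

lemma tto_normal_form:
  assumes A: "is_tto u \<phi> A"
  obtains \<psi> \<eta> c where "\<psi> \<in> K" "\<langle>\<psi>, l2_one\<rangle> = 0" "\<eta> \<in> K" "\<langle>\<eta>, l2_one\<rangle> = 0"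
    "is_tto u (\<psi> + l2_cnj \<eta> + l2_const c) A"
proof -
  obtain g1 g2 where g: "g1 \<in> H2" "g2 \<in> H2" "\<phi> = g1 + l2_cnj g2" by (rule ltwo_decomp)
  obtain \<psi> a h1 where 1: "\<psi> \<in> K" "\<langle>\<psi>, l2_one\<rangle> = 0" "h1 \<in> H2" "g1 = \<psi> + l2_const a + u \<odot> h1"
    using H2_normal_form[OF g(1)] by metis
  obtain \<eta> b h2 where 2: "\<eta> \<in> K" "\<langle>\<eta>, l2_one\<rangle> = 0" "h2 \<in> H2" "g2 = \<eta> + l2_const b + u \<odot> h2"
    using H2_normal_form[OF g(2)] by metis
  have "l2_const (a + cnj b) = l2_const a + l2_const (cnj b)"
    using to_L2_add[of "\<lambda>_. a" "\<lambda>_. cnj b"] by simp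
  then have "\<phi> = (\<psi> + l2_cnj \<eta> + l2_const (a + cnj b)) + u \<odot> h1 + l2_cnj (u \<odot> h2)"
    by (simp add: g(3) 1(4) 2(4) cnj_add)
  from that[OF 1(1,2) 2(1,2) tto_symbol_change[OF A 1(3) 2(3) this]] show ?thesis .
qed

lemma tto_translate:
  assumes A: "is_tto u \<phi> A"
  shows "is_tto u (a *\<^sub>C \<phi> + l2_const b) (\<lambda>f. a *\<^sub>C A f + b *\<^sub>C f)"
  unfolding is_tto_iff
proof (intro conjI ballI impI)
  show "bounded_operator_on K (\<lambda>f. a *\<^sub>C A f + b *\<^sub>C f)"
    by (rule bounded_operator_on_translate[OF K_closed ttoD(1)[OF A]])
  fix f g assume f: "f \<in> K" "l2_bdd f" and g: "g \<in> K"
  have "(a *\<^sub>C \<phi> + l2_const b) \<odot> f = a *\<^sub>C (\<phi> \<odot> f) + b *\<^sub>C f"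
    unfolding mult_add_left[OF f(2)] mult_scale_left[OF f(2)] mult_const_left ..
  then show "\<langle>a *\<^sub>C A f + b *\<^sub>C f, g\<rangle> = \<langle>(a *\<^sub>C \<phi> + l2_const b) \<odot> f, g\<rangle>"
    using ttoD(2)[OF A f g] by (simp add: cinner_add_left)
qed

end

section \<open>The displacement equation for a normalized symbol\<close>

locale normalized_tto = inner_symbol +
  fixes \<psi> \<eta> :: ltwo and A :: "ltwo \<Rightarrow> ltwo"
  assumes tto: "is_tto u (\<psi> + l2_cnj \<eta>) A"
    and psi: "\<psi> \<in> K" "\<langle>\<psi>, l2_one\<rangle> = 0"
    and eta: "\<eta> \<in> K" "\<langle>\<eta>, l2_one\<rangle> = 0"
begin

abbreviation A' where "A' \<equiv> adjoint_on K A"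
abbreviation \<phi> where "\<phi> \<equiv> \<psi> + l2_cnj \<eta>"

lemma A_bounded: "bounded_operator_on K A"
  by (rule ttoD(1)[OF tto])

lemmas A_op = bounded_operator_onD[OF A_bounded]

lemmas A'_in = adjoint_on_in[OF K_closed A_bounded]

lemmas cinner_A' = cinner_adjoint_on[OF K_closed A_bounded]
  cinner_adjoint_on_left[OF K_closed A_bounded]

text \<open>Exchanging \<psi> and \<eta> exchanges A and its adjoint, so every formula proved for
  \<open>A'\<close> yields one for A.\<close>

lemma adjoint_normalized: "normalized_tto u \<eta> \<psi> A'"
proof
  show "is_tto u (\<eta> + l2_cnj \<psi>) A'"
    using tto_adjoint[OF tto] by (simp add: cnj_add add.commute)
qed (use psi eta in auto)

lemma cinner_symbol:
  "g \<in> H2 \<Longrightarrow> \<langle>\<phi>, g\<rangle> = \<langle>\<psi>, g\<rangle>" "\<langle>\<phi>, l2_one\<rangle> = 0" "f \<in> H2 \<Longrightarrow> \<langle>\<phi>, l2_cnj f\<rangle> = \<langle>f, \<eta>\<rangle>"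
proof -
  show *: "\<langle>\<phi>, g\<rangle> = \<langle>\<psi>, g\<rangle>" if "g \<in> H2" for g
  proof -
    have "\<langle>l2_cnj \<eta>, g\<rangle> = cnj \<langle>g, l2_cnj \<eta>\<rangle>" by (rule cinner_commute)
    then show ?thesis using H2_cinner_cnj[OF that K_H2[OF eta(1)]] eta(2) by (simp add: cinner_add_left)
  qed
  show "\<langle>\<phi>, l2_one\<rangle> = 0" using *[OF one_H2] psi by simp
  show "\<langle>\<phi>, l2_cnj f\<rangle> = \<langle>f, \<eta>\<rangle>" if "f \<in> H2" for f
    using H2_cinner_cnj[OF K_H2[OF psi(1)] that] psi(2) by (simp add: cinner_add_left cinner_cnj_cnj)
qed

text \<open>In the pairing of \<phi> \<open>backshift f\<close> with \<open>backshift g\<close> the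
  two factors cnj z cancel. What separates the result from the pairing of \<phi> f with g are the
  constant terms of f and g, and these produce the rank-two correction.\<close>

lemma displacement:
  assumes g: "g \<in> K"
  shows "S (A' (backshift g)) = A' g - (\<langle>g, l2_one\<rangle> *\<^sub>C \<eta> + \<langle>g, \<psi>\<rangle> *\<^sub>C k0)"
proof (rule K_total[OF S_in])
  show "A' g - (\<langle>g, l2_one\<rangle> *\<^sub>C \<eta> + \<langle>g, \<psi>\<rangle> *\<^sub>C k0) \<in> K"
    by (intro K_subspace A'_in g eta k0_in)
  fix f assume f: "f \<in> K" "l2_bdd f"
  define s where "s = \<langle>f, l2_one\<rangle>"
  define t where "t = \<langle>g, l2_one\<rangle>"
  have Bf: "backshift f \<in> K" "l2_bdd (backshift f)" and Bg: "backshift g \<in> K"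
    using f g by (auto intro: backshift_in backshift_bdd)
  have "\<langle>f, S (A' (backshift g))\<rangle> = cnj \<langle>A' (backshift g), backshift f\<rangle>"
    using cinner_S[OF A'_in[OF Bg] f(1)] by (metis cinner_commute)
  also have "\<dots> = \<langle>A (backshift f), backshift g\<rangle>"
    using cinner_A'(1)[OF Bg Bf(1)] by (metis cinner_commute)
  also have "\<dots> = \<langle>\<phi> \<odot> backshift f, backshift g\<rangle>" by (rule ttoD(2)[OF tto Bf Bg])
  also have "\<phi> \<odot> backshift f = l2_cnj l2_z \<odot> (\<phi> \<odot> (f - s *\<^sub>C l2_one))"
  proof -
    have "backshift f \<odot> \<phi> = l2_cnj l2_z \<odot> ((f - s *\<^sub>C l2_one) \<odot> \<phi>)"
      unfolding backshift_def s_def[symmetric] using f by (intro mult_assoc) auto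
    then show ?thesis by (simp add: mult_commute[of \<phi>])
  qed
  also have "\<langle>\<dots>, backshift g\<rangle> = \<langle>\<phi> \<odot> (f - s *\<^sub>C l2_one), g - t *\<^sub>C l2_one\<rangle>"
    unfolding backshift_def t_def by (rule cinner_unimodular) simp
  also have "\<phi> \<odot> (f - s *\<^sub>C l2_one) = \<phi> \<odot> f - s *\<^sub>C \<phi>"
  proof -
    have "f \<odot> \<phi> = (f - s *\<^sub>C l2_one) \<odot> \<phi> + (s *\<^sub>C l2_one) \<odot> \<phi>"
      using f bdd_add_mult[of "f - s *\<^sub>C l2_one" "s *\<^sub>C l2_one" \<phi>] by simp
    then show ?thesis by (simp add: bdd_scale_mult mult_commute[of \<phi>])
  qed
  also have "\<langle>\<dots>, g - t *\<^sub>C l2_one\<rangle> = \<langle>A f, g\<rangle> - s * \<langle>\<psi>, g\<rangle> - cnj t * \<langle>f, \<eta>\<rangle>"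
  proof -
    have "\<langle>\<phi> \<odot> f, l2_one\<rangle> = \<langle>\<phi>, l2_cnj f\<rangle>"
      using f by (simp add: mult_commute[of \<phi>] cinner_mult_left)
    then have "\<langle>\<phi> \<odot> f, l2_one\<rangle> = \<langle>f, \<eta>\<rangle>" using cinner_symbol(3)[OF K_H2[OF f(1)]] by simp
    moreover have "\<langle>\<phi> \<odot> f, g\<rangle> = \<langle>A f, g\<rangle>" using ttoD(2)[OF tto f g] by simp
    ultimately show ?thesis
      using cinner_symbol(1)[OF K_H2[OF g]] cinner_symbol(2)
      by (simp only: cinner_diff_left cinner_diff_right cinner_scale_left cinner_scale_right) simp
  qed
  also have "\<dots> = \<langle>f, A' g - (\<langle>g, l2_one\<rangle> *\<^sub>C \<eta> + \<langle>g, \<psi>\<rangle> *\<^sub>C k0)\<rangle>"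
    using cinner_A'(1)[OF g f(1)] cinner_k0(1)[OF f(1)] cinner_commute[of \<psi> g]
    by (simp add: cinner_simps s_def t_def algebra_simps)
  finally show "\<langle>f, S (A' (backshift g))\<rangle> = \<langle>f, A' g - (\<langle>g, l2_one\<rangle> *\<^sub>C \<eta> + \<langle>g, \<psi>\<rangle> *\<^sub>C k0)\<rangle>" .
qed

lemma symbol_mult_u: "\<phi> \<odot> u = u \<odot> \<psi> + J \<eta>"
  by (simp add: mult_commute[of \<phi>] mult_add_right)

text \<open>Split k0 into 1 and a multiple of u: \<phi> projects to \<psi>, and \<phi> u = u \<psi>
  + J \<eta> projects to J \<eta>.\<close>

lemma A_k0: "A k0 = \<psi> - cnj u0 *\<^sub>C J \<eta>"
proof (rule cinner_eqI[OF K_closed A_op(1)[OF k0_in]])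
  show "\<psi> - cnj u0 *\<^sub>C J \<eta> \<in> K" by (intro K_subspace psi J_in eta)
  fix g assume g: "g \<in> K"
  have "\<phi> \<odot> k0 = \<phi> - cnj u0 *\<^sub>C (u \<odot> \<psi> + J \<eta>)"
    unfolding symbol_mult_u[symmetric]
  proof -
    have "\<phi> = k0 \<odot> \<phi> + (cnj u0 *\<^sub>C u) \<odot> \<phi>"
      using bdd_add_mult[of k0 "cnj u0 *\<^sub>C u" \<phi>] k0_bdd by (simp add: k0_def)
    then have "k0 \<odot> \<phi> = \<phi> - (cnj u0 *\<^sub>C u) \<odot> \<phi>"
      by (metis add_diff_cancel_right')
    then show "\<phi> \<odot> k0 = \<phi> - cnj u0 *\<^sub>C (\<phi> \<odot> u)"
      by (simp add: bdd_scale_mult mult_commute[of \<phi>])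
  qed
  then show "\<langle>A k0, g\<rangle> = \<langle>\<psi> - cnj u0 *\<^sub>C J \<eta>, g\<rangle>"
    using ttoD(2)[OF tto k0_in k0_bdd g] cinner_symbol(1)[OF K_H2[OF g]] K_orth(2)[OF g K_H2[OF psi(1)]]
    by (simp only: cinner_diff_left cinner_scale_left) (simp add: cinner_add_left)
qed

text \<open>Here \<open>C k0\<close> is cnj z (u - u0), whose factor cnj z cancels against that of
  \<open>backshift g\<close>. In effect this computes S A C k0; it is needed because
  \<open>C k0\<close> measures the norm loss of S.\<close>

lemma A_C_k0:
  assumes g: "g \<in> K"
  shows "\<langle>A (C k0), backshift g\<rangle> = \<langle>J \<eta> - u0 *\<^sub>C \<psi>, g\<rangle>"
proof -
  define t where "t = \<langle>g, l2_one\<rangle>"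
  have "C k0 = l2_cnj l2_z \<odot> (u - u0 *\<^sub>C l2_one)"
    by (simp add: model_conj_def k0_def cnj_diff cnj_scale mult_diff_right mult_scale_right
        mult_left_commute[of u "l2_cnj l2_z"] mult_commute[of u "l2_cnj l2_z"] unimodular_mult_cnj)
  then have Ck: "C k0 \<odot> \<phi> = l2_cnj l2_z \<odot> ((u - u0 *\<^sub>C l2_one) \<odot> \<phi>)"
    by (simp add: mult_assoc)
  have "u \<odot> \<phi> = (u - u0 *\<^sub>C l2_one) \<odot> \<phi> + (u0 *\<^sub>C l2_one) \<odot> \<phi>"
    using bdd_add_mult[of "u - u0 *\<^sub>C l2_one" "u0 *\<^sub>C l2_one" \<phi>] by simp
  then have diff: "(u - u0 *\<^sub>C l2_one) \<odot> \<phi> = \<phi> \<odot> u - u0 *\<^sub>C \<phi>"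
    by (simp add: bdd_scale_mult mult_commute[of u])
  have "\<langle>A (C k0), backshift g\<rangle> = \<langle>\<phi> \<odot> C k0, backshift g\<rangle>"
    by (rule ttoD(2)[OF tto C_in[OF k0_in] C_bdd[OF k0_bdd] backshift_in[OF g]])
  also have "\<dots> = \<langle>l2_cnj l2_z \<odot> (\<phi> \<odot> u - u0 *\<^sub>C \<phi>), backshift g\<rangle>"
    unfolding mult_commute[of \<phi> "C k0"] Ck diff by simp
  also have "\<dots> = \<langle>\<phi> \<odot> u - u0 *\<^sub>C \<phi>, g - t *\<^sub>C l2_one\<rangle>"
    unfolding backshift_def t_def by (rule cinner_unimodular) simp
  also have "\<dots> = \<langle>\<phi> \<odot> u, g\<rangle> - cnj t * \<langle>\<phi> \<odot> u, l2_one\<rangle> - u0 * \<langle>\<psi>, g\<rangle>"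
    using cinner_symbol(1)[OF K_H2[OF g]] cinner_symbol(2)
    by (simp only: cinner_diff_left cinner_diff_right cinner_scale_left cinner_scale_right) simp
  also have "\<langle>\<phi> \<odot> u, l2_one\<rangle> = 0"
    using cinner_symbol(3)[OF u_H2] K_orth_u(2)[OF eta(1)]
    by (simp only: mult_commute[of \<phi>] cinner_mult_left[OF u_bdd] one_mult)
  also have "\<langle>\<phi> \<odot> u, g\<rangle> = \<langle>J \<eta>, g\<rangle>"
    unfolding symbol_mult_u using K_orth(2)[OF g K_H2[OF psi(1)]] by (simp add: cinner_add_left)
  finally show ?thesis by (simp add: cinner_diff_left)
qed

text \<open>Take squared norms in the displacement equation. On the left \<open>norm_S\<close>
  accounts for the loss caused by S, evaluated by \<open>A_C_k0\<close>; on the right the mixed term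
  with k0 is evaluated by \<open>A_k0\<close>.\<close>

lemma norm_A'_displacement:
  assumes f: "f \<in> K"
  defines "s \<equiv> \<langle>f, l2_one\<rangle>"
  shows "(norm (A' f))\<^sup>2 - (norm (A' (backshift f)))\<^sup>2 =
    (cmod \<langle>f, \<psi>\<rangle>)\<^sup>2 - (cmod \<langle>f, J \<eta>\<rangle>)\<^sup>2 + 2 * Re (cnj s * \<langle>f, A \<eta>\<rangle>) - (cmod s)\<^sup>2 * (norm \<eta>)\<^sup>2"
proof -
  define t where "t = \<langle>f, \<psi>\<rangle>"
  define x where "x = \<langle>f, J \<eta>\<rangle>"
  define y where "y = \<langle>f, A \<eta>\<rangle>"
  have Bf: "backshift f \<in> K" by (rule backshift_in[OF f])
  have "\<langle>A' (backshift f), C k0\<rangle> = cnj \<langle>A (C k0), backshift f\<rangle>"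
    using cinner_A'(2)[OF Bf C_in[OF k0_in]] by (metis cinner_commute)
  also have "\<dots> = \<langle>f, J \<eta> - u0 *\<^sub>C \<psi>\<rangle>"
    unfolding A_C_k0[OF f] by (metis cinner_commute)
  also have "\<dots> = x - cnj u0 * t" by (simp add: cinner_diff_right x_def t_def)
  finally have 1: "\<langle>A' (backshift f), C k0\<rangle> = x - cnj u0 * t" .
  have "\<langle>A' f, s *\<^sub>C \<eta> + t *\<^sub>C k0\<rangle> = cnj s * y + cnj t * (t - u0 * x)"
    using cinner_A'(2)[OF f eta(1)] cinner_A'(2)[OF f k0_in]
    by (simp add: cinner_add_right A_k0 cinner_diff_right x_def t_def y_def)
  moreover have "(norm (s *\<^sub>C \<eta> + t *\<^sub>C k0))\<^sup>2 = (cmod s)\<^sup>2 * (norm \<eta>)\<^sup>2 + (cmod t)\<^sup>2 * (1 - (cmod u0)\<^sup>2)"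
  proof -
    have "(norm k0)\<^sup>2 = 1 - (cmod u0)\<^sup>2"
      using cinner_k0_k0 unfolding cinner_self of_real_eq_iff .
    moreover have "\<langle>\<eta>, k0\<rangle> = 0" using cinner_k0(1)[OF eta(1)] eta(2) by simp
    ultimately show ?thesis by (simp add: norm_add_sq power_mult_distrib)
  qed
  ultimately have "(norm (S (A' (backshift f))))\<^sup>2 = (norm (A' f))\<^sup>2 -
      2 * Re (cnj s * y + cnj t * (t - u0 * x)) + ((cmod s)\<^sup>2 * (norm \<eta>)\<^sup>2 + (cmod t)\<^sup>2 * (1 - (cmod u0)\<^sup>2))"
    unfolding displacement[OF f] s_def[symmetric] t_def[symmetric] norm_diff_sq by simp
  with norm_S[OF A'_in[OF Bf]] 1 have "(norm (A' f))\<^sup>2 - (norm (A' (backshift f)))\<^sup>2 =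
      2 * Re (cnj s * y + cnj t * (t - u0 * x)) - ((cmod s)\<^sup>2 * (norm \<eta>)\<^sup>2 + (cmod t)\<^sup>2 * (1 - (cmod u0)\<^sup>2))
      - (cmod (x - cnj u0 * t))\<^sup>2"
    by simp
  \<comment> \<open>All contributions of u0 cancel, so the formula depends on u only through
    J.\<close>
  moreover have "2 * Re (cnj t * (t - u0 * x)) - (cmod t)\<^sup>2 * (1 - (cmod u0)\<^sup>2) - (cmod (x - cnj u0 * t))\<^sup>2 =
      (cmod t)\<^sup>2 - (cmod x)\<^sup>2"
    unfolding cmod_power2 by (simp add: power2_eq_square algebra_simps)
  ultimately show ?thesis by (simp add: s_def t_def x_def y_def)
qed

lemma norm_A_displacement:
  assumes f: "f \<in> K"
  defines "s \<equiv> \<langle>f, l2_one\<rangle>"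
  shows "(norm (A f))\<^sup>2 - (norm (A (backshift f)))\<^sup>2 =
    (cmod \<langle>f, \<eta>\<rangle>)\<^sup>2 - (cmod \<langle>f, J \<psi>\<rangle>)\<^sup>2 + 2 * Re (cnj s * \<langle>f, A' \<psi>\<rangle>) - (cmod s)\<^sup>2 * (norm \<psi>)\<^sup>2"
  using normalized_tto.norm_A'_displacement[OF adjoint_normalized f]
  by (simp add: s_def adjoint_on_adjoint_on[OF K_closed A_bounded] f backshift_in)

text \<open>The defect \<open>\<parallel>A\<^sup>* f\<parallel>\<^sup>2 - \<parallel>A f\<parallel>\<^sup>2\<close> is invariant under the backward shift, whose powers tend to 0.\<close>

lemma norm_eq_of_J:
  assumes eq: "\<eta> = y *\<^sub>C J \<psi>" and y: "cmod y = 1" and f: "f \<in> K"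
  shows "norm (A' f) = norm (A f)"
proof -
  have J: "J \<eta> = cnj y *\<^sub>C \<psi>" unfolding eq J_scale J_J ..
  have nJ: "norm (J g) = norm g" for g by (simp add: norm_unimodular_mult)
  have n: "norm \<eta> = norm \<psi>" unfolding eq using y nJ[of \<psi>] by simp
  \<comment> \<open>This matches the mixed terms of the two displacement formulas. Both sides expand
    into two pairings: those mixing \<psi> and \<eta> agree by \<open>e1\<close>, the other two
    because |\<eta>| = |\<psi>| on the circle.\<close>
  have "A \<eta> = A' \<psi>"
  proof (rule K_total[OF A_op(1)[OF eta(1)] A'_in[OF psi(1)]])
    fix h assume h: "h \<in> K" "l2_bdd h"
    have a: "\<langle>h, A \<eta>\<rangle> = \<langle>l2_cnj \<phi> \<odot> h, \<eta>\<rangle>"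
      using ttoD(2)[OF tto_adjoint[OF tto] h eta(1)] cinner_A'(2)[OF h(1) eta(1)] by simp
    have b: "\<langle>h, A' \<psi>\<rangle> = \<langle>\<phi> \<odot> h, \<psi>\<rangle>"
      using ttoD(2)[OF tto h psi(1)] cinner_A'(1)[OF psi(1) h(1)] by simp
    \<comment> \<open>Both sides are the mean of h times the conjugates of g and k.\<close>
    have e1: "\<langle>l2_cnj g \<odot> h, k\<rangle> = \<langle>l2_cnj k \<odot> h, g\<rangle>" for g k
    proof -
      have "\<langle>l2_cnj g \<odot> h, k\<rangle> = \<langle>l2_cnj g, l2_cnj h \<odot> k\<rangle>"
        using h(2) by (simp add: mult_commute[of _ h] cinner_mult_left)
      also have "\<dots> = \<langle>h \<odot> l2_cnj k, g\<rangle>"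
        using cinner_cnj_cnj[of g "h \<odot> l2_cnj k"] h(2) by (simp add: cnj_mult)
      finally show ?thesis by (simp add: mult_commute)
    qed
    have "J \<psi> \<odot> h = u \<odot> (l2_cnj \<psi> \<odot> h)"
      using mult_left_commute[OF h(2) u_bdd, of "l2_cnj \<psi>"] by (simp only: mult_commute[of _ h])
    then have "\<langle>J \<psi> \<odot> h, J \<psi>\<rangle> = \<langle>\<psi> \<odot> h, \<psi>\<rangle>"
      using e1[of \<psi> "l2_cnj \<psi>"] by (simp add: cinner_unimodular)
    moreover have "\<eta> \<odot> h = y *\<^sub>C (J \<psi> \<odot> h)" unfolding eq by (rule mult_scale_left[OF h(2)])
    moreover have "cnj y * y = 1" using complex_norm_square[of y] y by (simp add: mult.commute)
    ultimately have "\<langle>\<eta> \<odot> h, \<eta>\<rangle> = \<langle>\<psi> \<odot> h, \<psi>\<rangle>"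
      unfolding eq by (simp add: mult.assoc[symmetric])
    then show "\<langle>h, A \<eta>\<rangle> = \<langle>h, A' \<psi>\<rangle>"
      unfolding a b using h(2) e1[of \<psi> \<eta>] by (simp add: cnj_add mult_add_left cinner_add_left)
  qed
  then have step: "(norm (A' g))\<^sup>2 - (norm (A g))\<^sup>2 = (norm (A' (backshift g)))\<^sup>2 - (norm (A (backshift g)))\<^sup>2"
    if "g \<in> K" for g
  proof -
    have "cmod \<langle>g, J \<eta>\<rangle> = cmod \<langle>g, \<psi>\<rangle>" unfolding J using y by (simp add: norm_mult)
    moreover have "cmod \<langle>g, \<eta>\<rangle> = cmod \<langle>g, J \<psi>\<rangle>" unfolding eq using y by (simp add: norm_mult)
    ultimately show ?thesis
      using norm_A'_displacement[OF that] norm_A_displacement[OF that] \<open>A \<eta> = A' \<psi>\<close> n by simp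
  qed
  have Bn: "(backshift ^^ n) f \<in> K" for n by (induction n) (auto intro: f backshift_in)
  have const: "(norm (A' f))\<^sup>2 - (norm (A f))\<^sup>2 =
      (norm (A' ((backshift ^^ n) f)))\<^sup>2 - (norm (A ((backshift ^^ n) f)))\<^sup>2" for n
    by (induction n) (simp_all add: step[OF Bn])
  obtain M1 where M1: "\<And>g. g \<in> K \<Longrightarrow> norm (A g) \<le> M1 * norm g" using A_op(4) by blast
  obtain M2 where M2: "\<And>g. g \<in> K \<Longrightarrow> norm (A' g) \<le> M2 * norm g"
    using bounded_operator_onD(4)[OF bounded_operator_on_adjoint[OF K_closed A_bounded]] by blast
  have lim: "(\<lambda>n. norm (T ((backshift ^^ n) f))) \<longlonglongrightarrow> 0" if "\<And>g. g \<in> K \<Longrightarrow> norm (T g) \<le> M * norm g" for T M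
  proof (rule Lim_null_comparison)
    show "\<forall>\<^sub>F n in sequentially. norm (norm (T ((backshift ^^ n) f))) \<le> M * norm ((backshift ^^ n) f)"
      using that[OF Bn] by simp
    show "(\<lambda>n. M * norm ((backshift ^^ n) f)) \<longlonglongrightarrow> 0"
      using tendsto_mult_left[OF backshift_funpow_tendsto[OF K_H2[OF f]], of M] by simp
  qed
  have "(\<lambda>n. (norm (A' ((backshift ^^ n) f)))\<^sup>2 - (norm (A ((backshift ^^ n) f)))\<^sup>2) \<longlonglongrightarrow> 0\<^sup>2 - 0\<^sup>2"
    by (intro tendsto_intros lim[OF M1] lim[OF M2])
  then have "(norm (A' f))\<^sup>2 - (norm (A f))\<^sup>2 = 0"
    unfolding const[symmetric] by (simp add: LIMSEQ_const_iff)
  then show ?thesis by (simp add: power2_eq_iff_nonneg)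
qed

lemma norm_eq_imp_rank_two:
  assumes n: "\<And>f. f \<in> K \<Longrightarrow> norm (A' f) = norm (A f)" and f: "f \<in> K" "\<langle>f, l2_one\<rangle> = 0"
  shows "(cmod \<langle>f, \<psi>\<rangle>)\<^sup>2 + (cmod \<langle>f, J \<psi>\<rangle>)\<^sup>2 = (cmod \<langle>f, \<eta>\<rangle>)\<^sup>2 + (cmod \<langle>f, J \<eta>\<rangle>)\<^sup>2"
  using norm_A'_displacement[OF f(1)] norm_A_displacement[OF f(1)] n[OF f(1)] n[OF backshift_in[OF f(1)]] f(2)
  by simp

end

section \<open>Equality of two rank-two forms\<close>

lemma cmod_sq_identity:
  "(cmod (cnj x * s + cnj y * t))\<^sup>2 + (cmod (x * t + y * s))\<^sup>2 =
   ((cmod x)\<^sup>2 + (cmod y)\<^sup>2) * ((cmod s)\<^sup>2 + (cmod t)\<^sup>2) + 4 * Re (cnj x * y * s * cnj t)"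
  unfolding cmod_power2 by (simp add: power2_eq_square algebra_simps)

text \<open>Here p' and q' stand for the images of p and q under J, of which \<open>conj\<close>
  retains the antilinear swap. Equality of the forms puts q into the span of p and p', say q = x p +
  y p'; then \<open>cmod_sq_identity\<close> isolates a cross term whose vanishing forces x = 0 or y
  = 0.\<close>

lemma rank_two_forms_eq:
  assumes M: "\<And>f g. f \<in> M \<Longrightarrow> g \<in> M \<Longrightarrow> f + g \<in> M" "\<And>c f. f \<in> M \<Longrightarrow> c *\<^sub>C f \<in> M"
    and mem: "p \<in> M" "p' \<in> M" "q \<in> M"
    and form: "\<And>f. f \<in> M \<Longrightarrow>
      (cmod \<langle>f, p\<rangle>)\<^sup>2 + (cmod \<langle>f, p'\<rangle>)\<^sup>2 = (cmod \<langle>f, q\<rangle>)\<^sup>2 + (cmod \<langle>f, q'\<rangle>)\<^sup>2"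
    and conj: "\<And>x y. q = x *\<^sub>C p + y *\<^sub>C p' \<Longrightarrow> q' = cnj x *\<^sub>C p' + cnj y *\<^sub>C p"
    and zero: "p = 0 \<Longrightarrow> p' = 0"
  shows "(\<exists>x. cmod x = 1 \<and> q = x *\<^sub>C p) \<or> (\<exists>y. cmod y = 1 \<and> q = y *\<^sub>C p')"
proof -
  have Md: "f - g \<in> M" if "f \<in> M" "g \<in> M" for f g
    using M(1)[OF that(1) M(2)[OF that(2), of "-1"]] by simp
  have perp: "\<langle>f, q\<rangle> = 0" if "f \<in> M" "\<langle>f, p\<rangle> = 0" "\<langle>f, p'\<rangle> = 0" for f
    using form[OF that(1)] that by (simp add: sum_power2_eq_zero_iff)
  \<comment> \<open>Separating the coefficients x and y requires a dual pair for p and p', so linear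
    dependence is settled first.\<close>
  consider "p = 0" | m where "p \<noteq> 0" "p' = m *\<^sub>C p" | "p \<noteq> 0" "\<And>m. p' \<noteq> m *\<^sub>C p"
    by blast
  then show ?thesis
  proof cases
    case 1
    then have "\<langle>q, q\<rangle> = 0" using perp[OF mem(3)] zero by simp
    then show ?thesis using 1 by (intro disjI1 exI[of _ 1]) simp
  next
    case 2
    define x where "x = \<langle>q, p\<rangle> / \<langle>p, p\<rangle>"
    define f where "f = q - x *\<^sub>C p"
    have "f \<in> M" unfolding f_def by (intro Md M mem)
    moreover have fp: "\<langle>f, p\<rangle> = 0" using 2 by (simp add: f_def x_def cinner_diff_left)
    ultimately have "\<langle>f, q\<rangle> = 0" using 2 by (intro perp) simp_all
    then have "\<langle>f, f\<rangle> = 0" using fp by (simp add: f_def[symmetric] cinner_diff_right[of f q "x *\<^sub>C p", folded f_def])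
    then have q: "q = x *\<^sub>C p" by (simp add: f_def)
    then have "q' = cnj x *\<^sub>C p'" using conj[of x 0] by simp
    define P where "P = cmod \<langle>p, p\<rangle>"
    have P: "P > 0" using 2 by (simp add: P_def)
    have "P\<^sup>2 + (cmod m * P)\<^sup>2 = (cmod x * P)\<^sup>2 + (cmod x * (cmod m * P))\<^sup>2"
      using form[OF mem(1)] unfolding q \<open>q' = cnj x *\<^sub>C p'\<close> 2(2)
      by (simp add: norm_mult P_def)
    then have "((cmod x)\<^sup>2 - 1) * (P\<^sup>2 * (1 + (cmod m)\<^sup>2)) = 0"
      by algebra
    moreover have "P\<^sup>2 * (1 + (cmod m)\<^sup>2) > 0"
      using P by (intro mult_pos_pos) (auto intro: add_pos_nonneg)
    ultimately have "(cmod x)\<^sup>2 = 1" by auto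
    then have "cmod x = 1" using norm_ge_zero[of x] by (auto simp: power2_eq_1_iff)
    with q show ?thesis by blast
  next
    case 3
    \<comment> \<open>The vector e built from c is orthogonal to p, and e' below is orthogonal to
      p'. Up to scaling they are dual to p' and p: each sees only one of the two
      coefficients.\<close>
    define c where "c = \<langle>p', p\<rangle> / \<langle>p, p\<rangle>"
    define e where "e = p' - c *\<^sub>C p"
    have p': "p' = e + c *\<^sub>C p" by (simp add: e_def)
    have e0: "e \<noteq> 0" using 3(2)[of c] by (auto simp: e_def)
    have eM: "e \<in> M" unfolding e_def by (intro Md M mem)
    have ep: "\<langle>e, p\<rangle> = 0" "\<langle>p, e\<rangle> = 0"
    proof -
      show "\<langle>e, p\<rangle> = 0" using 3 by (simp add: e_def c_def cinner_diff_left)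
      then show "\<langle>p, e\<rangle> = 0" using cinner_commute[of p e] by simp
    qed
    have ep': "\<langle>e, p'\<rangle> = \<langle>e, e\<rangle>" unfolding p' by (simp add: cinner_add_right ep)
    have "p' \<noteq> 0" using 3(2)[of 0] by simp
    define d where "d = \<langle>p, p'\<rangle> / \<langle>p', p'\<rangle>"
    define e' where "e' = p - d *\<^sub>C p'"
    have e'0: "e' \<noteq> 0"
    proof
      assume "e' = 0"
      then have "p = d *\<^sub>C p'" by (simp add: e'_def)
      moreover from this 3(1) have "d \<noteq> 0" by auto
      ultimately have "p' = (1 / d) *\<^sub>C p" by simp
      with 3(2) show False by blast
    qed
    have e'M: "e' \<in> M" unfolding e'_def by (intro Md M mem)
    have e'p': "\<langle>e', p'\<rangle> = 0" using \<open>p' \<noteq> 0\<close> by (simp add: e'_def d_def cinner_diff_left)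
    have e'p: "\<langle>e', p\<rangle> = \<langle>e', e'\<rangle>"
    proof -
      have "p = e' + d *\<^sub>C p'" by (simp add: e'_def)
      then have "\<langle>e', p\<rangle> = \<langle>e', e' + d *\<^sub>C p'\<rangle>" by (rule arg_cong)
      then show ?thesis by (simp add: cinner_add_right e'p')
    qed
    define y where "y = \<langle>q, e\<rangle> / \<langle>e, e\<rangle>"
    define x1 where "x1 = \<langle>q, p\<rangle> / \<langle>p, p\<rangle>"
    define f where "f = q - (y *\<^sub>C e + x1 *\<^sub>C p)"
    have "f \<in> M" unfolding f_def by (intro Md M mem eM)
    have fp: "\<langle>f, p\<rangle> = 0" using 3 by (simp add: f_def x1_def cinner_simps ep)
    have fe: "\<langle>f, e\<rangle> = 0" using e0 by (simp add: f_def y_def cinner_simps ep)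
    have "\<langle>f, p'\<rangle> = 0" unfolding p' by (simp add: cinner_add_right fp fe)
    then have "\<langle>f, q\<rangle> = 0" using \<open>f \<in> M\<close> fp by (intro perp)
    moreover have "\<langle>f, f\<rangle> = \<langle>f, q - (y *\<^sub>C e + x1 *\<^sub>C p)\<rangle>" by (simp only: f_def)
    ultimately have "\<langle>f, f\<rangle> = 0" by (simp add: cinner_diff_right cinner_add_right fp fe)
    then have q1: "q = y *\<^sub>C e + x1 *\<^sub>C p" by (simp add: f_def)
    \<comment> \<open>Passage from the orthogonal pair e, p back to p, p'.\<close>
    define x where "x = x1 - y * c"
    have q: "q = x *\<^sub>C p + y *\<^sub>C p'"
      unfolding q1 p' x_def by (simp add: l2.scale_left_diff_distrib l2.scale_right_distrib)
    have q': "q' = cnj x *\<^sub>C p' + cnj y *\<^sub>C p" by (rule conj[OF q])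
    define E where "E = (norm e)\<^sup>2"
    define E' where "E' = (norm e')\<^sup>2"
    have E: "E > 0" "E' > 0" using e0 e'0 by (auto simp: E_def E'_def)
    have eE: "\<langle>e, p'\<rangle> = complex_of_real E" "\<langle>e', p\<rangle> = complex_of_real E'"
      unfolding ep' e'p E_def E'_def by (simp_all only: cinner_self)
    have general: "(cmod s)\<^sup>2 + (cmod t)\<^sup>2 =
        ((cmod x)\<^sup>2 + (cmod y)\<^sup>2) * ((cmod s)\<^sup>2 + (cmod t)\<^sup>2) + 4 * Re (cnj x * y * s * cnj t)"
      if "g \<in> M" "s = \<langle>g, p\<rangle>" "t = \<langle>g, p'\<rangle>" for g s t
    proof -
      have "\<langle>g, q\<rangle> = cnj x * s + cnj y * t" "\<langle>g, q'\<rangle> = x * t + y * s"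
        unfolding q q' that by (simp_all add: cinner_add_right)
      then show ?thesis using form[OF that(1)] cmod_sq_identity[of x s y t] that by simp
    qed
    \<comment> \<open>At e the pairing with p is 0, so the cross term is absent and the diagonal
      part alone gives the normalization of x and y.\<close>
    have "E\<^sup>2 = ((cmod x)\<^sup>2 + (cmod y)\<^sup>2) * E\<^sup>2"
      using general[OF eM refl refl] by (simp add: ep eE)
    then have xy: "(cmod x)\<^sup>2 + (cmod y)\<^sup>2 = 1" using E by simp
    \<comment> \<open>The weights turn the cross term into |x|^2 |y|^2 E' E, which is real and
      nonnegative, so its real part can vanish only if x or y does.\<close>
    define g where "g = (x * cnj y) *\<^sub>C e' + e"
    have gM: "g \<in> M" unfolding g_def by (intro M e'M eM)
    have gs: "\<langle>g, p\<rangle> = x * cnj y * complex_of_real E'" "\<langle>g, p'\<rangle> = complex_of_real E"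
      by (simp_all add: g_def cinner_add_left ep e'p' eE)
    have "Re (cnj x * y * \<langle>g, p\<rangle> * cnj \<langle>g, p'\<rangle>) = 0"
      using general[OF gM refl refl] unfolding xy by simp
    moreover have "cnj x * y * \<langle>g, p\<rangle> * cnj \<langle>g, p'\<rangle> = complex_of_real ((cmod x)\<^sup>2 * (cmod y)\<^sup>2 * E' * E)"
      unfolding gs of_real_mult complex_norm_square by (simp add: mult_ac)
    ultimately have "(cmod x)\<^sup>2 * (cmod y)\<^sup>2 * E' * E = 0"
      by (simp only: Re_complex_of_real)
    then have "x = 0 \<or> y = 0" using E by simp
    then show ?thesis
    proof
      assume "x = 0"
      then have "cmod y = 1" using xy norm_ge_zero[of y] by (auto simp: power2_eq_1_iff)
      with q \<open>x = 0\<close> show ?thesis by auto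
    next
      assume "y = 0"
      then have "cmod x = 1" using xy norm_ge_zero[of x] by (auto simp: power2_eq_1_iff)
      with q \<open>y = 0\<close> show ?thesis by auto
    qed
  qed
qed


section \<open>Normality\<close>

lemma adjoint_on_cong:
  assumes "\<And>f. f \<in> K \<Longrightarrow> A f = B f"
  shows "adjoint_on K A = adjoint_on K B"
  unfolding adjoint_on_def using assms by (intro ext arg_cong[where f = The]) auto

text \<open>Operators are total functions whose values count on K only. The representation of A by a
  selfadjoint operator holds only there, so normality has to be transferred.\<close>

lemma normal_on_cong:
  assumes "\<And>f. f \<in> K \<Longrightarrow> A f = B f" "bounded_operator_on K A" "closed_csubspace K"
  shows "normal_on K A \<longleftrightarrow> normal_on K B"
proof -
  have eq: "adjoint_on K B = adjoint_on K A" by (rule adjoint_on_cong) (simp add: assms(1))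
  show ?thesis unfolding normal_on_def eq using assms(1) adjoint_on_in[OF assms(3,2)] by simp
qed

lemma normal_on_translate:
  assumes K: "closed_csubspace K" and A: "bounded_operator_on K A" and N: "normal_on K A"
  shows "normal_on K (\<lambda>f. a *\<^sub>C A f + b *\<^sub>C f)"
  unfolding normal_on_def
proof
  fix f assume f: "f \<in> K"
  note AD = bounded_operator_onD[OF A]
  note SD = bounded_operator_onD[OF bounded_operator_on_adjoint[OF K A]]
  note KD = closed_csubspaceD[OF K]
  define g where "g = adjoint_on K A f"
  have g: "g \<in> K" unfolding g_def by (rule SD(1)[OF f])
  have 1: "a *\<^sub>C A (cnj a *\<^sub>C g + cnj b *\<^sub>C f) + b *\<^sub>C (cnj a *\<^sub>C g + cnj b *\<^sub>C f) =
      (a * cnj a) *\<^sub>C A g + (a * cnj b) *\<^sub>C A f + ((b * cnj a) *\<^sub>C g + (b * cnj b) *\<^sub>C f)"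
    using f g by (simp add: AD KD l2.scale_right_distrib)
  have 2: "cnj a *\<^sub>C adjoint_on K A (a *\<^sub>C A f + b *\<^sub>C f) + cnj b *\<^sub>C (a *\<^sub>C A f + b *\<^sub>C f) =
      (a * cnj a) *\<^sub>C adjoint_on K A (A f) + (b * cnj a) *\<^sub>C g + ((a * cnj b) *\<^sub>C A f + (b * cnj b) *\<^sub>C f)"
    using f AD(1)[OF f] by (simp add: SD KD l2.scale_right_distrib g_def mult.commute)
  have "adjoint_on K A (A f) = A g" using N f by (simp add: normal_on_def g_def)
  moreover have "a *\<^sub>C A f + b *\<^sub>C f \<in> K" using f AD(1)[OF f] KD by simp
  ultimately show "a *\<^sub>C A (adjoint_on K (\<lambda>f. a *\<^sub>C A f + b *\<^sub>C f) f) +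
        b *\<^sub>C adjoint_on K (\<lambda>f. a *\<^sub>C A f + b *\<^sub>C f) f =
      adjoint_on K (\<lambda>f. a *\<^sub>C A f + b *\<^sub>C f) (a *\<^sub>C A f + b *\<^sub>C f)"
    using f 1 2 by (simp add: adjoint_on_translate[OF K A] g_def[symmetric])
qed

section \<open>From normalized symbols to the equivalent conditions\<close>

context inner_symbol
begin

lemma tto_real_symbol_selfadjoint:
  assumes A: "is_tto u \<sigma> A" and \<sigma>: "l2_cnj \<sigma> = \<sigma>"
  shows "selfadjoint_on K A"
  unfolding selfadjoint_on_def
proof
  note Ab = ttoD(1)[OF A]
  fix f assume f: "f \<in> K"
  show "adjoint_on K A f = A f"
  proof (rule K_total[OF adjoint_on_in[OF K_closed Ab f] bounded_operator_onD(1)[OF Ab f]])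
    fix h assume h: "h \<in> K" "l2_bdd h"
    have "\<langle>h, adjoint_on K A f\<rangle> = \<langle>\<sigma> \<odot> h, f\<rangle>"
      using cinner_adjoint_on[OF K_closed Ab f h(1)] ttoD(2)[OF A h f] by simp
    also have "\<dots> = \<langle>h, A f\<rangle>"
      using cinner_adjoint_on_left[OF K_closed Ab h(1) f] ttoD(2)[OF tto_adjoint[OF A] h f] \<sigma> by simp
    finally show "\<langle>h, adjoint_on K A f\<rangle> = \<langle>h, A f\<rangle>" .
  qed
qed

lemma const_cancel: "l2_const c + l2_const (- c) = 0"
  using to_L2_add[of "\<lambda>_. c" "\<lambda>_. - c"] by (simp add: to_L2_zero)

text \<open>The factor 1 keeps the shifted operator in the affine form of
  \<open>tto_translate\<close>, so the translation facts apply to it verbatim.\<close>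

lemma normalized_of_tto:
  assumes A: "is_tto u (\<psi> + l2_cnj \<eta> + l2_const c) A"
    and "\<psi> \<in> K" "\<langle>\<psi>, l2_one\<rangle> = 0" "\<eta> \<in> K" "\<langle>\<eta>, l2_one\<rangle> = 0"
  shows "normalized_tto u \<psi> \<eta> (\<lambda>f. 1 *\<^sub>C A f + (- c) *\<^sub>C f)"
proof
  have eq: "1 *\<^sub>C (\<psi> + l2_cnj \<eta> + l2_const c) + l2_const (- c) = \<psi> + l2_cnj \<eta>"
    using const_cancel[of c] by (simp add: add.assoc)
  show "is_tto u (\<psi> + l2_cnj \<eta>) (\<lambda>f. 1 *\<^sub>C A f + (- c) *\<^sub>C f)"
    using tto_translate[OF A, of 1 "- c"] unfolding eq .
qed (use assms in auto)

lemma normal_on_translate_iff: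
  assumes A: "bounded_operator_on K A"
  shows "normal_on K (\<lambda>f. 1 *\<^sub>C A f + (- c) *\<^sub>C f) \<longleftrightarrow> normal_on K A"
proof
  define B where "B f = 1 *\<^sub>C A f + (- c) *\<^sub>C f" for f
  have B: "bounded_operator_on K B"
    unfolding B_def by (rule bounded_operator_on_translate[OF K_closed A])
  assume "normal_on K (\<lambda>f. 1 *\<^sub>C A f + (- c) *\<^sub>C f)"
  then have "normal_on K (\<lambda>f. 1 *\<^sub>C B f + c *\<^sub>C f)"
    by (intro normal_on_translate[OF K_closed B]) (simp only: B_def[abs_def])
  moreover have "(\<lambda>f. 1 *\<^sub>C B f + c *\<^sub>C f) = A"
    by (rule ext) (simp add: B_def)
  ultimately show "normal_on K A" by simp
qed (rule normal_on_translate[OF K_closed A])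

lemma normal_imp_commutator_tto:
  assumes A: "bounded_operator_on K A" and N: "normal_on K A"
  shows "(\<lambda>f. A (adjoint_on K A f) - adjoint_on K A (A f)) \<in> ttos u"
proof -
  have "is_tto u 0 (\<lambda>f. A (adjoint_on K A f) - adjoint_on K A (A f))"
    unfolding is_tto_iff
  proof (intro conjI ballI impI)
    show "bounded_operator_on K (\<lambda>f. A (adjoint_on K A f) - adjoint_on K A (A f))"
      using N closed_csubspaceD[OF K_closed]
      by (auto simp: bounded_operator_on_def normal_on_def intro!: exI[of _ 0])
    show "\<langle>A (adjoint_on K A f) - adjoint_on K A (A f), g\<rangle> = \<langle>0 \<odot> f, g\<rangle>" if "f \<in> K" for f g
      using N that bdd_scale_mult[of 0 0 f] by (simp add: normal_on_def)
  qed
  then show ?thesis by (auto simp: ttos_def)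
qed

text \<open>Every truncated Toeplitz operator \<open>T\<close> satisfies \<open>C T C = T\<^sup>*\<close>, whereas conjugation by \<open>C\<close>
  reverses the sign of the self-commutator of \<open>A\<close>.\<close>

lemma commutator_tto_imp_normal:
  assumes A: "is_tto u \<phi> A"
    and N: "(\<lambda>f. A (adjoint_on K A f) - adjoint_on K A (A f)) \<in> ttos u"
  shows "normal_on K A"
proof -
  note Ab = ttoD(1)[OF A]
  note AD = bounded_operator_onD[OF Ab]
  note adj = adjoint_on_in[OF K_closed Ab] cinner_adjoint_on[OF K_closed Ab]
    cinner_adjoint_on_left[OF K_closed Ab]
  define T where "T f = A (adjoint_on K A f) - adjoint_on K A (A f)" for f
  obtain \<sigma> where T: "is_tto u \<sigma> T" using N by (auto simp: ttos_def T_def[abs_def])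
  define q where "q f = (norm (adjoint_on K A f))\<^sup>2 - (norm (A f))\<^sup>2" for f
  have q: "\<langle>T f, f\<rangle> = complex_of_real (q f)" if f: "f \<in> K" for f
    using f by (simp add: T_def q_def cinner_diff_left adj AD cinner_self)
  have "norm (adjoint_on K A f) = norm (A f)" if f: "f \<in> K" for f
  proof -
    have "\<langle>T f, f\<rangle> = \<langle>f, C (T (C f))\<rangle>"
      using cinner_adjoint_on[OF K_closed ttoD(1)[OF T] f f] tto_C_symmetric[OF T f] by simp
    also have "\<dots> = \<langle>T (C f), C f\<rangle>" by (metis C_C cinner_C_C)
    finally have "q f = q (C f)" unfolding q[OF f] q[OF C_in[OF f]] by (rule of_real_eq_iff[THEN iffD1])
    also have "q (C f) = - q f"
    proof -
      have "adjoint_on K A (C f) = C (A f)" using tto_C_symmetric[OF A C_in[OF f]] by simp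
      moreover have "A (C f) = C (adjoint_on K A f)" using tto_C_symmetric[OF A f] by simp
      ultimately show ?thesis by (simp add: q_def)
    qed
    finally have "q f = 0" by simp
    then show ?thesis by (simp add: q_def power2_eq_iff_nonneg)
  qed
  then show ?thesis by (simp add: normal_on_iff_norm[OF K_closed Ab])
qed

lemma selfadjoint_translate_imp_normal:
  assumes A: "bounded_operator_on K A" and B: "B \<in> ttos u" "selfadjoint_on K B"
    and eq: "\<forall>f\<in>K. A f = a *\<^sub>C B f + b *\<^sub>C f"
  shows "normal_on K A"
proof -
  have Bb: "bounded_operator_on K B" using B(1) ttoD(1) by (auto simp: ttos_def)
  have "normal_on K B"
    using B(2) bounded_operator_onD(1)[OF Bb] by (simp add: normal_on_def selfadjoint_on_def)
  then have "normal_on K (\<lambda>f. a *\<^sub>C B f + b *\<^sub>C f)" by (rule normal_on_translate[OF K_closed Bb])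
  then show ?thesis using normal_on_cong[OF _ A K_closed, of "\<lambda>f. a *\<^sub>C B f + b *\<^sub>C f"] eq by simp
qed

text \<open>The function in a Sedlock symbol need not vanish at the origin. Its component along k0
  contributes S C k0 to the symbol, and this lemma shows that contribution to be a multiple of
  k0.\<close>

lemma C_backshift_k0: "C (backshift k0) = - u0 *\<^sub>C k0"
proof -
  have "\<langle>k0, l2_one\<rangle> = 1 - cnj u0 * u0" by (simp add: k0_def cinner_diff_left u0_def)
  then have "backshift k0 = l2_cnj l2_z \<odot> (- cnj u0 *\<^sub>C (u - u0 *\<^sub>C l2_one))"
    by (simp add: backshift_def k0_def l2.scale_left_diff_distrib l2.scale_right_diff_distrib)
  then have "C (backshift k0) = u \<odot> l2_cnj (- cnj u0 *\<^sub>C (u - u0 *\<^sub>C l2_one))"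
    by (simp only: model_conj_def cnj_mult[OF l2_bdd_cnj[THEN iffD2, OF l2_bdd_z]] cnj_cnj
        unimodular_cancel[OF unimodular_z])
  also have "\<dots> = - u0 *\<^sub>C k0"
    unfolding J_scale by (simp add: cnj_diff cnj_scale mult_diff_right mult_scale_right unimodular_mult_cnj k0_def)
  finally show ?thesis .
qed

lemma sedlock_imp_normal:
  assumes \<alpha>: "cmod \<alpha> = 1" and A: "A \<in> sedlock_class u \<alpha>"
  shows "normal_on K A"
proof -
  obtain \<phi> c where \<phi>: "\<phi> \<in> K" and tto: "is_tto u (\<phi> + \<alpha> *\<^sub>C l2_cnj (S (C \<phi>)) + l2_const c) A"
    using A by (auto simp: sedlock_class_def)
  obtain \<psi> a where \<psi>: "\<psi> \<in> K" "\<langle>\<psi>, l2_one\<rangle> = 0" and dec: "\<phi> = \<psi> + a *\<^sub>C k0"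
    using H2_normal_form[OF K_H2[OF \<phi>]] \<phi> by metis
  define \<eta> where "\<eta> = cnj \<alpha> *\<^sub>C J \<psi>"
  \<comment> \<open>The coefficient of the conjugate of k0, obtained by conjugating cnj a (- u0) and
    multiplying by \<alpha>.\<close>
  define b where "b = - (\<alpha> * a * cnj u0)"
  have "S (C \<phi>) = C (backshift \<phi>)" by (rule S_C[OF \<phi>])
  also have "\<dots> = C (backshift \<psi>) + cnj a *\<^sub>C (- u0 *\<^sub>C k0)"
    unfolding dec backshift_add backshift_scale C_add C_scale C_backshift_k0 ..
  also have "C (backshift \<psi>) = J \<psi>" using J_eq_S_C[OF \<psi>] S_C[OF \<psi>(1)] by simp
  finally have "S (C \<phi>) = J \<psi> + cnj a *\<^sub>C (- u0 *\<^sub>C k0)" .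
  then have "\<phi> + \<alpha> *\<^sub>C l2_cnj (S (C \<phi>)) + l2_const c =
      \<psi> + l2_cnj \<eta> + a *\<^sub>C k0 + b *\<^sub>C l2_cnj k0 + l2_const c"
    by (simp add: dec \<eta>_def b_def cnj_add cnj_diff cnj_scale l2.scale_right_distrib
        l2.scale_right_diff_distrib mult_ac)
  \<comment> \<open>Modulo u H2 the function k0 is the constant 1, and its conjugate is 1 modulo the
    conjugates of u H2. So the components along k0 only change the constant of the symbol.\<close>
  also have "\<dots> = (\<psi> + l2_cnj \<eta> + l2_const (a + b + c)) + u \<odot> (- (a * cnj u0) *\<^sub>C l2_one)
      + l2_cnj (u \<odot> (- (cnj b * cnj u0) *\<^sub>C l2_one))"
  proof -
    have "l2_const (a + b + c) = a *\<^sub>C l2_one + b *\<^sub>C l2_one + l2_const c"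
      by (simp add: const_scale[of "a + b + c"] const_scale[of c] l2.scale_left_distrib)
    moreover have "a *\<^sub>C k0 = a *\<^sub>C l2_one + u \<odot> (- (a * cnj u0) *\<^sub>C l2_one)"
      unfolding mult_scale_right[OF u_bdd] by (simp add: k0_def l2.scale_right_diff_distrib)
    moreover have "b *\<^sub>C l2_cnj k0 = b *\<^sub>C l2_one + l2_cnj (u \<odot> (- (cnj b * cnj u0) *\<^sub>C l2_one))"
      unfolding mult_scale_right[OF u_bdd] cnj_scale
      by (simp add: k0_def cnj_diff cnj_scale l2.scale_right_diff_distrib)
    ultimately show ?thesis by (simp only: add_ac)
  qed
  finally have eq: "\<phi> + \<alpha> *\<^sub>C l2_cnj (S (C \<phi>)) + l2_const c = \<dots>" .
  have "is_tto u (\<psi> + l2_cnj \<eta> + l2_const (a + b + c)) A"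
    by (rule tto_symbol_change[OF tto _ _ eq]) (intro H2_subspace(3) one_H2)+
  then interpret nt: normalized_tto u \<psi> \<eta> "\<lambda>f. 1 *\<^sub>C A f + (- (a + b + c)) *\<^sub>C f"
    using \<psi> unfolding \<eta>_def
    by (intro normalized_of_tto K_subspace(3) J_in) (simp_all add: J_one)
  have "normal_on K (\<lambda>f. 1 *\<^sub>C A f + (- (a + b + c)) *\<^sub>C f)"
    unfolding normal_on_iff_norm[OF K_closed nt.A_bounded]
    by (intro ballI nt.norm_eq_of_J[OF \<eta>_def]) (simp_all add: \<alpha>)
  then show ?thesis using normal_on_translate_iff[OF ttoD(1)[OF tto]] by blast
qed

lemma normal_imp_sedlock_or_selfadjoint:
  assumes A: "is_tto u \<phi> A" and N: "normal_on K A"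
  shows "(\<exists>\<alpha>. cmod \<alpha> = 1 \<and> A \<in> sedlock_class u \<alpha>) \<or>
    (\<exists>B\<in>ttos u. selfadjoint_on K B \<and> (\<exists>a b. \<forall>f\<in>K. A f = a *\<^sub>C B f + b *\<^sub>C f))"
proof -
  obtain \<psi> \<eta> c where \<psi>: "\<psi> \<in> K" "\<langle>\<psi>, l2_one\<rangle> = 0" and \<eta>: "\<eta> \<in> K" "\<langle>\<eta>, l2_one\<rangle> = 0"
    and tto: "is_tto u (\<psi> + l2_cnj \<eta> + l2_const c) A"
    by (rule tto_normal_form[OF A])
  interpret nt: normalized_tto u \<psi> \<eta> "\<lambda>f. 1 *\<^sub>C A f + (- c) *\<^sub>C f"
    by (rule normalized_of_tto[OF tto \<psi> \<eta>])
  have "normal_on K (\<lambda>f. 1 *\<^sub>C A f + (- c) *\<^sub>C f)"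
    using normal_on_translate_iff[OF ttoD(1)[OF A]] N by blast
  then have n: "norm (nt.A' f) = norm (1 *\<^sub>C A f + (- c) *\<^sub>C f)" if "f \<in> K" for f
    unfolding normal_on_iff_norm[OF K_closed nt.A_bounded] using that by blast
  define M where "M = {f \<in> K. \<langle>f, l2_one\<rangle> = 0}"
  have "(\<exists>x. cmod x = 1 \<and> \<eta> = x *\<^sub>C \<psi>) \<or> (\<exists>y. cmod y = 1 \<and> \<eta> = y *\<^sub>C J \<psi>)"
  proof (rule rank_two_forms_eq[where M = M and q' = "J \<eta>"])
    show "\<psi> \<in> M" "\<eta> \<in> M" using \<psi> \<eta> by (auto simp: M_def)
    show "J \<psi> \<in> M" using \<psi> J_in J_one by (simp add: M_def)
    show "f + g \<in> M" if "f \<in> M" "g \<in> M" for f g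
      using that K_subspace(2) by (simp add: M_def cinner_add_left)
    show "a *\<^sub>C f \<in> M" if "f \<in> M" for a f
      using that K_subspace(3) by (simp add: M_def)
    show "(cmod \<langle>f, \<psi>\<rangle>)\<^sup>2 + (cmod \<langle>f, J \<psi>\<rangle>)\<^sup>2 = (cmod \<langle>f, \<eta>\<rangle>)\<^sup>2 + (cmod \<langle>f, J \<eta>\<rangle>)\<^sup>2"
      if "f \<in> M" for f
      using that nt.norm_eq_imp_rank_two[OF n, of f] by (simp add: M_def)
    show "J \<eta> = cnj x *\<^sub>C J \<psi> + cnj y *\<^sub>C \<psi>" if "\<eta> = x *\<^sub>C \<psi> + y *\<^sub>C J \<psi>" for x y
      unfolding that J_add J_scale J_J ..
    show "J \<psi> = 0" if "\<psi> = 0"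
      using J_scale[of 0 0] that by simp
  qed
  then show ?thesis
  proof (elim disjE exE conjE)
    fix y assume y: "cmod y = 1" "\<eta> = y *\<^sub>C J \<psi>"
    \<comment> \<open>Since \<psi> vanishes at the origin, J \<psi> is S C \<psi>, and conjugating
      \<eta> = y J \<psi> turns the factor y into cnj y.\<close>
    have "A \<in> sedlock_class u (cnj y)"
      unfolding sedlock_class_def
    proof (intro CollectI conjI bexI exI)
      show "A \<in> ttos u" using A by (auto simp: ttos_def)
      show "is_tto u (\<psi> + cnj y *\<^sub>C l2_cnj (S (C \<psi>)) + l2_const c) A"
        using tto unfolding J_eq_S_C[OF \<psi>] y(2) cnj_scale .
    qed (rule \<psi>(1))
    then show ?thesis using y by (intro disjI1 exI[of _ "cnj y"]) simp
  next
    fix x assume x: "cmod x = 1" "\<eta> = x *\<^sub>C \<psi>"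
    \<comment> \<open>A square root of x distributes the rotation evenly: g cnj x = cnj g, so g
      times the symbol \<psi> + cnj (x \<psi>) becomes g \<psi> plus its own conjugate, a real
      symbol.\<close>
    define g where "g = csqrt x"
    have "g\<^sup>2 = x" by (simp add: g_def)
    moreover have g1: "cmod g = 1" using x by (simp add: g_def norm_csqrt)
    moreover have gg: "g * cnj g = 1" using complex_norm_square[of g] g1 by simp
    ultimately have gx: "g * cnj x = cnj g"
      by (metis complex_cnj_power mult.assoc mult.left_neutral power2_eq_square)
    \<comment> \<open>B is g (A - c). As g is unimodular, A is recovered as cnj g B + c.\<close>
    define B where "B f = g *\<^sub>C A f + (- (g * c)) *\<^sub>C f" for f
    have sym: "g *\<^sub>C (\<psi> + l2_cnj \<eta> + l2_const c) + l2_const (- (g * c)) = g *\<^sub>C \<psi> + l2_cnj (g *\<^sub>C \<psi>)"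
    proof -
      have "g *\<^sub>C l2_const c = l2_const (g * c)"
        by (simp add: const_scale[of c] const_scale[of "g * c"])
      then show ?thesis
        using const_cancel[of "g * c"] gx
        by (simp add: l2.scale_right_distrib x(2) cnj_scale add.assoc)
    qed
    have B: "is_tto u (g *\<^sub>C \<psi> + l2_cnj (g *\<^sub>C \<psi>)) B"
      using tto_translate[OF tto, of g "- (g * c)"] unfolding sym B_def[abs_def] .
    have "selfadjoint_on K B"
      by (rule tto_real_symbol_selfadjoint[OF B]) (simp add: cnj_add add.commute)
    moreover have "A f = cnj g *\<^sub>C B f + c *\<^sub>C f" for f
      using gg by (simp add: B_def l2.scale_right_diff_distrib mult.assoc[symmetric] mult.commute[of "cnj g"])
    moreover have "B \<in> ttos u" using B by (auto simp: ttos_def)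
    ultimately show ?thesis by blast
  qed
qed

end

theorem theorem6p2:
  fixes u \<phi> :: ltwo and A :: "ltwo \<Rightarrow> ltwo"
  assumes "inner_function u"
    and "is_tto u \<phi> A"
  shows "(normal_on (model_space u) A \<longleftrightarrow>
            (\<lambda>f. A (adjoint_on (model_space u) A f) - adjoint_on (model_space u) A (A f)) \<in> ttos u)
       \<and> ((\<lambda>f. A (adjoint_on (model_space u) A f) - adjoint_on (model_space u) A (A f)) \<in> ttos u \<longleftrightarrow>
            (\<exists>\<alpha>. cmod \<alpha> = 1 \<and> A \<in> sedlock_class u \<alpha>) \<or>
            (\<exists>B\<in>ttos u. selfadjoint_on (model_space u) B \<and> (\<exists>a b. \<forall>f\<in>model_space u. A f = a *\<^sub>C B f + b *\<^sub>C f)))"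
proof -
  interpret inner_symbol u by standard (fact assms(1))
  note Ab = ttoD(1)[OF assms(2)]
  have "normal_on K A \<longleftrightarrow> (\<lambda>f. A (adjoint_on K A f) - adjoint_on K A (A f)) \<in> ttos u"
    using normal_imp_commutator_tto[OF Ab] commutator_tto_imp_normal[OF assms(2)] by blast
  moreover have "normal_on K A \<longleftrightarrow> (\<exists>\<alpha>. cmod \<alpha> = 1 \<and> A \<in> sedlock_class u \<alpha>) \<or>
      (\<exists>B\<in>ttos u. selfadjoint_on K B \<and> (\<exists>a b. \<forall>f\<in>K. A f = a *\<^sub>C B f + b *\<^sub>C f))"
    using normal_imp_sedlock_or_selfadjoint[OF assms(2)] sedlock_imp_normal
      selfadjoint_translate_imp_normal[OF Ab] by blast
  ultimately show ?thesis by blast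
qed

end
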